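(* Let $y$ be the unique solution of the weighted Toeplitz regularized least-squares problem $$\min_{y\in\mathbb R^n}\left\|\begin{bmatrix}W^{1/2}Q\\ \sqrt\lambda I_n\end{bmatrix}y-\begin{bmatrix}W^{1/2}f\\ \mathbf 0\end{bmatrix}\right\|_2^2,$$ and let $\mathbf r=W(f-Qy)$. Then the structured normwise, mixed and componentwise condition numbers of $y$ are, respectively, $$\mathscr K^{rls}(y;\mathcal E)=\frac{\left\|\begin{bmatrix}(\mathbf r^{\mathsf T}\otimes\widetilde K)\Phi_{\mathcal S_m}\mathfrak D_{\mathcal S_m}^{-1}&(\widetilde K\otimes y^{\mathsf T}+\mathbf r^{\mathsf T}\otimes\widetilde S^{-1})\Phi_{\mathcal T_{nm}}\mathfrak D_{\mathcal T_{nm}}^{-1}&y^{\mathsf T}\otimes\widetilde S^{-1}&-\widetilde K&-\widetilde S^{-1}\end{bmatrix}\right\|_2}{\|y\|_2\,/\left\|\begin{bmatrix}\widehat{\mathcal M}&\mathbf d\end{bmatrix}\right\|_F},$$ $$\mathscr M^{rls}(y;\mathcal E)=\frac{\|\mathcal N_y\|_\infty}{\|y\|_\infty},\qquad \mathscr C^{rls}(y;\mathcal E)=\left\|\mathbf D_y^\dagger\mathcal N_y\right\|_\infty,$$ where $$\mathcal N_y=|(\mathbf r^{\mathsf T}\otimes\widetilde K)\Phi_{\mathcal S_m}|\,\mathrm{vec}_{\mathcal S}(|A|)+|(\widetilde K\otimes y^{\mathsf T}+\mathbf r^{\mathsf T}\otimes\widetilde S^{-1})\Phi_{\mathcal T_{nm}}|\,\mathrm{vec}_{\mathcal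 T}(|Q^{\mathsf T}|)+|\widetilde S^{-1}||D||y|+|\widetilde K||f|,$$ $\widetilde K=-\widetilde S^{-1}Q^{\mathsf T}W$, $\widetilde S=-(\lambda I_n+Q^{\mathsf T}WQ)$, $A=W^{-1}$, $D=-\lambda I_n$, $\widehat{\mathcal M}=\begin{bmatrix}W^{-1}&Q\\ Q^{\mathsf T}&-\lambda I_n\end{bmatrix}$ and $\mathbf d=\begin{bmatrix}f\\ \mathbf 0\end{bmatrix}$.
   Context: Notation: $\|\cdot\|_2$ is the Euclidean norm of a vector / spectral norm of a matrix, $\|\cdot\|_\infty$ the infinity norm, $\|\cdot\|_F$ the Frobenius norm. $|X|$ is the entrywise absolute value, and $X\le Y$ for matrices is entrywise. $\mathrm{vec}$ stacks columns, $\otimes$ is the Kronecker product. For a vector $v$, $\mathbf D_v$ is the diagonal matrix with diagonal $v$; $\dagger$ is the Moore-Penrose inverse. Quotients of vectors are entrywise, with $0/0=0$ and $a/0=\infty$ for $a\ne0$. Setting: $Q\in\mathbb R^{m\times n}$ ($m\ge n$) is a full rank Toeplitz matrix, $W\in\mathbb R^{m\times m}$ is symmetric positive definite, $\lambda>0$, $f\in\mathbb R^m$. The problem is equivalent to the augmented system $\widehat{\mathcal M}\begin{bmatrix}\mathbf r\\ y\end{bmatrix}=\begin{bmatrix}W^{-1}&Q\\ Q^{\mathsf T}&-\lambda I_n\end{bmatrix}\begin{bmatrix}\mathbf r\\ y\end{bmatrix}=\begin{bmatrix}f\\ \mathbf 0\end{bmatrix}$, i.e. the generalized saddle point problem $\begin{bmatrix}A&B^{\mathsf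 T}\\ B&D\end{bmatrix}\begin{bmatrix}x\\ y\end{bmatrix}=\begin{bmatrix}f\\ g\end{bmatrix}$ with $A=W^{-1}$, $B=Q^{\mathsf T}$, $D=-\lambda I_n$, $x=\mathbf r$, $g=\mathbf 0$. Standing assumptions: $[x^{\mathsf T},y^{\mathsf T}]^{\mathsf T}\neq\mathbf 0$ for the mixed condition number, all $x_i\ne0$ and $y_i\ne0$ for the componentwise one, and, as required for the condition numbers to be defined, $y\neq\mathbf 0$. Symmetric structure: $\mathcal S_m$ is the space of symmetric $m\times m$ real matrices, $p=m(m+1)/2$, and $\mathrm{vec}_{\mathcal S}(A)=[a_{11},\dots,a_{1m},a_{22},\dots,a_{2m},\dots,a_{(m-1)(m-1)},a_{(m-1)m},a_{mm}]^{\mathsf T}\in\mathbb R^p$. With $e_i$ the columns of $I_m$, $S_{ii}=e_ie_i^{\mathsf T}$ and $S_{ij}=e_ie_j^{\mathsf T}+e_je_i^{\mathsf T}$ for $i<j$; $\Phi_{\mathcal S_m}\in\mathbb R^{m^2\times p}$ has columns $\mathrm{vec}(S_{ij})$, $i\le j$, in the same order as the entries of $\mathrm{vec}_{\mathcal S}$. $\mathfrak D_{\mathcal S_m}\in\mathbb R^{p\times p}$ is diagonal with entry $1$ at positions corresponding to diagonal entries $a_{ii}$ and $\sqrt2$ elsewhere. Toeplitz structure: $\mathcal T^{n\times m}$ is the space of $n\times m$ real Toeplitz matrices $T=[t_{j-i}]$, with $\mathrm{vec}_{\mathcal T}(T)=[t_{-n+1},\dots,t_0,\dots,t_{m-1}]^{\mathsf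 T}\in\mathbb R^{m+n-1}$. For $-n+1\le i\le m-1$, $\mathcal J_i$ is the $n\times m$ Toeplitz matrix with $t_i=1$ and all other $t_l=0$; $\Phi_{\mathcal T_{nm}}=[\mathrm{vec}(\mathcal J_{-n+1}),\dots,\mathrm{vec}(\mathcal J_{m-1})]$. $\mathfrak D_{\mathcal T_{nm}}\in\mathbb R^{(m+n-1)\times(m+n-1)}$ is the diagonal matrix with $\mathfrak D_{\mathcal T_{nm}}(j,j)=\mathbf a_j$, where $$\mathbf a=[1,\sqrt2,\dots,\sqrt{n-1},\sqrt{\min\{m,n\}},\sqrt{m-1},\dots,\sqrt2,1]^{\mathsf T}\in\mathbb R^{m+n-1},$$ such that $\|T\|_F=\|\mathfrak D_{\mathcal T_{nm}}\mathrm{vec}_{\mathcal T}(T)\|_2$. $\mathcal E=\left\{\begin{bmatrix}A&\mathbf 0\\ B&D\end{bmatrix}:A\in\mathcal S_m,\ B\in\mathcal T^{n\times m},\ D\in\mathbb R^{n\times n}\right\}$. Condition numbers: the structured condition numbers of $y$ are those of the generalized saddle point problem above for the linear function $\begin{bmatrix}\mathbf 0&I_n\end{bmatrix}[x^{\mathsf T},y^{\mathsf T}]^{\mathsf T}=y$. With $\mathbf H=\begin{bmatrix}A&\mathbf 0\\ B&D\end{bmatrix}$, $\Delta\mathbf H=\begin{bmatrix}\Delta A&\mathbf 0\\ \Delta B&\Delta D\end{bmatrix}$, $\Delta\mathbf d=\begin{bmatrix}\Delta f\\ \Delta g\end{bmatrix}$, let $[(x+\Delta x)^{\mathsf T},(y+\Delta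 y)^{\mathsf T}]^{\mathsf T}$ be the unique solution (for small perturbations) of $\begin{bmatrix}A+\Delta A&(B+\Delta B)^{\mathsf T}\\ B+\Delta B&D+\Delta D\end{bmatrix}\begin{bmatrix}x+\Delta x\\ y+\Delta y\end{bmatrix}=\begin{bmatrix}f+\Delta f\\ g+\Delta g\end{bmatrix}$. The structured normwise, mixed and componentwise condition numbers are, respectively, $$\lim_{\eta\to0}\sup\left\{\frac{\|\Delta y\|_2}{\eta\|y\|_2}:\|[\Delta\mathbf H\ \ \Delta\mathbf d]\|_F\le\eta\|[\mathbf H\ \ \mathbf d]\|_F,\ \Delta\mathbf H\in\mathcal E\right\},$$ $$\lim_{\eta\to0}\sup\left\{\frac{\|\Delta y\|_\infty}{\eta\|y\|_\infty}:|[\Delta\mathbf H\ \ \Delta\mathbf d]|\le\eta|[\mathbf H\ \ \mathbf d]|,\ \Delta\mathbf H\in\mathcal E\right\},$$ $$\lim_{\eta\to0}\sup\left\{\frac1\eta\left\|\frac{\Delta y}{y}\right\|_\infty:|[\Delta\mathbf H\ \ \Delta\mathbf d]|\le\eta|[\mathbf H\ \ \mathbf d]|,\ \Delta\mathbf H\in\mathcal E\right\}.$$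
   Formalization: The normwise value, as defined, has ‖[H d]‖_F instead of ‖[M̂ d]‖_F (the displayed value is proved for perturbations scaled by ‖[M̂ d]‖_F), and for m>n+1 the Toeplitz weights a are corrected to the square roots of the diagonal lengths, so that ‖T‖_F=‖D vec(T)‖_2 holds. *)

theory Defs
  imports
    "HOL-Library.Extended_Real"
    "Jordan_Normal_Form.Gauss_Jordan_Elimination"
    "Jordan_Normal_Form.DL_Rank"
begin

section \<open>Matrix notions\<close>

definition norm2_vec :: "real vec \<Rightarrow> real" where
  "norm2_vec v = sqrt (v \<bullet> v)"

definition norm_inf_vec :: "real vec \<Rightarrow> real" where
  "norm_inf_vec v = Max (insert 0 {\<bar>v $ i\<bar> | i. i < dim_vec v})"

definition frobenius_norm :: "real mat \<Rightarrow> real" where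
  "frobenius_norm A = sqrt (\<Sum>i<dim_row A. \<Sum>j<dim_col A. (A $$ (i,j))\<^sup>2)"

definition spectral_norm :: "real mat \<Rightarrow> real" where
  "spectral_norm A =
     (SUP v\<in>{v \<in> carrier_vec (dim_col A). norm2_vec v \<le> 1}. norm2_vec (A *\<^sub>v v))"

abbreviation abs_mat :: "real mat \<Rightarrow> real mat" where
  "abs_mat A \<equiv> map_mat abs A"

abbreviation abs_vec :: "real vec \<Rightarrow> real vec" where
  "abs_vec v \<equiv> map_vec abs v"

definition entrywise_le :: "real mat \<Rightarrow> real mat \<Rightarrow> bool" where
  "entrywise_le X Y \<longleftrightarrow> dim_row X = dim_row Y \<and> dim_col X = dim_col Y \<and>
     (\<forall>i<dim_row X. \<forall>j<dim_col X. X $$ (i,j) \<le> Y $$ (i,j))"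

text \<open>Only meaningful for invertible square matrices.\<close>

definition mat_inv :: "real mat \<Rightarrow> real mat" where
  "mat_inv A = the (mat_inverse A)"

text \<open>The Moore--Penrose inverse, through the four Penrose conditions.\<close>

definition pseudo_inverse :: "real mat \<Rightarrow> real mat" where
  "pseudo_inverse A = (THE X. X \<in> carrier_mat (dim_col A) (dim_row A) \<and>
     A * X * A = A \<and> X * A * X = X \<and> (A * X)\<^sup>T = A * X \<and> (X * A)\<^sup>T = X * A)"

definition symmetric_mats :: "nat \<Rightarrow> real mat set" where
  "symmetric_mats m = {A \<in> carrier_mat m m. A\<^sup>T = A}"

definition spd_mat :: "nat \<Rightarrow> real mat \<Rightarrow> bool" where
  "spd_mat m A \<longleftrightarrow> A \<in> symmetric_mats m \<and>
     (\<forall>v\<in>carrier_vec m. v \<noteq> 0\<^sub>v m \<longrightarrow> v \<bullet> (A *\<^sub>v v) > 0)"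

definition toeplitz_of :: "nat \<Rightarrow> nat \<Rightarrow> (int \<Rightarrow> real) \<Rightarrow> real mat" where
  "toeplitz_of nr nc t = mat nr nc (\<lambda>(i,j). t (int j - int i))"

definition toeplitz_mats :: "nat \<Rightarrow> nat \<Rightarrow> real mat set" where
  "toeplitz_mats nr nc = range (toeplitz_of nr nc)"

definition stack_cols :: "real mat \<Rightarrow> real vec" where
  "stack_cols X = vec (dim_row X * dim_col X) (\<lambda>k. X $$ (k mod dim_row X, k div dim_row X))"

definition kronecker :: "real mat \<Rightarrow> real mat \<Rightarrow> real mat" (infixl \<open>\<otimes>\<^sub>K\<close> 70) where
  "A \<otimes>\<^sub>K B = mat (dim_row A * dim_row B) (dim_col A * dim_col B)
     (\<lambda>(i,j). A $$ (i div dim_row B, j div dim_col B) * B $$ (i mod dim_row B, j mod dim_col B))"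

definition row_mat :: "real vec \<Rightarrow> real mat" where
  "row_mat v = mat_of_rows (dim_vec v) [v]"

definition append_cols :: "real mat \<Rightarrow> real mat \<Rightarrow> real mat" (infixr \<open>@\<^sub>c\<close> 65) where
  "A @\<^sub>c B = mat_of_cols (dim_row A) (cols A @ cols B)"

definition append_col :: "real mat \<Rightarrow> real vec \<Rightarrow> real mat" where
  "append_col A v = mat_of_cols (dim_row A) (cols A @ [v])"

section \<open>Coordinates on symmetric and Toeplitz matrices\<close>

definition sym_pairs :: "nat \<Rightarrow> (nat \<times> nat) list" where
  "sym_pairs m = [(i,j). i \<leftarrow> [0..<m], j \<leftarrow> [i..<m]]"

definition vec_sym :: "real mat \<Rightarrow> real vec" where
  "vec_sym A = vec_of_list (map (\<lambda>(i,j). A $$ (i,j)) (sym_pairs (dim_row A)))"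

definition sym_unit :: "nat \<Rightarrow> nat \<times> nat \<Rightarrow> real mat" where
  "sym_unit m p = mat m m (\<lambda>(k,l). if (k,l) = p \<or> (l,k) = p then 1 else 0)"

definition Phi_sym :: "nat \<Rightarrow> real mat" where
  "Phi_sym m = mat_of_cols (m * m) (map (\<lambda>p. stack_cols (sym_unit m p)) (sym_pairs m))"

definition weight_sym :: "nat \<Rightarrow> real mat" where
  "weight_sym m = mat_diag (length (sym_pairs m))
     (\<lambda>k. case sym_pairs m ! k of (i,j) \<Rightarrow> if i = j then 1 else sqrt 2)"

definition toep_indices :: "nat \<Rightarrow> nat \<Rightarrow> int list" where
  "toep_indices nr nc = [1 - int nr .. int nc - 1]"

text \<open>The entry \<open>t\<^sub>k\<close> of a Toeplitz matrix is read off its first column if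
  \<open>k \<le> 0\<close> and off its first row if \<open>k \<ge> 0\<close>.\<close>

definition vec_toep :: "real mat \<Rightarrow> real vec" where
  "vec_toep T = vec_of_list
     (map (\<lambda>k. T $$ (nat (- k), nat k)) (toep_indices (dim_row T) (dim_col T)))"

definition Phi_toep :: "nat \<Rightarrow> nat \<Rightarrow> real mat" where
  "Phi_toep nr nc = mat_of_cols (nr * nc)
     (map (\<lambda>k. stack_cols (toeplitz_of nr nc (\<lambda>l. if l = k then 1 else 0))) (toep_indices nr nc))"

text \<open>The weights are the square roots of the lengths of the successive diagonals,
  \<open>1, \<surd>2, \<dots>, \<surd>(min nr nc), \<dots>, \<surd>2, 1\<close>, where the value \<open>\<surd>(min nr nc)\<close> is repeated on all
  diagonals of full length. They are the weights for which \<open>frobenius_norm_toeplitz\<close> below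
  holds. A list that continues with \<open>\<surd>(nc - 1)\<close> right after \<open>\<surd>(min nr nc)\<close> agrees
  with them if \<open>nr \<le> nc \<le> nr + 1\<close>, but violates that identity if \<open>nc > nr + 1\<close>.\<close>

definition weight_toep :: "nat \<Rightarrow> nat \<Rightarrow> real mat" where
  "weight_toep nr nc = mat_diag (nr + nc - 1)
     (\<lambda>j. sqrt (real (min (min (j + 1) (nr + nc - 1 - j)) (min nr nc))))"

section \<open>Structured condition numbers of a generalized saddle point problem\<close>

definition saddle_mat :: "real mat \<Rightarrow> real mat \<Rightarrow> real mat \<Rightarrow> real mat" where
  "saddle_mat A B D = four_block_mat A (B\<^sup>T) B D"

definition saddle_data :: "real mat \<Rightarrow> real mat \<Rightarrow> real mat \<Rightarrow> real mat" where
  "saddle_data A B D = four_block_mat A (0\<^sub>m (dim_row A) (dim_col D)) B D"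

definition sym_toep_structure :: "nat \<Rightarrow> nat \<Rightarrow> real mat set" where
  "sym_toep_structure m n =
     {saddle_data A B D | A B D. A \<in> symmetric_mats m \<and> B \<in> toeplitz_mats n m \<and> D \<in> carrier_mat n n}"

definition unique_solution :: "real mat \<Rightarrow> real vec \<Rightarrow> real vec \<Rightarrow> bool" where
  "unique_solution M b z \<longleftrightarrow> z \<in> carrier_vec (dim_col M) \<and> M *\<^sub>v z = b \<and>
     (\<forall>z'\<in>carrier_vec (dim_col M). M *\<^sub>v z' = b \<longrightarrow> z' = z)"

text \<open>The changes \<open>dy\<close> of the solution component \<open>y\<close> under perturbations of the data whose
  matrix part has structure \<open>E\<close> and whose size \<open>[\<Delta>H \<Delta>d]\<close> satisfies the constraint \<open>C\<close>.\<close>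

definition solution_changes ::
  "real mat set \<Rightarrow> real mat \<Rightarrow> real mat \<Rightarrow> real mat \<Rightarrow> real vec \<Rightarrow> real vec \<Rightarrow> real vec \<Rightarrow> real vec
   \<Rightarrow> (real mat \<Rightarrow> bool) \<Rightarrow> real vec set" where
  "solution_changes E A B D f g x y C =
     (let m = dim_row A; n = dim_row D in
      {dy \<in> carrier_vec n. \<exists>dA\<in>carrier_mat m m. \<exists>dB\<in>carrier_mat n m. \<exists>dD\<in>carrier_mat n n.
         \<exists>df\<in>carrier_vec m. \<exists>dg\<in>carrier_vec n. \<exists>dx\<in>carrier_vec m.
           saddle_data dA dB dD \<in> E \<and>
           C (append_col (saddle_data dA dB dD) (df @\<^sub>v dg)) \<and>
           unique_solution (saddle_mat (A + dA) (B + dB) (D + dD))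
             ((f + df) @\<^sub>v (g + dg)) ((x + dx) @\<^sub>v (y + dy))})"

text \<open>A condition number is the limit, as \<open>\<eta>\<close> decreases to \<open>0\<close>, of extended real suprema.
  The predicates say that this limit exists and equals \<open>\<kappa>\<close>. In the normwise case \<open>\<rho>\<close> is
  the size of the data to which the perturbations are compared: \<open>has_normwise_cond\<close> takes
  the Frobenius norm of \<open>[H d]\<close>, in which the block \<open>B\<close> is counted once; comparing with the
  full saddle point matrix, where \<open>B\<close> is counted twice, gives a different condition number.\<close>

definition has_normwise_cond_rel ::
  "real \<Rightarrow> real mat set \<Rightarrow> real mat \<Rightarrow> real mat \<Rightarrow> real mat \<Rightarrow> real vec \<Rightarrow> real vec \<Rightarrow> real vec \<Rightarrow> real vec
   \<Rightarrow> ereal \<Rightarrow> bool" where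
  "has_normwise_cond_rel \<rho> E A B D f g x y \<kappa> \<longleftrightarrow>
     ((\<lambda>\<eta>. SUP dy\<in>solution_changes E A B D f g x y (\<lambda>P. frobenius_norm P \<le> \<eta> * \<rho>).
         ereal (norm2_vec dy / (\<eta> * norm2_vec y))) \<longlongrightarrow> \<kappa>) (at_right 0)"

definition has_normwise_cond ::
  "real mat set \<Rightarrow> real mat \<Rightarrow> real mat \<Rightarrow> real mat \<Rightarrow> real vec \<Rightarrow> real vec \<Rightarrow> real vec \<Rightarrow> real vec
   \<Rightarrow> ereal \<Rightarrow> bool" where
  "has_normwise_cond E A B D f g x y \<kappa> \<longleftrightarrow>
     has_normwise_cond_rel (frobenius_norm (append_col (saddle_data A B D) (f @\<^sub>v g)))
       E A B D f g x y \<kappa>"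

definition componentwise_small ::
  "real mat \<Rightarrow> real mat \<Rightarrow> real mat \<Rightarrow> real vec \<Rightarrow> real vec \<Rightarrow> real \<Rightarrow> real mat \<Rightarrow> bool" where
  "componentwise_small A B D f g \<eta> P \<longleftrightarrow>
     entrywise_le (abs_mat P) (\<eta> \<cdot>\<^sub>m abs_mat (append_col (saddle_data A B D) (f @\<^sub>v g)))"

definition has_mixed_cond ::
  "real mat set \<Rightarrow> real mat \<Rightarrow> real mat \<Rightarrow> real mat \<Rightarrow> real vec \<Rightarrow> real vec \<Rightarrow> real vec \<Rightarrow> real vec
   \<Rightarrow> ereal \<Rightarrow> bool" where
  "has_mixed_cond E A B D f g x y \<kappa> \<longleftrightarrow>
     ((\<lambda>\<eta>. SUP dy\<in>solution_changes E A B D f g x y (componentwise_small A B D f g \<eta>).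
         ereal (norm_inf_vec dy / (\<eta> * norm_inf_vec y))) \<longlongrightarrow> \<kappa>) (at_right 0)"

text \<open>The quotients \<open>a/0\<close> follow the convention \<open>0/0 = 0\<close> and \<open>a/0 = \<infinity>\<close> for \<open>a \<noteq> 0\<close>.\<close>

definition entry_quotient :: "real \<Rightarrow> real \<Rightarrow> ereal" where
  "entry_quotient a b = (if b \<noteq> 0 then ereal (a / b) else if a = 0 then 0 else \<infinity>)"

definition quotient_norm_inf :: "real vec \<Rightarrow> real vec \<Rightarrow> ereal" where
  "quotient_norm_inf u v = Max (insert 0 {\<bar>entry_quotient (u $ i) (v $ i)\<bar> | i. i < dim_vec v})"

definition has_componentwise_cond ::
  "real mat set \<Rightarrow> real mat \<Rightarrow> real mat \<Rightarrow> real mat \<Rightarrow> real vec \<Rightarrow> real vec \<Rightarrow> real vec \<Rightarrow> real vec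
   \<Rightarrow> ereal \<Rightarrow> bool" where
  "has_componentwise_cond E A B D f g x y \<kappa> \<longleftrightarrow>
     ((\<lambda>\<eta>. SUP dy\<in>solution_changes E A B D f g x y (componentwise_small A B D f g \<eta>).
         ereal (1 / \<eta>) * quotient_norm_inf dy y) \<longlongrightarrow> \<kappa>) (at_right 0)"

section \<open>The Toeplitz weights\<close>

lemma card_diagonal:
  assumes "d < nr + nc - 1"
  shows "card {(i,j). i < nr \<and> j < nc \<and> j + (nr - 1) - i = (d::nat)}
       = min (min (d + 1) (nr + nc - 1 - d)) (min nr nc)"
proof -
  let ?lo = "nr - 1 - d" and ?hi = "min nr (nr + nc - 1 - d)"
  have "bij_betw (\<lambda>i. (i, d + i - (nr - 1))) {?lo..<?hi}
      {(i,j). i < nr \<and> j < nc \<and> j + (nr - 1) - i = d}"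
    by (rule bij_betw_byWitness[where f' = fst]) (use assms in auto)
  then have "card {(i,j). i < nr \<and> j < nc \<and> j + (nr - 1) - i = d} = card {?lo..<?hi}"
    by (rule bij_betw_same_card[symmetric])
  moreover have "?hi - ?lo = min (min (d + 1) (nr + nc - 1 - d)) (min nr nc)"
    using assms by linarith
  ultimately show ?thesis
    by simp
qed

lemma frobenius_norm_toeplitz:
  assumes T: "T \<in> toeplitz_mats nr nc" and pos: "0 < nr" "0 < nc"
  shows "frobenius_norm T = norm2_vec (weight_toep nr nc *\<^sub>v vec_toep T)"
proof -
  obtain t where t: "T = toeplitz_of nr nc t"
    using T by (auto simp: toeplitz_mats_def)
  let ?N = "nr + nc - 1"
  let ?len = "\<lambda>d. min (min (d + 1) (?N - d)) (min nr nc)"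
  let ?t = "\<lambda>d. t (int d - int (nr - 1))"
  have len: "length (toep_indices nr nc) = ?N"
    using pos by (simp add: toep_indices_def)
  have entry: "vec_toep T $ d = ?t d" if "d < ?N" for d
  proof -
    have "toep_indices nr nc ! d = int d - int (nr - 1)"
      using that pos by (simp add: toep_indices_def of_nat_diff)
    moreover have "vec_toep T $ d = T $$ (nat (- (toep_indices nr nc ! d)), nat (toep_indices nr nc ! d))"
      using that len by (simp add: vec_toep_def t toeplitz_of_def flip: vec_of_list_index)
    moreover have "nat (- (int d - int (nr - 1))) < nr" "nat (int d - int (nr - 1)) < nc"
      using that pos by linarith+
    moreover have "int (nat k) - int (nat (- k)) = k" for k
      by simp
    ultimately show ?thesis
      by (simp only: t toeplitz_of_def index_mat prod.case)
  qed
  have dim: "dim_vec (vec_toep T) = ?N"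
    using len by (simp add: vec_toep_def t toeplitz_of_def)
  have prod: "(weight_toep nr nc *\<^sub>v vec_toep T) $ d = sqrt (?len d) * ?t d" if "d < ?N" for d
  proof -
    have "(weight_toep nr nc *\<^sub>v vec_toep T) $ d
        = (\<Sum>k = 0..<?N. (if d = k then sqrt (?len k) else 0) * vec_toep T $ k)"
      using that dim by (simp add: weight_toep_def mat_diag_def scalar_prod_def cong: if_cong)
    also have "\<dots> = (\<Sum>k = 0..<?N. if d = k then sqrt (?len k) * vec_toep T $ k else 0)"
      by (rule sum.cong) auto
    also have "\<dots> = sqrt (?len d) * ?t d"
      using that entry by (subst sum.delta') auto
    finally show ?thesis .
  qed
  have "(\<Sum>i<nr. \<Sum>j<nc. (T $$ (i,j))\<^sup>2)
      = (\<Sum>(i,j)\<in>{..<nr} \<times> {..<nc}. (?t (j + (nr - 1) - i))\<^sup>2)"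
    by (subst sum.cartesian_product, rule sum.cong)
       (auto simp: t toeplitz_of_def of_nat_diff)
  also have "\<dots> = (\<Sum>d<?N. \<Sum>(i,j)\<in>{p \<in> {..<nr} \<times> {..<nc}. (case p of (i,j) \<Rightarrow> j + (nr - 1) - i) = d}.
      (?t (j + (nr - 1) - i))\<^sup>2)"
    by (rule sum.group[symmetric]) auto
  also have "\<dots> = (\<Sum>d<?N. real (?len d) * (?t d)\<^sup>2)"
  proof (rule sum.cong[OF refl])
    fix d assume "d \<in> {..<?N}"
    then have d: "d < ?N" by simp
    have set: "{p \<in> {..<nr} \<times> {..<nc}. (case p of (i,j) \<Rightarrow> j + (nr - 1) - i) = d}
        = {(i,j). i < nr \<and> j < nc \<and> j + (nr - 1) - i = d}"
      by auto
    have "(\<Sum>(i,j)\<in>{(i,j). i < nr \<and> j < nc \<and> j + (nr - 1) - i = d}. (?t (j + (nr - 1) - i))\<^sup>2)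
        = (\<Sum>p\<in>{(i,j). i < nr \<and> j < nc \<and> j + (nr - 1) - i = d}. (?t d)\<^sup>2)"
      by (rule sum.cong) auto
    then show "(\<Sum>(i,j)\<in>{p \<in> {..<nr} \<times> {..<nc}. (case p of (i,j) \<Rightarrow> j + (nr - 1) - i) = d}.
      (?t (j + (nr - 1) - i))\<^sup>2) = real (?len d) * (?t d)\<^sup>2"
      unfolding set using card_diagonal[OF d] by simp
  qed
  also have "\<dots> = (\<Sum>d<?N. (sqrt (?len d) * ?t d)\<^sup>2)"
    by (simp add: power_mult_distrib)
  also have "\<dots> = (weight_toep nr nc *\<^sub>v vec_toep T) \<bullet> (weight_toep nr nc *\<^sub>v vec_toep T)"
  proof -
    have "dim_vec (weight_toep nr nc *\<^sub>v vec_toep T) = ?N"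
      by (simp add: weight_toep_def mat_diag_def)
    then show ?thesis
      unfolding scalar_prod_def lessThan_atLeast0
      by (intro sum.cong) (simp_all only: prod power2_eq_square atLeastLessThan_iff)
  qed
  finally show ?thesis
    by (simp add: frobenius_norm_def norm2_vec_def t toeplitz_of_def)
qed

end

theory Submission
  imports Defs "HOL-Analysis.L2_Norm"
begin

text \<open>The normal equations turn the least-squares problem into the saddle point system with blocks
  \<open>A = W\<inverse>\<close>, \<open>B = Q\<^sup>T\<close>, \<open>D = - \<lambda>I\<close>, whose Schur complement is \<open>S = - (\<lambda>I + Q\<^sup>T W Q)\<close>. The matrices \<open>K\<close>
  and \<open>S\<inverse>\<close> form the lower block row of the inverse of the saddle point matrix. A perturbation of
  the data changes \<open>y\<close>, up to a quadratic error, by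
  \<open>L = K (df - dA r - dB\<^sup>T y) + S\<inverse> (dg - dB r - dD y)\<close>. The quadratic error is bounded uniformly
  over all sufficiently small perturbations (\<open>change_near_first_order\<close>, obtained from a Neumann
  estimate in the maximum norm, \<open>solution_near\<close>). A condition number is therefore the
  supremum of a norm of \<open>L\<close> over the perturbations that are admissible for \<open>\<eta> = 1\<close>
  (\<open>condition_number_limit\<close>).

  It remains to compute these suprema. In the coordinates of symmetric and of Toeplitz matrices,
  \<open>- L\<close> is the image of the coordinate vector of the perturbation under a fixed matrix
  (\<open>first_order_change_coordinates\<close>). Weighting the coordinates makes their Euclidean norm the Frobenius
  norm of \<open>[\<Delta>H \<Delta>d]\<close>, and every coordinate vector occurs. The normwise supremum is thus a spectral norm
  (\<open>normwise_condition_number\<close>). Under the componentwise constraint each coordinate ranges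
  independently over a symmetric interval. The supremum of \<open>\<bar>L\<^sub>i\<bar>\<close> is the sum of the products
  of the absolute values, attained by choosing signs (\<open>first_order_change_le\<close>,
  \<open>first_order_change_attained\<close>); this yields the mixed and the componentwise condition number.\<close>

section \<open>Limits of suprema with a first-order expansion\<close>

text \<open>Only approximate maximizers are needed, so the first-order supremum \<open>\<kappa>\<close> need not be attained.\<close>

lemma tendsto_SUP_first_order:
  fixes X :: "real \<Rightarrow> 'a set" and \<nu> :: "'a \<Rightarrow> real" and \<epsilon> C \<kappa> :: real
  assumes \<epsilon>: "0 < \<epsilon>"
    and upper: "\<And>\<eta> u. 0 < \<eta> \<Longrightarrow> \<eta> < \<epsilon> \<Longrightarrow> u \<in> X \<eta> \<Longrightarrow> \<nu> u \<le> \<eta> * \<kappa> + C * \<eta>\<^sup>2"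
    and lower: "\<And>\<eta> t. 0 < \<eta> \<Longrightarrow> \<eta> < \<epsilon> \<Longrightarrow> t < \<kappa> \<Longrightarrow> \<exists>u\<in>X \<eta>. \<eta> * t - C * \<eta>\<^sup>2 \<le> \<nu> u"
  shows "((\<lambda>\<eta>. SUP u\<in>X \<eta>. ereal (\<nu> u / \<eta>)) \<longlongrightarrow> ereal \<kappa>) (at_right 0)"
proof (rule tendsto_sandwich)
  have ev: "eventually (\<lambda>\<eta>. 0 < \<eta> \<and> \<eta> < \<epsilon>) (at_right 0)"
    using \<epsilon> by (auto simp: eventually_at_right_field)
  show "eventually (\<lambda>\<eta>. (SUP u\<in>X \<eta>. ereal (\<nu> u / \<eta>)) \<le> ereal (\<kappa> + C * \<eta>)) (at_right 0)"
    using ev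
  proof eventually_elim
    case (elim \<eta>)
    show ?case
    proof (rule SUP_least)
      fix u assume "u \<in> X \<eta>"
      with upper elim have "\<nu> u \<le> \<eta> * \<kappa> + C * \<eta>\<^sup>2" by blast
      with elim show "ereal (\<nu> u / \<eta>) \<le> ereal (\<kappa> + C * \<eta>)"
        by (simp add: field_simps power2_eq_square)
    qed
  qed
  show "eventually (\<lambda>\<eta>. ereal (\<kappa> - C * \<eta>) \<le> (SUP u\<in>X \<eta>. ereal (\<nu> u / \<eta>))) (at_right 0)"
    using ev
  proof eventually_elim
    case (elim \<eta>)
    show ?case
    proof (rule dense_le)
      fix b assume b: "b < ereal (\<kappa> - C * \<eta>)"
      show "b \<le> (SUP u\<in>X \<eta>. ereal (\<nu> u / \<eta>))"
      proof (cases b)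
        case (real t)
        with b have "t + C * \<eta> < \<kappa>" by simp
        with lower[of \<eta> "t + C * \<eta>"] elim obtain u
          where u: "u \<in> X \<eta>" "\<eta> * (t + C * \<eta>) - C * \<eta>\<^sup>2 \<le> \<nu> u" by blast
        from u(2) elim have "t \<le> \<nu> u / \<eta>"
          by (simp add: field_simps power2_eq_square)
        with u(1) real show ?thesis by (intro SUP_upper2[of u]) auto
      qed (use b in auto)
    qed
  qed
  have "((\<lambda>\<eta>. \<kappa> - C * \<eta>) \<longlongrightarrow> \<kappa> - C * 0) (at_right 0)"
    by (intro tendsto_intros)
  then show "((\<lambda>\<eta>. ereal (\<kappa> - C * \<eta>)) \<longlongrightarrow> ereal \<kappa>) (at_right 0)"
    by simp
  have "((\<lambda>\<eta>. \<kappa> + C * \<eta>) \<longlongrightarrow> \<kappa> + C * 0) (at_right 0)"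
    by (intro tendsto_intros)
  then show "((\<lambda>\<eta>. ereal (\<kappa> + C * \<eta>)) \<longlongrightarrow> ereal \<kappa>) (at_right 0)"
    by simp
qed

section \<open>Inverses and perturbed linear systems\<close>

lemma abs_mult_mat_vec_le:
  fixes M :: "real mat"
  assumes M: "M \<in> carrier_mat a b" and v: "v \<in> carrier_vec b" and i: "i < a"
    and Mb: "\<And>i j. i < a \<Longrightarrow> j < b \<Longrightarrow> \<bar>M $$ (i,j)\<bar> \<le> s" and vb: "\<And>j. j < b \<Longrightarrow> \<bar>v $ j\<bar> \<le> t"
  shows "\<bar>(M *\<^sub>v v) $ i\<bar> \<le> real b * s * t"
proof -
  have "(M *\<^sub>v v) $ i = (\<Sum>j = 0..<b. M $$ (i,j) * v $ j)"
    using M v i by (simp add: scalar_prod_def)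
  also have "\<bar>\<dots>\<bar> \<le> (\<Sum>j = 0..<b. \<bar>M $$ (i,j) * v $ j\<bar>)"
    by (rule sum_abs)
  also have "\<dots> \<le> (\<Sum>j = 0..<b. s * t)"
  proof (rule sum_mono)
    fix j assume j: "j \<in> {0..<b}"
    have "0 \<le> s" using Mb[OF i, of j] j by auto
    with j Mb[OF i, of j] vb[of j] show "\<bar>M $$ (i,j) * v $ j\<bar> \<le> s * t"
      by (auto simp: abs_mult intro!: mult_mono)
  qed
  finally show ?thesis by simp
qed

lemma mat_entries_bounded:
  fixes M :: "real mat"
  obtains s where "0 \<le> s" "\<And>i j. i < dim_row M \<Longrightarrow> j < dim_col M \<Longrightarrow> \<bar>M $$ (i,j)\<bar> \<le> s"
proof
  let ?S = "insert 0 ((\<lambda>p. \<bar>M $$ p\<bar>) ` ({..<dim_row M} \<times> {..<dim_col M}))"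
  show "0 \<le> Max ?S" by (rule Max_ge) auto
  show "\<bar>M $$ (i,j)\<bar> \<le> Max ?S" if "i < dim_row M" "j < dim_col M" for i j
    using that by (intro Max_ge) auto
qed

lemma vec_entries_bounded:
  fixes v :: "real vec"
  obtains s where "0 \<le> s" "\<And>i. i < dim_vec v \<Longrightarrow> \<bar>v $ i\<bar> \<le> s"
proof
  let ?S = "insert 0 ((\<lambda>p. \<bar>v $ p\<bar>) ` {..<dim_vec v})"
  show "0 \<le> Max ?S" by (rule Max_ge) auto
  show "\<bar>v $ i\<bar> \<le> Max ?S" if "i < dim_vec v" for i
    using that by (intro Max_ge) auto
qed

lemma mult_mat_zero_vec:
  fixes M :: "real mat"
  assumes "M \<in> carrier_mat a b"
  shows "M *\<^sub>v 0\<^sub>v b = 0\<^sub>v a"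
  using assms by (intro eq_vecI) auto

lemma inverse_mat_exists:
  fixes M :: "real mat"
  assumes M: "M \<in> carrier_mat k k"
    and inj: "\<And>v. v \<in> carrier_vec k \<Longrightarrow> M *\<^sub>v v = 0\<^sub>v k \<Longrightarrow> v = 0\<^sub>v k"
  shows "mat_inv M \<in> carrier_mat k k" "mat_inv M * M = 1\<^sub>m k" "M * mat_inv M = 1\<^sub>m k"
proof -
  have "det M \<noteq> 0"
    using det_0_iff_vec_prod_zero_field[OF M] inj by blast
  then have "M \<in> Units (ring_mat TYPE(real) k ())"
    by (rule det_non_zero_imp_unit[OF M])
  then obtain N where "mat_inverse M = Some N"
    using mat_inverse(1)[OF M, of "()"] by blast
  with mat_inverse(2)[OF M this]
  show "mat_inv M \<in> carrier_mat k k" "mat_inv M * M = 1\<^sub>m k" "M * mat_inv M = 1\<^sub>m k"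
    by (auto simp: mat_inv_def)
qed

lemma mat_inv_left_inverse:
  fixes M N :: "real mat"
  assumes M: "M \<in> carrier_mat k k" and N: "N \<in> carrier_mat k k" and NM: "N * M = 1\<^sub>m k"
  shows "mat_inv M = N"
proof -
  have inj: "v = 0\<^sub>v k" if v: "v \<in> carrier_vec k" "M *\<^sub>v v = 0\<^sub>v k" for v
  proof -
    have "v = (N * M) *\<^sub>v v" using v NM by simp
    also have "\<dots> = N *\<^sub>v (M *\<^sub>v v)" using M N v by simp
    also have "\<dots> = 0\<^sub>v k" using N v by auto
    finally show ?thesis .
  qed
  note I = inverse_mat_exists[OF M inj]
  have "mat_inv M = (N * M) * mat_inv M" using NM I by simp
  also have "\<dots> = N * (M * mat_inv M)" using M N I by simp
  also have "\<dots> = N" using N I by simp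
  finally show ?thesis .
qed

text \<open>The uniform first-order expansion of the solution of a perturbed linear system. The unique
  solvability of the perturbed system is part of the conclusion.\<close>

lemma solution_near:
  fixes M Minv :: "real mat"
  assumes M: "M \<in> carrier_mat k k" and Minv: "Minv \<in> carrier_mat k k" and inv: "Minv * M = 1\<^sub>m k"
    and z: "z \<in> carrier_vec k"
  obtains \<epsilon> C where "0 < \<epsilon>" "0 \<le> C"
    "\<And>e E b. 0 \<le> e \<Longrightarrow> e \<le> \<epsilon> \<Longrightarrow> E \<in> carrier_mat k k \<Longrightarrow> b \<in> carrier_vec k
       \<Longrightarrow> (\<And>i j. i < k \<Longrightarrow> j < k \<Longrightarrow> \<bar>E $$ (i,j)\<bar> \<le> e) \<Longrightarrow> (\<And>i. i < k \<Longrightarrow> \<bar>b $ i\<bar> \<le> e)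
       \<Longrightarrow> \<exists>dz\<in>carrier_vec k. unique_solution (M + E) (M *\<^sub>v z + b) (z + dz) \<and>
             (\<forall>i<k. \<bar>dz $ i - (Minv *\<^sub>v (b - E *\<^sub>v z)) $ i\<bar> \<le> C * e\<^sup>2)"
proof -
  obtain s where s: "0 \<le> s" "\<And>i j. i < k \<Longrightarrow> j < k \<Longrightarrow> \<bar>Minv $$ (i,j)\<bar> \<le> s"
    using mat_entries_bounded[of Minv] Minv by auto
  obtain t where t: "0 \<le> t" "\<And>i. i < k \<Longrightarrow> \<bar>z $ i\<bar> \<le> t"
    using vec_entries_bounded[of z] z by auto
  define c where "c = real k * s * real k"
  define a where "a = real k * s * (1 + real k * t)"
  have c: "0 \<le> c" and a: "0 \<le> a" using s t by (auto simp: c_def a_def)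
  \<comment> \<open>The bound \<open>c \<epsilon> \<le> 1/2\<close> makes the perturbation a contraction; the summand 1 covers \<open>c = 0\<close>.\<close>
  define \<epsilon> where "\<epsilon> = 1 / (2 * c + 1)"
  have \<epsilon>: "0 < \<epsilon>" using c by (simp add: \<epsilon>_def)
  have "\<exists>dz\<in>carrier_vec k. unique_solution (M + E) (M *\<^sub>v z + b) (z + dz) \<and>
             (\<forall>i<k. \<bar>dz $ i - (Minv *\<^sub>v (b - E *\<^sub>v z)) $ i\<bar> \<le> (c * (2 * a)) * e\<^sup>2)"
    if e: "0 \<le> e" "e \<le> \<epsilon>" and E: "E \<in> carrier_mat k k" and b: "b \<in> carrier_vec k"
      and Eb: "\<And>i j. i < k \<Longrightarrow> j < k \<Longrightarrow> \<bar>E $$ (i,j)\<bar> \<le> e" and bb: "\<And>i. i < k \<Longrightarrow> \<bar>b $ i\<bar> \<le> e"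
    for e E b
  proof -
    have ce: "c * e \<le> 1 / 2"
    proof -
      have "c * e \<le> c * \<epsilon>" using e c by (intro mult_left_mono) auto
      also have "\<dots> \<le> 1 / 2" using c by (simp add: \<epsilon>_def field_simps)
      finally show ?thesis .
    qed
    have cE: "\<bar>(Minv *\<^sub>v (E *\<^sub>v v)) $ i\<bar> \<le> c * e * q"
      if v: "v \<in> carrier_vec k" and vb: "\<And>i. i < k \<Longrightarrow> \<bar>v $ i\<bar> \<le> q" and i: "i < k" for v q i
    proof -
      have "\<bar>(Minv *\<^sub>v (E *\<^sub>v v)) $ i\<bar> \<le> real k * s * (real k * e * q)"
        using E v by (intro abs_mult_mat_vec_le[OF Minv _ i s(2)] abs_mult_mat_vec_le[OF E v _ Eb vb]) auto
      then show ?thesis by (simp add: c_def mult_ac)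
    qed
    \<comment> \<open>\<open>Minv E\<close> at least halves the maximum norm, so \<open>v\<close> is at most twice \<open>v + Minv E v\<close>.\<close>
    have small: "\<bar>v $ i\<bar> \<le> 2 * q"
      if v: "v \<in> carrier_vec k" and vb: "\<And>i. i < k \<Longrightarrow> \<bar>v $ i + (Minv *\<^sub>v (E *\<^sub>v v)) $ i\<bar> \<le> q"
        and i: "i < k" for v q i
    proof -
      define V where "V = Max ((\<lambda>i. \<bar>v $ i\<bar>) ` {..<k})"
      have ne: "(\<lambda>i. \<bar>v $ i\<bar>) ` {..<k} \<noteq> {}" using i by auto
      have Vb: "\<bar>v $ j\<bar> \<le> V" if "j < k" for j
        using that by (auto simp: V_def intro!: Max_ge)
      obtain j where j: "j < k" "V = \<bar>v $ j\<bar>"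
        using Max_in[OF _ ne] by (auto simp: V_def)
      have "\<bar>(Minv *\<^sub>v (E *\<^sub>v v)) $ j\<bar> \<le> c * e * V" by (rule cE[OF v Vb j(1)])
      also have "\<dots> \<le> 1 / 2 * V" using ce j by (intro mult_right_mono) auto
      finally have "V \<le> q + V / 2" using vb[OF j(1)] j by linarith
      then show ?thesis using Vb[OF i] by linarith
    qed
    have res: "Minv *\<^sub>v ((M + E) *\<^sub>v v) = v + Minv *\<^sub>v (E *\<^sub>v v)" if v: "v \<in> carrier_vec k" for v
    proof -
      have "Minv *\<^sub>v ((M + E) *\<^sub>v v) = Minv *\<^sub>v (M *\<^sub>v v) + Minv *\<^sub>v (E *\<^sub>v v)"
        using M E Minv v by (simp add: add_mult_distrib_mat_vec[OF M E v] mult_add_distrib_mat_vec[OF Minv])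
      also have "Minv *\<^sub>v (M *\<^sub>v v) = v"
        using assoc_mult_mat_vec[OF Minv M v] inv v by simp
      finally show ?thesis .
    qed
    have ME: "M + E \<in> carrier_mat k k" using M E by simp
    have inj: "v = 0\<^sub>v k" if v: "v \<in> carrier_vec k" and 0: "(M + E) *\<^sub>v v = 0\<^sub>v k" for v
    proof -
      have "v + Minv *\<^sub>v (E *\<^sub>v v) = 0\<^sub>v k"
        using res[OF v] mult_mat_zero_vec[OF Minv] unfolding 0 by simp
      then have "v $ i + (Minv *\<^sub>v (E *\<^sub>v v)) $ i = 0" if "i < k" for i
        using that Minv by (metis index_add_vec(1) index_zero_vec(1) dim_mult_mat_vec carrier_matD(1))
      then have "v $ i = 0" if "i < k" for i
        using small[OF v, of 0 i] that by simp
      then show ?thesis using v by auto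
    qed
    note I = inverse_mat_exists[OF ME inj]
    define rhs where "rhs = M *\<^sub>v z + b"
    have rhs: "rhs \<in> carrier_vec k" using M z b by (simp add: rhs_def)
    define w where "w = mat_inv (M + E) *\<^sub>v rhs"
    have w: "w \<in> carrier_vec k" using I rhs by (simp add: w_def)
    have Mw: "(M + E) *\<^sub>v w = rhs"
      unfolding w_def using assoc_mult_mat_vec[OF ME I(1) rhs] I rhs by simp
    have uniq: "w' = w" if "w' \<in> carrier_vec k" "(M + E) *\<^sub>v w' = rhs" for w'
      unfolding w_def using assoc_mult_mat_vec[OF I(1) ME that(1)] that I by simp
    define dz where "dz = w - z"
    have dz: "dz \<in> carrier_vec k" and zdz: "z + dz = w" using w z by (auto simp: dz_def)
    define \<delta> where "\<delta> = b - E *\<^sub>v z"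
    have \<delta>: "\<delta> \<in> carrier_vec k" using b E z by (simp add: \<delta>_def)
    have "(M + E) *\<^sub>v dz = rhs - (M + E) *\<^sub>v z"
      unfolding dz_def using Mw mult_minus_distrib_mat_vec[OF ME w z] by simp
    also have "\<dots> = \<delta>"
      using M E b z by (auto simp: rhs_def \<delta>_def add_mult_distrib_mat_vec[OF M E z])
    finally have "dz + Minv *\<^sub>v (E *\<^sub>v dz) = Minv *\<^sub>v \<delta>"
      using res[OF dz] by simp
    then have key: "dz $ i + (Minv *\<^sub>v (E *\<^sub>v dz)) $ i = (Minv *\<^sub>v \<delta>) $ i" if "i < k" for i
      using that Minv by (metis index_add_vec(1) dim_mult_mat_vec carrier_matD(1))
    have "\<bar>\<delta> $ i\<bar> \<le> e + real k * e * t" if i: "i < k" for i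
    proof -
      have "\<delta> $ i = b $ i - (E *\<^sub>v z) $ i"
        unfolding \<delta>_def using i E by (intro index_minus_vec) auto
      then show ?thesis
        using bb[OF i] abs_mult_mat_vec_le[OF E z i Eb t(2)] by linarith
    qed
    then have "\<bar>(Minv *\<^sub>v \<delta>) $ i\<bar> \<le> real k * s * (e + real k * e * t)" if "i < k" for i
      by (intro abs_mult_mat_vec_le[OF Minv \<delta> that s(2)]) auto
    then have \<delta>b: "\<bar>(Minv *\<^sub>v \<delta>) $ i\<bar> \<le> a * e" if "i < k" for i
      using that by (simp add: a_def algebra_simps)
    have dzb: "\<bar>dz $ i\<bar> \<le> 2 * (a * e)" if "i < k" for i
      using key \<delta>b by (intro small[OF dz _ that]) simp
    have "\<bar>dz $ i - (Minv *\<^sub>v \<delta>) $ i\<bar> \<le> c * (2 * a) * e\<^sup>2" if i: "i < k" for i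
    proof -
      have "\<bar>dz $ i - (Minv *\<^sub>v \<delta>) $ i\<bar> = \<bar>(Minv *\<^sub>v (E *\<^sub>v dz)) $ i\<bar>"
        using key[OF i] by linarith
      also have "\<dots> \<le> c * e * (2 * (a * e))" by (rule cE[OF dz dzb i])
      finally show ?thesis by (simp add: power2_eq_square mult_ac)
    qed
    moreover have "unique_solution (M + E) rhs w"
      unfolding unique_solution_def using w Mw uniq ME by (metis carrier_matD(2))
    ultimately show ?thesis
      using dz zdz unfolding rhs_def \<delta>_def by metis
  qed
  then show thesis
    using \<epsilon> c a by (intro that[of \<epsilon> "c * (2 * a)"]) auto
qed

section \<open>Generalized saddle point problems\<close>

text \<open>The first-order change of the solution component \<open>y\<close>, where \<open>[K Sinv]\<close> stands for the lower
  block row of the inverse of the saddle point matrix.\<close>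

definition first_order_change ::
  "real mat \<Rightarrow> real mat \<Rightarrow> real vec \<Rightarrow> real vec
   \<Rightarrow> real mat \<Rightarrow> real mat \<Rightarrow> real mat \<Rightarrow> real vec \<Rightarrow> real vec \<Rightarrow> real vec" where
  "first_order_change K Sinv x y dA dB dD df dg =
     K *\<^sub>v (df - (dA *\<^sub>v x + dB\<^sup>T *\<^sub>v y)) + Sinv *\<^sub>v (dg - (dB *\<^sub>v x + dD *\<^sub>v y))"

text \<open>A perturbation of the data with structure \<open>E\<close> and size constraint \<open>C\<close>.\<close>

definition perturbation ::
  "nat \<Rightarrow> nat \<Rightarrow> real mat set \<Rightarrow> (real mat \<Rightarrow> bool)
   \<Rightarrow> real mat \<Rightarrow> real mat \<Rightarrow> real mat \<Rightarrow> real vec \<Rightarrow> real vec \<Rightarrow> bool" where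
  "perturbation m n E C dA dB dD df dg \<longleftrightarrow>
     dA \<in> carrier_mat m m \<and> dB \<in> carrier_mat n m \<and> dD \<in> carrier_mat n n
     \<and> df \<in> carrier_vec m \<and> dg \<in> carrier_vec n
     \<and> saddle_data dA dB dD \<in> E \<and> C (append_col (saddle_data dA dB dD) (df @\<^sub>v dg))"

lemma saddle_mat_mult_vec:
  assumes "A \<in> carrier_mat m m" "B \<in> carrier_mat n m" "D \<in> carrier_mat n n"
    and "u \<in> carrier_vec m" "v \<in> carrier_vec n"
  shows "saddle_mat A B D *\<^sub>v (u @\<^sub>v v) = (A *\<^sub>v u + B\<^sup>T *\<^sub>v v) @\<^sub>v (B *\<^sub>v u + D *\<^sub>v v)"
  unfolding saddle_mat_def using assms by (intro four_block_mat_mult_vec) auto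

lemma saddle_mat_carrier:
  assumes "A \<in> carrier_mat m m" "D \<in> carrier_mat n n"
  shows "saddle_mat A B D \<in> carrier_mat (m + n) (m + n)"
  unfolding saddle_mat_def using assms by simp

lemma append_col_saddle_data:
  assumes A: "A \<in> carrier_mat m m" and B: "B \<in> carrier_mat n m" and D: "D \<in> carrier_mat n n"
    and f: "f \<in> carrier_vec m" and g: "g \<in> carrier_vec n"
  shows "append_col (saddle_data A B D) (f @\<^sub>v g) = mat (m + n) (m + n + 1)
     (\<lambda>(i,j). if j < m + n
        then if i < m then if j < m then A $$ (i,j) else 0
             else if j < m then B $$ (i - m, j) else D $$ (i - m, j - m)
        else if i < m then f $ i else g $ (i - m))"
proof -
  have dims: "dim_row (saddle_data A B D) = m + n" "dim_col (saddle_data A B D) = m + n"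
    using A B D by (auto simp: saddle_data_def)
  show ?thesis
    by (rule eq_matI)
      (use dims A B D f g in \<open>auto simp: append_col_def mat_of_cols_def nth_append saddle_data_def not_less less_Suc_eq\<close>)
qed

lemma saddle_data_eq_iff:
  assumes "A \<in> carrier_mat m m" "B \<in> carrier_mat n m" "D \<in> carrier_mat n n"
    and "A' \<in> carrier_mat m m" "B' \<in> carrier_mat n m" "D' \<in> carrier_mat n n"
  shows "saddle_data A B D = saddle_data A' B' D' \<longleftrightarrow> A = A' \<and> B = B' \<and> D = D'"
proof
  assume eq: "saddle_data A B D = saddle_data A' B' D'"
  have e: "saddle_data A B D $$ p = saddle_data A' B' D' $$ p" for p by (simp only: eq)
  have "A $$ (i,j) = A' $$ (i,j)" if "i < m" "j < m" for i j
    using e[of "(i,j)"] that assms by (simp add: saddle_data_def)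
  moreover have "B $$ (i,j) = B' $$ (i,j)" if "i < n" "j < m" for i j
    using e[of "(i + m,j)"] that assms by (simp add: saddle_data_def)
  moreover have "D $$ (i,j) = D' $$ (i,j)" if "i < n" "j < n" for i j
    using e[of "(i + m,j + m)"] that assms by (simp add: saddle_data_def)
  ultimately show "A = A' \<and> B = B' \<and> D = D'"
    using assms by (auto intro!: eq_matI)
qed simp

text \<open>A solution \<open>[x y]\<close> of a saddle point problem whose block \<open>A\<close> has the inverse \<open>V\<close> and whose Schur
  complement \<open>D - B V B\<^sup>T\<close> has the inverse \<open>Sinv\<close>. No symmetry of \<open>A\<close> is required.\<close>

locale generalized_saddle_point =
  fixes m n :: nat and A V B D Sinv K :: "real mat" and f g x y :: "real vec"
  assumes A: "A \<in> carrier_mat m m" and V: "V \<in> carrier_mat m m" and VA: "V * A = 1\<^sub>m m"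
    and B: "B \<in> carrier_mat n m" and D: "D \<in> carrier_mat n n"
    and Sinv: "Sinv \<in> carrier_mat n n" and schur: "Sinv * (D - B * V * B\<^sup>T) = 1\<^sub>m n"
    and K: "K = - (Sinv * B * V)"
    and f: "f \<in> carrier_vec m" and g: "g \<in> carrier_vec n"
    and x: "x \<in> carrier_vec m" and y: "y \<in> carrier_vec n"
    and upper_row: "A *\<^sub>v x + B\<^sup>T *\<^sub>v y = f" and lower_row: "B *\<^sub>v x + D *\<^sub>v y = g"
begin

lemma K_carrier: "K \<in> carrier_mat n m"
  using Sinv B V by (simp add: K)

text \<open>Block elimination: the lower component of a solution for an arbitrary right-hand side.\<close>

lemma lower_solution:
  assumes u: "u \<in> carrier_vec m" and v: "v \<in> carrier_vec n"
  shows "v = K *\<^sub>v (A *\<^sub>v u + B\<^sup>T *\<^sub>v v) + Sinv *\<^sub>v (B *\<^sub>v u + D *\<^sub>v v)"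
proof -
  let ?a = "A *\<^sub>v u + B\<^sup>T *\<^sub>v v" and ?b = "B *\<^sub>v u + D *\<^sub>v v"
  have BT: "B\<^sup>T \<in> carrier_mat m n" using B by simp
  have Bv: "B\<^sup>T *\<^sub>v v \<in> carrier_vec m" and Du: "D *\<^sub>v v \<in> carrier_vec n" and Au: "A *\<^sub>v u \<in> carrier_vec m"
    and Bu: "B *\<^sub>v u \<in> carrier_vec n"
    using A B D u v by auto
  have a: "?a \<in> carrier_vec m" and b: "?b \<in> carrier_vec n"
    using Bv Du Au Bu by auto
  have BV: "B * V \<in> carrier_mat n m" using B V by simp
  have BVB: "B * V * B\<^sup>T \<in> carrier_mat n n" using BV BT by simp
  have "(B * V) *\<^sub>v ?a = B *\<^sub>v (V *\<^sub>v (A *\<^sub>v u)) + (B * V * B\<^sup>T) *\<^sub>v v"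
    using assoc_mult_mat_vec[OF BV BT v] assoc_mult_mat_vec[OF B V Au]
    by (simp add: mult_add_distrib_mat_vec[OF BV Au Bv])
  also have "V *\<^sub>v (A *\<^sub>v u) = u"
    using assoc_mult_mat_vec[OF V A u] VA u by simp
  finally have BVa: "(B * V) *\<^sub>v ?a = B *\<^sub>v u + (B * V * B\<^sup>T) *\<^sub>v v" .
  have "K *\<^sub>v ?a + Sinv *\<^sub>v ?b = - (Sinv *\<^sub>v ((B * V) *\<^sub>v ?a)) + Sinv *\<^sub>v ?b"
    using assoc_mult_mat_vec[OF Sinv BV a] assoc_mult_mat[OF Sinv B V] Sinv B V a
    by (simp add: K)
  also have "\<dots> = Sinv *\<^sub>v (?b - (B * V) *\<^sub>v ?a)"
    using mult_minus_distrib_mat_vec[OF Sinv b, of "(B * V) *\<^sub>v ?a"] Sinv b BV a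
    by (auto simp: comm_add_vec[of _ n])
  also have "?b - (B * V) *\<^sub>v ?a = (D - B * V * B\<^sup>T) *\<^sub>v v"
    unfolding BVa minus_mult_distrib_mat_vec[OF D BVB v]
    using B D u v BVB by (intro eq_vecI) auto
  also have "Sinv *\<^sub>v \<dots> = v"
    using assoc_mult_mat_vec[OF Sinv minus_carrier_mat[OF BVB, of D] v] schur v by simp
  finally show ?thesis by simp
qed

lemma saddle_inverse:
  obtains N where "N \<in> carrier_mat (m + n) (m + n)" "N * saddle_mat A B D = 1\<^sub>m (m + n)"
    "saddle_mat A B D * N = 1\<^sub>m (m + n)"
proof -
  have M: "saddle_mat A B D \<in> carrier_mat (m + n) (m + n)"
    by (rule saddle_mat_carrier[OF A D])
  have "w = 0\<^sub>v (m + n)" if w: "w \<in> carrier_vec (m + n)" and 0: "saddle_mat A B D *\<^sub>v w = 0\<^sub>v (m + n)" for w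
  proof -
    define u v where "u = vec_first w m" and "v = vec_last w n"
    have u: "u \<in> carrier_vec m" and v: "v \<in> carrier_vec n" and uv: "w = u @\<^sub>v v"
      using w by (auto simp: u_def v_def)
    have "(A *\<^sub>v u + B\<^sup>T *\<^sub>v v) @\<^sub>v (B *\<^sub>v u + D *\<^sub>v v) = 0\<^sub>v m @\<^sub>v 0\<^sub>v n"
      using 0 unfolding uv saddle_mat_mult_vec[OF A B D u v] by auto
    moreover have "A *\<^sub>v u + B\<^sup>T *\<^sub>v v \<in> carrier_vec m"
      using A B u v by simp
    ultimately have a: "A *\<^sub>v u + B\<^sup>T *\<^sub>v v = 0\<^sub>v m" and b: "B *\<^sub>v u + D *\<^sub>v v = 0\<^sub>v n"
      by (auto simp: append_vec_eq[of _ m])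
    have v0: "v = 0\<^sub>v n"
      using lower_solution[OF u v] mult_mat_zero_vec[OF K_carrier] mult_mat_zero_vec[OF Sinv]
      unfolding a b by simp
    have "A *\<^sub>v u = 0\<^sub>v m"
      using a mult_mat_zero_vec[of "B\<^sup>T" m n] A B u unfolding v0 by simp
    then have "u = 0\<^sub>v m"
      using assoc_mult_mat_vec[OF V A u] VA u mult_mat_zero_vec[OF V] by simp
    then show ?thesis unfolding uv v0 by auto
  qed
  from inverse_mat_exists[OF M this] that show thesis by blast
qed

text \<open>All perturbations of entries at most \<open>e\<close> are covered by one constant \<open>C\<close>, which makes the
  expansion uniform over any set of structured perturbations.\<close>

lemma change_near_first_order:
  obtains \<epsilon> C where "0 < \<epsilon>" "0 \<le> C"
    "\<And>e dA dB dD df dg. 0 \<le> e \<Longrightarrow> e \<le> \<epsilon>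
       \<Longrightarrow> dA \<in> carrier_mat m m \<Longrightarrow> dB \<in> carrier_mat n m \<Longrightarrow> dD \<in> carrier_mat n n
       \<Longrightarrow> df \<in> carrier_vec m \<Longrightarrow> dg \<in> carrier_vec n
       \<Longrightarrow> (\<And>i j. i < m + n \<Longrightarrow> j < m + n + 1 \<Longrightarrow>
              \<bar>append_col (saddle_data dA dB dD) (df @\<^sub>v dg) $$ (i,j)\<bar> \<le> e)
       \<Longrightarrow> \<exists>dx\<in>carrier_vec m. \<exists>dy\<in>carrier_vec n.
             unique_solution (saddle_mat (A + dA) (B + dB) (D + dD))
               ((f + df) @\<^sub>v (g + dg)) ((x + dx) @\<^sub>v (y + dy)) \<and>
             (\<forall>i<n. \<bar>dy $ i - first_order_change K Sinv x y dA dB dD df dg $ i\<bar> \<le> C * e\<^sup>2)"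
proof -
  obtain N where N: "N \<in> carrier_mat (m + n) (m + n)" "N * saddle_mat A B D = 1\<^sub>m (m + n)"
    "saddle_mat A B D * N = 1\<^sub>m (m + n)"
    by (rule saddle_inverse)
  have M: "saddle_mat A B D \<in> carrier_mat (m + n) (m + n)"
    by (rule saddle_mat_carrier[OF A D])
  have xy: "x @\<^sub>v y \<in> carrier_vec (m + n)" using x y by simp
  have Mxy: "saddle_mat A B D *\<^sub>v (x @\<^sub>v y) = f @\<^sub>v g"
    by (simp add: saddle_mat_mult_vec[OF A B D x y] upper_row lower_row)
  obtain \<epsilon> C where \<epsilon>C: "0 < \<epsilon>" "0 \<le> C"
    and near: "\<And>e E b. 0 \<le> e \<Longrightarrow> e \<le> \<epsilon> \<Longrightarrow> E \<in> carrier_mat (m + n) (m + n) \<Longrightarrow> b \<in> carrier_vec (m + n)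
       \<Longrightarrow> (\<And>i j. i < m + n \<Longrightarrow> j < m + n \<Longrightarrow> \<bar>E $$ (i,j)\<bar> \<le> e) \<Longrightarrow> (\<And>i. i < m + n \<Longrightarrow> \<bar>b $ i\<bar> \<le> e)
       \<Longrightarrow> \<exists>dz\<in>carrier_vec (m + n). unique_solution (saddle_mat A B D + E) (saddle_mat A B D *\<^sub>v (x @\<^sub>v y) + b) ((x @\<^sub>v y) + dz) \<and>
             (\<forall>i<m + n. \<bar>dz $ i - (N *\<^sub>v (b - E *\<^sub>v (x @\<^sub>v y))) $ i\<bar> \<le> C * e\<^sup>2)"
    using solution_near[OF M N(1,2) xy] by blast
  show thesis
  proof (rule that[OF \<epsilon>C])
    fix e dA dB dD df dg
    assume e: "0 \<le> e" "e \<le> \<epsilon>"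
      and dA: "dA \<in> carrier_mat m m" and dB: "dB \<in> carrier_mat n m" and dD: "dD \<in> carrier_mat n n"
      and df: "df \<in> carrier_vec m" and dg: "dg \<in> carrier_vec n"
      and bound: "\<And>i j. i < m + n \<Longrightarrow> j < m + n + 1 \<Longrightarrow>
              \<bar>append_col (saddle_data dA dB dD) (df @\<^sub>v dg) $$ (i,j)\<bar> \<le> e"
    let ?E = "saddle_mat dA dB dD" and ?b = "df @\<^sub>v dg"
    note P = append_col_saddle_data[OF dA dB dD df dg]
    have E: "?E \<in> carrier_mat (m + n) (m + n)" by (rule saddle_mat_carrier[OF dA dD])
    have b: "?b \<in> carrier_vec (m + n)" using df dg by simp
    have "\<bar>?E $$ (i,j)\<bar> \<le> e" if "i < m + n" "j < m + n" for i j
      using bound[of i j] bound[of j i] that dA dB dD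
      by (auto simp: P saddle_mat_def split: if_splits)
    moreover have "\<bar>?b $ i\<bar> \<le> e" if "i < m + n" for i
      using bound[of i "m + n"] that df dg by (auto simp: P)
    ultimately obtain dz where dz: "dz \<in> carrier_vec (m + n)"
      and sol: "unique_solution (saddle_mat A B D + ?E) ((f @\<^sub>v g) + ?b) ((x @\<^sub>v y) + dz)"
      and est: "\<And>i. i < m + n \<Longrightarrow> \<bar>dz $ i - (N *\<^sub>v (?b - ?E *\<^sub>v (x @\<^sub>v y))) $ i\<bar> \<le> C * e\<^sup>2"
      using near[OF e E b] unfolding Mxy by blast
    define dx dy where "dx = vec_first dz m" and "dy = vec_last dz n"
    have dx: "dx \<in> carrier_vec m" and dy: "dy \<in> carrier_vec n" and dxy: "dz = dx @\<^sub>v dy"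
      using dz by (auto simp: dx_def dy_def)
    have sum: "saddle_mat A B D + ?E = saddle_mat (A + dA) (B + dB) (D + dD)"
      unfolding saddle_mat_def using A B D dA dB dD by (intro eq_matI) auto
    have rhs: "(f @\<^sub>v g) + ?b = (f + df) @\<^sub>v (g + dg)"
      by (rule append_vec_add[OF f df g dg])
    have lhs: "(x @\<^sub>v y) + dz = (x + dx) @\<^sub>v (y + dy)"
      unfolding dxy by (rule append_vec_add[OF x dx y dy])
    define w where "w = N *\<^sub>v (?b - ?E *\<^sub>v (x @\<^sub>v y))"
    define u v where "u = vec_first w m" and "v = vec_last w n"
    have w: "w \<in> carrier_vec (m + n)" using N b E xy by (simp add: w_def)
    have u: "u \<in> carrier_vec m" and v: "v \<in> carrier_vec n" and uv: "w = u @\<^sub>v v"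
      using w by (auto simp: u_def v_def)
    let ?a1 = "df - (dA *\<^sub>v x + dB\<^sup>T *\<^sub>v y)" and ?a2 = "dg - (dB *\<^sub>v x + dD *\<^sub>v y)"
    have "saddle_mat A B D *\<^sub>v w = ?b - ?E *\<^sub>v (x @\<^sub>v y)"
      unfolding w_def using assoc_mult_mat_vec[OF M N(1), of "?b - ?E *\<^sub>v (x @\<^sub>v y)"] N(3) b E xy by simp
    also have "\<dots> = ?a1 @\<^sub>v ?a2"
      unfolding saddle_mat_mult_vec[OF dA dB dD x y]
      using dA dB dD df dg by (intro eq_vecI) auto
    finally have "(A *\<^sub>v u + B\<^sup>T *\<^sub>v v) @\<^sub>v (B *\<^sub>v u + D *\<^sub>v v) = ?a1 @\<^sub>v ?a2"
      unfolding uv saddle_mat_mult_vec[OF A B D u v] .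
    moreover have "A *\<^sub>v u + B\<^sup>T *\<^sub>v v \<in> carrier_vec m" "?a1 \<in> carrier_vec m"
      using A B u v dA dB df x y by auto
    ultimately have "A *\<^sub>v u + B\<^sup>T *\<^sub>v v = ?a1" "B *\<^sub>v u + D *\<^sub>v v = ?a2"
      using append_vec_eq by blast+
    with lower_solution[OF u v] have v_eq: "v = first_order_change K Sinv x y dA dB dD df dg"
      by (simp add: first_order_change_def)
    have "\<bar>dy $ i - v $ i\<bar> \<le> C * e\<^sup>2" if "i < n" for i
      using est[of "m + i"] that dx dy u v unfolding w_def[symmetric] uv dxy by simp
    with sol dx dy show "\<exists>dx\<in>carrier_vec m. \<exists>dy\<in>carrier_vec n.
             unique_solution (saddle_mat (A + dA) (B + dB) (D + dD))
               ((f + df) @\<^sub>v (g + dg)) ((x + dx) @\<^sub>v (y + dy)) \<and>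
             (\<forall>i<n. \<bar>dy $ i - first_order_change K Sinv x y dA dB dD df dg $ i\<bar> \<le> C * e\<^sup>2)"
      unfolding sum rhs lhs v_eq by blast
  qed
qed

text \<open>The reduction of every condition number to a first-order problem. The constraint \<open>Cn \<eta>\<close> bounds
  the entries by a multiple of \<open>\<eta>\<close>, and \<open>\<nu>\<close> is any Lipschitz measure of the change of \<open>y\<close>.\<close>

lemma condition_number_limit:
  fixes Cn :: "real \<Rightarrow> real mat \<Rightarrow> bool" and \<nu> :: "real vec \<Rightarrow> real" and R L \<kappa> :: real
  assumes R: "0 < R" and L: "0 \<le> L"
    and bound: "\<And>\<eta> P i j. 0 < \<eta> \<Longrightarrow> P \<in> carrier_mat (m + n) (m + n + 1) \<Longrightarrow> Cn \<eta> P
       \<Longrightarrow> i < m + n \<Longrightarrow> j < m + n + 1 \<Longrightarrow> \<bar>P $$ (i,j)\<bar> \<le> R * \<eta>"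
    and lipschitz: "\<And>u v e. u \<in> carrier_vec n \<Longrightarrow> v \<in> carrier_vec n \<Longrightarrow> 0 \<le> e
       \<Longrightarrow> (\<And>i. i < n \<Longrightarrow> \<bar>u $ i - v $ i\<bar> \<le> e) \<Longrightarrow> \<nu> u \<le> \<nu> v + L * e"
    and upper: "\<And>\<eta> dA dB dD df dg. 0 < \<eta> \<Longrightarrow> perturbation m n E (Cn \<eta>) dA dB dD df dg
       \<Longrightarrow> \<nu> (first_order_change K Sinv x y dA dB dD df dg) \<le> \<eta> * \<kappa>"
    and lower: "\<And>\<eta> t. 0 < \<eta> \<Longrightarrow> t < \<kappa> \<Longrightarrow> \<exists>dA dB dD df dg. perturbation m n E (Cn \<eta>) dA dB dD df dg
       \<and> \<eta> * t \<le> \<nu> (first_order_change K Sinv x y dA dB dD df dg)"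
  shows "((\<lambda>\<eta>. SUP dy\<in>solution_changes E A B D f g x y (Cn \<eta>). ereal (\<nu> dy / \<eta>)) \<longlongrightarrow> ereal \<kappa>)
    (at_right 0)"
proof -
  let ?L = "first_order_change K Sinv x y"
  obtain \<epsilon> C where \<epsilon>C: "0 < \<epsilon>" "0 \<le> C"
    and near: "\<And>e dA dB dD df dg. 0 \<le> e \<Longrightarrow> e \<le> \<epsilon>
       \<Longrightarrow> dA \<in> carrier_mat m m \<Longrightarrow> dB \<in> carrier_mat n m \<Longrightarrow> dD \<in> carrier_mat n n
       \<Longrightarrow> df \<in> carrier_vec m \<Longrightarrow> dg \<in> carrier_vec n
       \<Longrightarrow> (\<And>i j. i < m + n \<Longrightarrow> j < m + n + 1 \<Longrightarrow>
              \<bar>append_col (saddle_data dA dB dD) (df @\<^sub>v dg) $$ (i,j)\<bar> \<le> e)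
       \<Longrightarrow> \<exists>dx\<in>carrier_vec m. \<exists>dy\<in>carrier_vec n.
             unique_solution (saddle_mat (A + dA) (B + dB) (D + dD))
               ((f + df) @\<^sub>v (g + dg)) ((x + dx) @\<^sub>v (y + dy)) \<and>
             (\<forall>i<n. \<bar>dy $ i - ?L dA dB dD df dg $ i\<bar> \<le> C * e\<^sup>2)"
    using change_near_first_order by blast
  have L_carrier: "?L dA dB dD df dg \<in> carrier_vec n"
    if "perturbation m n E (Cn \<eta>) dA dB dD df dg" for \<eta> dA dB dD df dg
    using that K_carrier Sinv x y by (auto simp: perturbation_def first_order_change_def)
  have near': "\<exists>dx\<in>carrier_vec m. \<exists>dy\<in>carrier_vec n.
             unique_solution (saddle_mat (A + dA) (B + dB) (D + dD))
               ((f + df) @\<^sub>v (g + dg)) ((x + dx) @\<^sub>v (y + dy)) \<and>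
             (\<forall>i<n. \<bar>dy $ i - ?L dA dB dD df dg $ i\<bar> \<le> C * R\<^sup>2 * \<eta>\<^sup>2)"
    if \<eta>: "0 < \<eta>" "\<eta> < \<epsilon> / R" and p: "perturbation m n E (Cn \<eta>) dA dB dD df dg"
    for \<eta> dA dB dD df dg
  proof -
    have c: "dA \<in> carrier_mat m m" "dB \<in> carrier_mat n m" "dD \<in> carrier_mat n n"
      "df \<in> carrier_vec m" "dg \<in> carrier_vec n"
      and Cn: "Cn \<eta> (append_col (saddle_data dA dB dD) (df @\<^sub>v dg))"
      using p by (auto simp: perturbation_def)
    have P: "append_col (saddle_data dA dB dD) (df @\<^sub>v dg) \<in> carrier_mat (m + n) (m + n + 1)"
      by (simp add: append_col_saddle_data[OF c])
    have "R * \<eta> \<le> \<epsilon>" "0 \<le> R * \<eta>" using \<eta> R by (auto simp: field_simps)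
    from near[OF this(2,1) c bound[OF \<eta>(1) P Cn]] show ?thesis
      by (simp add: power_mult_distrib mult.assoc)
  qed
  show ?thesis
  proof (rule tendsto_SUP_first_order)
    show "0 < \<epsilon> / R" using \<epsilon>C R by simp
    fix \<eta> :: real assume \<eta>: "0 < \<eta>" "\<eta> < \<epsilon> / R"
    {
      fix dy assume "dy \<in> solution_changes E A B D f g x y (Cn \<eta>)"
      then obtain dA dB dD df dg dx where p: "perturbation m n E (Cn \<eta>) dA dB dD df dg"
        and dx: "dx \<in> carrier_vec m" and dy: "dy \<in> carrier_vec n"
        and sol: "unique_solution (saddle_mat (A + dA) (B + dB) (D + dD))
               ((f + df) @\<^sub>v (g + dg)) ((x + dx) @\<^sub>v (y + dy))"
        using A D unfolding solution_changes_def perturbation_def Let_def by auto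
      obtain dx' dy' where dx': "dx' \<in> carrier_vec m" and dy': "dy' \<in> carrier_vec n"
        and sol': "unique_solution (saddle_mat (A + dA) (B + dB) (D + dD))
               ((f + df) @\<^sub>v (g + dg)) ((x + dx') @\<^sub>v (y + dy'))"
        and est: "\<forall>i<n. \<bar>dy' $ i - ?L dA dB dD df dg $ i\<bar> \<le> C * R\<^sup>2 * \<eta>\<^sup>2"
        using near'[OF \<eta> p] by blast
      have "(x + dx) @\<^sub>v (y + dy) = (x + dx') @\<^sub>v (y + dy')"
        using sol sol' unfolding unique_solution_def by blast
      moreover have "x + dx \<in> carrier_vec m" "x + dx' \<in> carrier_vec m"
        using x dx dx' by auto
      ultimately have "y + dy = y + dy'"
        using append_vec_eq by blast
      then have "dy $ i = dy' $ i" if "i < n" for i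
        using that dy dy' y by (metis add_left_cancel carrier_vecD index_add_vec(1))
      then have "dy = dy'" using dy dy' by auto
      then have "\<nu> dy \<le> \<nu> (?L dA dB dD df dg) + L * (C * R\<^sup>2 * \<eta>\<^sup>2)"
        using est \<epsilon>C by (intro lipschitz[OF dy L_carrier[OF p]]) auto
      with upper[OF \<eta>(1) p] show "\<nu> dy \<le> \<eta> * \<kappa> + L * C * R\<^sup>2 * \<eta>\<^sup>2"
        by (simp add: mult.assoc)
    }
    fix t assume "t < \<kappa>"
    then obtain dA dB dD df dg where p: "perturbation m n E (Cn \<eta>) dA dB dD df dg"
      and t: "\<eta> * t \<le> \<nu> (?L dA dB dD df dg)"
      using lower[OF \<eta>(1)] by blast
    obtain dx dy where dx: "dx \<in> carrier_vec m" and dy: "dy \<in> carrier_vec n"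
      and sol: "unique_solution (saddle_mat (A + dA) (B + dB) (D + dD))
             ((f + df) @\<^sub>v (g + dg)) ((x + dx) @\<^sub>v (y + dy))"
      and est: "\<forall>i<n. \<bar>dy $ i - ?L dA dB dD df dg $ i\<bar> \<le> C * R\<^sup>2 * \<eta>\<^sup>2"
      using near'[OF \<eta> p] by blast
    have "\<nu> (?L dA dB dD df dg) \<le> \<nu> dy + L * (C * R\<^sup>2 * \<eta>\<^sup>2)"
      using est \<epsilon>C by (intro lipschitz[OF L_carrier[OF p] dy]) (auto simp: abs_minus_commute)
    with t have "\<eta> * t - L * C * R\<^sup>2 * \<eta>\<^sup>2 \<le> \<nu> dy" by (simp add: mult.assoc)
    moreover have "dy \<in> solution_changes E A B D f g x y (Cn \<eta>)"
    proof -
      have "dim_row A = m" "dim_row D = n" using A D by auto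
      then show ?thesis
        using p dx dy sol unfolding solution_changes_def perturbation_def Let_def by blast
    qed
    ultimately show "\<exists>dy\<in>solution_changes E A B D f g x y (Cn \<eta>). \<eta> * t - L * C * R\<^sup>2 * \<eta>\<^sup>2 \<le> \<nu> dy"
      by blast
  qed
qed

end

section \<open>Kronecker products and coordinates of structured matrices\<close>

lemma index_mult_mat_vec_sum:
  assumes "M \<in> carrier_mat a b" "v \<in> carrier_vec b" "i < a"
  shows "(M *\<^sub>v v) $ i = (\<Sum>j<b. M $$ (i,j) * v $ j)"
  using assms by (simp add: scalar_prod_def lessThan_atLeast0)

lemma sum_div_mod:
  "(\<Sum>k<c * b. h (k div b) (k mod b)) = (\<Sum>q<c. \<Sum>s<b. h q (s::nat))"
proof (cases "b = 0")
  case False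
  then have b: "0 < b" by simp
  have lt: "q * b + s < c * b" if "q < c" "s < b" for q s
  proof -
    have "q * b + s < Suc q * b" using that by simp
    also have "\<dots> \<le> c * b" using that by (intro mult_le_mono1) simp
    finally show ?thesis .
  qed
  have "(\<Sum>k<c * b. h (k div b) (k mod b)) = (\<Sum>(q,s)\<in>{..<c} \<times> {..<b}. h q s)"
    by (rule sum.reindex_bij_witness[where i = "\<lambda>(q,s). q * b + s" and j = "\<lambda>k. (k div b, k mod b)"])
      (use b lt in \<open>auto simp: less_mult_imp_div_less\<close>)
  then show ?thesis by (simp add: sum.cartesian_product)
qed simp

lemma div_mod_less:
  fixes k b c :: nat
  assumes "k < c * b"
  shows "k div b < c" "k mod b < b"
proof -
  have "0 < b" using assms by (cases "b = 0") auto
  then show "k div b < c" "k mod b < b" using assms by (auto simp: less_mult_imp_div_less)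
qed

lemma stack_cols_carrier: "X \<in> carrier_mat a b \<Longrightarrow> stack_cols X \<in> carrier_vec (b * a)"
  by (simp add: stack_cols_def carrier_dim_vec mult.commute)

lemma stack_cols_index:
  "X \<in> carrier_mat a b \<Longrightarrow> k < b * a \<Longrightarrow> stack_cols X $ k = X $$ (k mod a, k div a)"
  by (auto simp: stack_cols_def mult.commute)

lemma row_mat_carrier: "v \<in> carrier_vec c \<Longrightarrow> row_mat v \<in> carrier_mat 1 c"
  by (rule carrier_matI) (simp_all add: row_mat_def)

lemma row_mat_index: "v \<in> carrier_vec c \<Longrightarrow> j < c \<Longrightarrow> row_mat v $$ (0,j) = v $ j"
  by (simp add: row_mat_def mat_of_rows_def)

lemma kronecker_carrier:
  "M \<in> carrier_mat a b \<Longrightarrow> N \<in> carrier_mat c d \<Longrightarrow> M \<otimes>\<^sub>K N \<in> carrier_mat (a * c) (b * d)"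
  by (auto simp: kronecker_def)

lemma kronecker_row_mat_stack_cols:
  assumes B: "B \<in> carrier_mat a b" and v: "v \<in> carrier_vec c" and X: "X \<in> carrier_mat b c"
  shows "(row_mat v \<otimes>\<^sub>K B) *\<^sub>v stack_cols X = B *\<^sub>v (X *\<^sub>v v)"
proof (rule eq_vecI)
  note R = row_mat_carrier[OF v]
  have M: "row_mat v \<otimes>\<^sub>K B \<in> carrier_mat a (c * b)" using kronecker_carrier[OF R B] by simp
  show "dim_vec ((row_mat v \<otimes>\<^sub>K B) *\<^sub>v stack_cols X) = dim_vec (B *\<^sub>v (X *\<^sub>v v))"
    using M B by simp
  fix i assume "i < dim_vec (B *\<^sub>v (X *\<^sub>v v))"
  then have i: "i < a" using B by simp
  have "((row_mat v \<otimes>\<^sub>K B) *\<^sub>v stack_cols X) $ i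
      = (\<Sum>k<c * b. v $ (k div b) * B $$ (i, k mod b) * X $$ (k mod b, k div b))"
    unfolding index_mult_mat_vec_sum[OF M stack_cols_carrier[OF X] i]
  proof (rule sum.cong[OF refl])
    fix k assume k: "k \<in> {..<c * b}"
    then have "k div b < c" by (simp add: less_mult_imp_div_less)
    with k i R B v show "(row_mat v \<otimes>\<^sub>K B) $$ (i,k) * stack_cols X $ k
       = v $ (k div b) * B $$ (i, k mod b) * X $$ (k mod b, k div b)"
      by (simp add: stack_cols_index[OF X] kronecker_def row_mat_index[OF v])
  qed
  also have "\<dots> = (\<Sum>q<c. \<Sum>s<b. v $ q * B $$ (i,s) * X $$ (s,q))"
    by (rule sum_div_mod)
  also have "\<dots> = (\<Sum>s<b. \<Sum>q<c. v $ q * B $$ (i,s) * X $$ (s,q))"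
    by (rule sum.swap)
  also have "\<dots> = (\<Sum>s<b. B $$ (i,s) * (X *\<^sub>v v) $ s)"
    by (intro sum.cong refl) (simp add: index_mult_mat_vec_sum[OF X v] sum_distrib_left mult_ac)
  also have "\<dots> = (B *\<^sub>v (X *\<^sub>v v)) $ i"
    using X v by (intro index_mult_mat_vec_sum[OF B _ i, symmetric]) simp
  finally show "((row_mat v \<otimes>\<^sub>K B) *\<^sub>v stack_cols X) $ i = (B *\<^sub>v (X *\<^sub>v v)) $ i" .
qed

lemma kronecker_stack_cols_row_mat:
  assumes K: "K \<in> carrier_mat a c" and y: "y \<in> carrier_vec b" and X: "X \<in> carrier_mat b c"
  shows "(K \<otimes>\<^sub>K row_mat y) *\<^sub>v stack_cols X = K *\<^sub>v (X\<^sup>T *\<^sub>v y)"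
proof (rule eq_vecI)
  note R = row_mat_carrier[OF y]
  have XT: "X\<^sup>T \<in> carrier_mat c b" using X by simp
  have M: "K \<otimes>\<^sub>K row_mat y \<in> carrier_mat a (c * b)" using kronecker_carrier[OF K R] by simp
  show "dim_vec ((K \<otimes>\<^sub>K row_mat y) *\<^sub>v stack_cols X) = dim_vec (K *\<^sub>v (X\<^sup>T *\<^sub>v y))"
    using M K by simp
  fix i assume "i < dim_vec (K *\<^sub>v (X\<^sup>T *\<^sub>v y))"
  then have i: "i < a" using K by simp
  have "((K \<otimes>\<^sub>K row_mat y) *\<^sub>v stack_cols X) $ i
      = (\<Sum>k<c * b. K $$ (i, k div b) * y $ (k mod b) * X $$ (k mod b, k div b))"
    unfolding index_mult_mat_vec_sum[OF M stack_cols_carrier[OF X] i]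
  proof (rule sum.cong[OF refl])
    fix k assume k: "k \<in> {..<c * b}"
    then have "k div b < c" "k mod b < b" using div_mod_less by auto
    with k i R K y show "(K \<otimes>\<^sub>K row_mat y) $$ (i,k) * stack_cols X $ k
       = K $$ (i, k div b) * y $ (k mod b) * X $$ (k mod b, k div b)"
      by (simp add: stack_cols_index[OF X] kronecker_def row_mat_index[OF y])
  qed
  also have "\<dots> = (\<Sum>q<c. \<Sum>s<b. K $$ (i,q) * y $ s * X $$ (s,q))"
    by (rule sum_div_mod)
  also have "\<dots> = (\<Sum>q<c. K $$ (i,q) * (X\<^sup>T *\<^sub>v y) $ q)"
  proof (intro sum.cong refl)
    fix q assume "q \<in> {..<c}"
    then show "(\<Sum>s<b. K $$ (i,q) * y $ s * X $$ (s,q)) = K $$ (i,q) * (X\<^sup>T *\<^sub>v y) $ q"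
      using X by (simp add: index_mult_mat_vec_sum[OF XT y] sum_distrib_left mult_ac del: index_mult_mat_vec)
  qed
  also have "\<dots> = (K *\<^sub>v (X\<^sup>T *\<^sub>v y)) $ i"
    using XT y by (intro index_mult_mat_vec_sum[OF K _ i, symmetric]) simp
  finally show "((K \<otimes>\<^sub>K row_mat y) *\<^sub>v stack_cols X) $ i = (K *\<^sub>v (X\<^sup>T *\<^sub>v y)) $ i" .
qed

lemma sum_nth_distinct:
  "distinct ps \<Longrightarrow> (\<Sum>k<length ps. h (ps ! k)) = (\<Sum>p\<in>set ps. h p)"
  by (rule sum.reindex_bij_betw[OF bij_betw_nth]) auto

lemma mat_of_cols_mult_coordinates:
  assumes ps: "distinct ps" and F: "\<And>p. F p \<in> carrier_vec a" and i: "i < a"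
  shows "(mat_of_cols a (map F ps) *\<^sub>v vec_of_list (map h ps)) $ i = (\<Sum>p\<in>set ps. F p $ i * (h p :: real))"
proof -
  have M: "mat_of_cols a (map F ps) \<in> carrier_mat a (length ps)" by (rule carrier_matI) simp_all
  have v: "vec_of_list (map h ps) \<in> carrier_vec (length ps)" by (simp add: carrier_dim_vec)
  show ?thesis
    unfolding index_mult_mat_vec_sum[OF M v i] sum_nth_distinct[OF ps, symmetric]
    using i by (intro sum.cong) (auto simp: mat_of_cols_def simp flip: vec_of_list_index)
qed

lemma vec_coordinates:
  assumes ps: "distinct ps" and u: "u \<in> carrier_vec (length ps)"
  obtains h where "u = vec_of_list (map h ps)"
proof
  let ?h = "\<lambda>p. the (map_of (zip ps (list_of_vec u)) p)"
  have "map ?h ps = list_of_vec u"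
    using ps u by (intro nth_equalityI) (auto simp: map_of_zip_nth)
  then show "u = vec_of_list (map ?h ps)" by (metis vec_list)
qed

lemma set_sym_pairs: "set (sym_pairs m) = {(i,j). i \<le> j \<and> j < m}"
  by (force simp: sym_pairs_def)

lemma distinct_sym_pairs: "distinct (sym_pairs m)"
proof -
  have "x = y" if "x < m" "map (Pair x) [x..<m] = map (Pair y) [y..<m]" for x y
  proof -
    have "(x,x) \<in> set (map (Pair x) [x..<m])" using that(1) by simp
    then show ?thesis unfolding that(2) by auto
  qed
  then show ?thesis
    by (auto simp: sym_pairs_def distinct_map inj_on_def intro!: distinct_concat)
qed

lemma vec_sym_coordinates:
  "X \<in> carrier_mat m m \<Longrightarrow> vec_sym X = vec_of_list (map (\<lambda>p. X $$ p) (sym_pairs m))"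
  by (simp add: vec_sym_def case_prod_beta)

lemma vec_sym_carrier: "X \<in> carrier_mat m m \<Longrightarrow> vec_sym X \<in> carrier_vec (length (sym_pairs m))"
  by (simp add: vec_sym_def carrier_dim_vec)

lemma vec_sym_index:
  "X \<in> carrier_mat m m \<Longrightarrow> k < length (sym_pairs m) \<Longrightarrow> vec_sym X $ k = X $$ (sym_pairs m ! k)"
  by (simp add: vec_sym_coordinates vec_of_list_index del: vec_of_list_map)

lemma symmetric_mats_carrier: "X \<in> symmetric_mats m \<Longrightarrow> X \<in> carrier_mat m m"
  by (simp add: symmetric_mats_def)

lemma symmetric_mats_index:
  assumes "X \<in> symmetric_mats m" "i < m" "j < m"
  shows "X $$ (i,j) = X $$ (j,i)"
proof -
  have "X\<^sup>T $$ (i,j) = X $$ (j,i)"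
    using assms by (intro index_transpose_mat(1)) (auto simp: symmetric_mats_def)
  with assms(1) show ?thesis by (simp add: symmetric_mats_def)
qed

text \<open>The entries with \<open>i > j\<close>, absent from \<open>vec_sym\<close>, are restored by symmetry.\<close>

lemma Phi_sym_vec_sym:
  assumes X: "X \<in> symmetric_mats m"
  shows "Phi_sym m *\<^sub>v vec_sym X = stack_cols X"
proof (rule eq_vecI)
  note Xc = symmetric_mats_carrier[OF X]
  show "dim_vec (Phi_sym m *\<^sub>v vec_sym X) = dim_vec (stack_cols X)"
    using Xc by (simp add: Phi_sym_def stack_cols_def)
  fix k assume "k < dim_vec (stack_cols X)"
  then have k: "k < m * m" using Xc by (simp add: stack_cols_def)
  define i j where "i = k mod m" and "j = k div m"
  have ij: "i < m" "j < m"
    using div_mod_less[OF k] by (auto simp: i_def j_def)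
  have U: "stack_cols (sym_unit m p) \<in> carrier_vec (m * m)" for p
    by (intro stack_cols_carrier) (simp add: sym_unit_def)
  have "(Phi_sym m *\<^sub>v vec_sym X) $ k
      = (\<Sum>p\<in>set (sym_pairs m). stack_cols (sym_unit m p) $ k * X $$ p)"
    unfolding Phi_sym_def vec_sym_coordinates[OF Xc]
    by (rule mat_of_cols_mult_coordinates[OF distinct_sym_pairs U k])
  also have "\<dots> = (\<Sum>p\<in>set (sym_pairs m). if (min i j, max i j) = p then X $$ p else 0)"
  proof (rule sum.cong[OF refl])
    fix p assume "p \<in> set (sym_pairs m)"
    then obtain a b where p: "p = (a,b)" "a \<le> b" "b < m" by (auto simp: set_sym_pairs)
    have "stack_cols (sym_unit m p) $ k = sym_unit m p $$ (i,j)"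
      unfolding i_def j_def using k by (intro stack_cols_index[of _ m m]) (auto simp: sym_unit_def)
    also have "\<dots> = (if (min i j, max i j) = p then 1 else 0)"
      using ij p by (auto simp: sym_unit_def min_def max_def)
    finally show "stack_cols (sym_unit m p) $ k * X $$ p = (if (min i j, max i j) = p then X $$ p else 0)"
      by simp
  qed
  also have "\<dots> = X $$ (min i j, max i j)"
    using ij by (subst sum.delta'[OF finite_set]) (auto simp: set_sym_pairs)
  also have "\<dots> = X $$ (i,j)"
    using symmetric_mats_index[OF X ij] by (auto simp: min_def max_def)
  also have "\<dots> = stack_cols X $ k"
    unfolding i_def j_def using stack_cols_index[OF Xc k] by simp
  finally show "(Phi_sym m *\<^sub>v vec_sym X) $ k = stack_cols X $ k" .
qed

lemma vec_sym_surj: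
  assumes u: "u \<in> carrier_vec (length (sym_pairs m))"
  obtains X where "X \<in> symmetric_mats m" "vec_sym X = u"
proof -
  obtain h where h: "u = vec_of_list (map h (sym_pairs m))"
    using vec_coordinates[OF distinct_sym_pairs u] .
  define X where "X = mat m m (\<lambda>(i,j). h (min i j, max i j))"
  have Xc: "X \<in> carrier_mat m m" by (simp add: X_def)
  have "map (\<lambda>p. X $$ p) (sym_pairs m) = map h (sym_pairs m)"
    by (auto simp: set_sym_pairs X_def min_def max_def)
  then have "vec_sym X = u" unfolding h vec_sym_coordinates[OF Xc] by (rule arg_cong)
  moreover have "X \<in> symmetric_mats m"
    by (auto simp: symmetric_mats_def X_def min.commute max.commute)
  ultimately show thesis by (rule that[rotated])
qed

text \<open>For symmetric matrices an entrywise bound is the same as a bound on the independent entries,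
  so the coordinates can be perturbed independently of each other.\<close>

lemma vec_sym_bound_iff:
  assumes X: "X \<in> symmetric_mats m" and Y: "Y \<in> symmetric_mats m"
  shows "(\<forall>k<length (sym_pairs m). \<bar>vec_sym X $ k\<bar> \<le> \<eta> * vec_sym (abs_mat Y) $ k)
     \<longleftrightarrow> (\<forall>i<m. \<forall>j<m. \<bar>X $$ (i,j)\<bar> \<le> \<eta> * \<bar>Y $$ (i,j)\<bar>)"
proof -
  have Xc: "X \<in> carrier_mat m m" and Yc: "Y \<in> carrier_mat m m" "abs_mat Y \<in> carrier_mat m m"
    using X Y by (auto simp: symmetric_mats_def)
  have entry: "abs_mat Y $$ (sym_pairs m ! k) = \<bar>Y $$ (sym_pairs m ! k)\<bar>" if "k < length (sym_pairs m)" for k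
  proof -
    have "sym_pairs m ! k \<in> set (sym_pairs m)" using that by simp
    then show ?thesis using Yc by (auto simp: set_sym_pairs)
  qed
  have "(\<forall>k<length (sym_pairs m). \<bar>vec_sym X $ k\<bar> \<le> \<eta> * vec_sym (abs_mat Y) $ k)
     \<longleftrightarrow> (\<forall>p\<in>set (sym_pairs m). \<bar>X $$ p\<bar> \<le> \<eta> * \<bar>Y $$ p\<bar>)"
    unfolding all_set_conv_all_nth using entry
    by (simp add: vec_sym_index[OF Xc] vec_sym_index[OF Yc(2)])
  also have "\<dots> \<longleftrightarrow> (\<forall>i<m. \<forall>j<m. \<bar>X $$ (i,j)\<bar> \<le> \<eta> * \<bar>Y $$ (i,j)\<bar>)"
  proof
    assume *: "\<forall>p\<in>set (sym_pairs m). \<bar>X $$ p\<bar> \<le> \<eta> * \<bar>Y $$ p\<bar>"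
    show "\<forall>i<m. \<forall>j<m. \<bar>X $$ (i,j)\<bar> \<le> \<eta> * \<bar>Y $$ (i,j)\<bar>"
    proof (intro allI impI)
      fix i j assume ij: "i < m" "j < m"
      show "\<bar>X $$ (i,j)\<bar> \<le> \<eta> * \<bar>Y $$ (i,j)\<bar>"
      proof (cases "i \<le> j")
        case True then show ?thesis using * ij by (auto simp: set_sym_pairs)
      next
        case False
        then have "(j,i) \<in> set (sym_pairs m)" using ij by (simp add: set_sym_pairs)
        with * show ?thesis
          using symmetric_mats_index[OF X ij] symmetric_mats_index[OF Y ij] by fastforce
      qed
    qed
  qed (auto simp: set_sym_pairs)
  finally show ?thesis .
qed

lemma toeplitz_mats_carrier: "T \<in> toeplitz_mats nr nc \<Longrightarrow> T \<in> carrier_mat nr nc"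
  by (auto simp: toeplitz_mats_def toeplitz_of_def)

lemma set_toep_indices: "set (toep_indices nr nc) = {1 - int nr..int nc - 1}"
  by (auto simp: toep_indices_def)

lemma distinct_toep_indices: "distinct (toep_indices nr nc)"
  by (simp add: toep_indices_def)

lemma length_toep_indices: "0 < nr \<Longrightarrow> 0 < nc \<Longrightarrow> length (toep_indices nr nc) = nr + nc - 1"
  by (simp add: toep_indices_def)

text \<open>Without positive dimensions \<open>toep_indices\<close> may contain indices of no diagonal.\<close>

lemma toep_indices_bounds:
  assumes "0 < nr" "0 < nc" "k \<in> set (toep_indices nr nc)"
  shows "nat (- k) < nr" "nat k < nc"
  using assms unfolding set_toep_indices atLeastAtMost_iff by linarith+

lemma vec_toep_coordinates:
  "X \<in> carrier_mat nr nc \<Longrightarrow> vec_toep X = vec_of_list (map (\<lambda>k. X $$ (nat (- k), nat k)) (toep_indices nr nc))"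
  by (simp add: vec_toep_def)

lemma vec_toep_carrier:
  "X \<in> carrier_mat nr nc \<Longrightarrow> vec_toep X \<in> carrier_vec (length (toep_indices nr nc))"
  by (simp add: vec_toep_def carrier_dim_vec)

lemma vec_toep_index:
  "X \<in> carrier_mat nr nc \<Longrightarrow> k < length (toep_indices nr nc)
   \<Longrightarrow> vec_toep X $ k = X $$ (nat (- (toep_indices nr nc ! k)), nat (toep_indices nr nc ! k))"
  by (simp add: vec_toep_coordinates vec_of_list_index del: vec_of_list_map)

lemma toeplitz_entry:
  assumes T: "T \<in> toeplitz_mats nr nc" and ij: "i < nr" "j < nc"
  shows "T $$ (nat (- (int j - int i)), nat (int j - int i)) = T $$ (i,j)"
proof -
  obtain t where t: "T = toeplitz_of nr nc t" using T by (auto simp: toeplitz_mats_def)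
  have "nat (- (int j - int i)) < nr" "nat (int j - int i) < nc" using ij by linarith+
  moreover have "int (nat (int j - int i)) - int (nat (- (int j - int i))) = int j - int i" by simp
  ultimately show ?thesis using ij by (simp only: t toeplitz_of_def index_mat prod.case)
qed

lemma Phi_toep_vec_toep:
  assumes T: "T \<in> toeplitz_mats nr nc"
  shows "Phi_toep nr nc *\<^sub>v vec_toep T = stack_cols T"
proof (rule eq_vecI)
  note Tc = toeplitz_mats_carrier[OF T]
  show "dim_vec (Phi_toep nr nc *\<^sub>v vec_toep T) = dim_vec (stack_cols T)"
    using Tc by (simp add: Phi_toep_def stack_cols_def)
  fix k assume "k < dim_vec (stack_cols T)"
  then have k: "k < nc * nr" using Tc by (simp add: stack_cols_def mult.commute)
  then have k': "k < nr * nc" by (simp add: mult.commute)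
  define i j where "i = k mod nr" and "j = k div nr"
  have ij: "i < nr" "j < nc"
    using div_mod_less[OF k] by (auto simp: i_def j_def)
  let ?J = "\<lambda>l. toeplitz_of nr nc (\<lambda>l'. if l' = l then 1 else 0)"
  have Jc: "?J l \<in> carrier_mat nr nc" for l by (simp add: toeplitz_of_def)
  have U: "stack_cols (?J l) \<in> carrier_vec (nr * nc)" for l
    using stack_cols_carrier[OF Jc] by (simp add: mult.commute)
  have "(Phi_toep nr nc *\<^sub>v vec_toep T) $ k
      = (\<Sum>l\<in>set (toep_indices nr nc). stack_cols (?J l) $ k * T $$ (nat (- l), nat l))"
    unfolding Phi_toep_def vec_toep_coordinates[OF Tc]
    by (rule mat_of_cols_mult_coordinates[OF distinct_toep_indices U k'])
  also have "\<dots> = (\<Sum>l\<in>set (toep_indices nr nc). if int j - int i = l then T $$ (nat (- l), nat l) else 0)"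
  proof (rule sum.cong[OF refl])
    fix l
    have "stack_cols (?J l) $ k = ?J l $$ (i,j)"
      unfolding i_def j_def by (rule stack_cols_index[OF Jc k])
    also have "\<dots> = (if int j - int i = l then 1 else 0)"
      using ij by (simp add: toeplitz_of_def)
    finally show "stack_cols (?J l) $ k * T $$ (nat (- l), nat l)
      = (if int j - int i = l then T $$ (nat (- l), nat l) else 0)" by simp
  qed
  also have "\<dots> = T $$ (nat (- (int j - int i)), nat (int j - int i))"
    using ij by (subst sum.delta'[OF finite_set]) (auto simp: set_toep_indices)
  also have "\<dots> = T $$ (i,j)" by (rule toeplitz_entry[OF T ij])
  also have "\<dots> = stack_cols T $ k"
    unfolding i_def j_def using stack_cols_index[OF Tc k] by simp
  finally show "(Phi_toep nr nc *\<^sub>v vec_toep T) $ k = stack_cols T $ k" .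
qed

lemma vec_toep_surj:
  assumes pos: "0 < nr" "0 < nc" and u: "u \<in> carrier_vec (length (toep_indices nr nc))"
  obtains T where "T \<in> toeplitz_mats nr nc" "vec_toep T = u"
proof -
  obtain h where h: "u = vec_of_list (map h (toep_indices nr nc))"
    using vec_coordinates[OF distinct_toep_indices u] .
  define T where "T = toeplitz_of nr nc h"
  have Tc: "T \<in> carrier_mat nr nc" by (simp add: T_def toeplitz_of_def)
  have "map (\<lambda>k. T $$ (nat (- k), nat k)) (toep_indices nr nc) = map h (toep_indices nr nc)"
  proof (rule map_cong[OF refl])
    fix k assume "k \<in> set (toep_indices nr nc)"
    then have "nat (- k) < nr" "nat k < nc" by (rule toep_indices_bounds[OF pos])+
    moreover have "int (nat k) - int (nat (- k)) = k" by simp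
    ultimately show "T $$ (nat (- k), nat k) = h k"
      by (simp only: T_def toeplitz_of_def index_mat prod.case)
  qed
  then have "vec_toep T = u" unfolding h vec_toep_coordinates[OF Tc] by (rule arg_cong)
  moreover have "T \<in> toeplitz_mats nr nc" by (simp add: T_def toeplitz_mats_def)
  ultimately show thesis by (rule that[rotated])
qed

lemma vec_toep_bound_iff:
  assumes pos: "0 < nr" "0 < nc" and X: "X \<in> toeplitz_mats nr nc" and Y: "Y \<in> toeplitz_mats nr nc"
  shows "(\<forall>k<length (toep_indices nr nc). \<bar>vec_toep X $ k\<bar> \<le> \<eta> * vec_toep (abs_mat Y) $ k)
     \<longleftrightarrow> (\<forall>i<nr. \<forall>j<nc. \<bar>X $$ (i,j)\<bar> \<le> \<eta> * \<bar>Y $$ (i,j)\<bar>)"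
proof -
  have Xc: "X \<in> carrier_mat nr nc" and Yc: "Y \<in> carrier_mat nr nc" "abs_mat Y \<in> carrier_mat nr nc"
    using X Y toeplitz_mats_carrier by auto
  let ?e = "\<lambda>l. (nat (- l), nat l)"
  have entry: "abs_mat Y $$ ?e (toep_indices nr nc ! k) = \<bar>Y $$ ?e (toep_indices nr nc ! k)\<bar>"
    if "k < length (toep_indices nr nc)" for k
  proof -
    have "toep_indices nr nc ! k \<in> set (toep_indices nr nc)" using that by simp
    then show ?thesis using Yc toep_indices_bounds[OF pos] by simp
  qed
  have "(\<forall>k<length (toep_indices nr nc). \<bar>vec_toep X $ k\<bar> \<le> \<eta> * vec_toep (abs_mat Y) $ k)
     \<longleftrightarrow> (\<forall>l\<in>set (toep_indices nr nc). \<bar>X $$ ?e l\<bar> \<le> \<eta> * \<bar>Y $$ ?e l\<bar>)"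
    unfolding all_set_conv_all_nth using entry
    by (simp add: vec_toep_index[OF Xc] vec_toep_index[OF Yc(2)])
  also have "\<dots> \<longleftrightarrow> (\<forall>i<nr. \<forall>j<nc. \<bar>X $$ (i,j)\<bar> \<le> \<eta> * \<bar>Y $$ (i,j)\<bar>)"
  proof
    assume *: "\<forall>l\<in>set (toep_indices nr nc). \<bar>X $$ ?e l\<bar> \<le> \<eta> * \<bar>Y $$ ?e l\<bar>"
    show "\<forall>i<nr. \<forall>j<nc. \<bar>X $$ (i,j)\<bar> \<le> \<eta> * \<bar>Y $$ (i,j)\<bar>"
    proof (intro allI impI)
      fix i j assume ij: "i < nr" "j < nc"
      then have "int j - int i \<in> set (toep_indices nr nc)" by (simp add: set_toep_indices)
      from bspec[OF * this] show "\<bar>X $$ (i,j)\<bar> \<le> \<eta> * \<bar>Y $$ (i,j)\<bar>"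
        by (simp only: toeplitz_entry[OF X ij] toeplitz_entry[OF Y ij])
    qed
  qed (use toep_indices_bounds[OF pos] in blast)
  finally show ?thesis .
qed

section \<open>Norms and weights\<close>

lemma norm2_vec_L2_set: "norm2_vec v = L2_set (\<lambda>i. v $ i) {..<dim_vec v}"
  by (simp add: norm2_vec_def L2_set_def scalar_prod_def lessThan_atLeast0 power2_eq_square)

lemma norm2_vec_nonneg: "0 \<le> norm2_vec v"
  by (simp add: norm2_vec_L2_set)

lemma norm2_vec_square: "v \<in> carrier_vec k \<Longrightarrow> (norm2_vec v)\<^sup>2 = (\<Sum>i<k. (v $ i)\<^sup>2)"
  by (simp add: norm2_vec_L2_set L2_set_def sum_nonneg)

lemma norm2_vec_append:
  assumes "u \<in> carrier_vec a" "v \<in> carrier_vec b"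
  shows "(norm2_vec (u @\<^sub>v v))\<^sup>2 = (norm2_vec u)\<^sup>2 + (norm2_vec v)\<^sup>2"
proof -
  have "0 \<le> w \<bullet> w" for w :: "real vec"
    by (auto simp: scalar_prod_def intro!: sum_nonneg)
  then show ?thesis using assms by (simp add: norm2_vec_def scalar_prod_append)
qed

lemma norm2_vec_smult: "norm2_vec (c \<cdot>\<^sub>v v) = \<bar>c\<bar> * norm2_vec v"
proof -
  have "norm2_vec (c \<cdot>\<^sub>v v) = sqrt (c\<^sup>2 * (v \<bullet> v))"
    by (simp add: norm2_vec_def power2_eq_square mult.assoc)
  then show ?thesis by (simp add: norm2_vec_def real_sqrt_mult)
qed

lemma norm2_vec_uminus: "norm2_vec (- v) = norm2_vec v"
  by (simp add: norm2_vec_L2_set L2_set_def)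

lemma abs_index_le_norm2_vec: "i < dim_vec v \<Longrightarrow> \<bar>v $ i\<bar> \<le> norm2_vec v"
proof -
  assume i: "i < dim_vec v"
  have "(v $ i)\<^sup>2 \<le> (\<Sum>i<dim_vec v. (v $ i)\<^sup>2)"
    using i by (intro member_le_sum) auto
  then have "sqrt ((v $ i)\<^sup>2) \<le> norm2_vec v"
    unfolding norm2_vec_L2_set L2_set_def by (rule real_sqrt_le_mono)
  then show ?thesis by simp
qed

lemma norm2_vec_le:
  assumes "\<And>i. i < dim_vec v \<Longrightarrow> \<bar>v $ i\<bar> \<le> e"
  shows "norm2_vec v \<le> real (dim_vec v) * e"
proof -
  have "norm2_vec v \<le> (\<Sum>i<dim_vec v. \<bar>v $ i\<bar>)"
    unfolding norm2_vec_L2_set by (rule L2_set_le_sum_abs)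
  also have "\<dots> \<le> real (dim_vec v) * e"
    using sum_bounded_above[of "{..<dim_vec v}" "\<lambda>i. \<bar>v $ i\<bar>" e] assms by simp
  finally show ?thesis .
qed

lemma norm2_vec_lipschitz:
  assumes u: "u \<in> carrier_vec k" and v: "v \<in> carrier_vec k"
    and e: "\<And>i. i < k \<Longrightarrow> \<bar>u $ i - v $ i\<bar> \<le> e"
  shows "norm2_vec u \<le> norm2_vec v + real k * e"
proof -
  have "norm2_vec u = L2_set (\<lambda>i. v $ i + (u - v) $ i) {..<k}"
    using u v by (auto simp: norm2_vec_L2_set intro!: L2_set_cong)
  also have "\<dots> \<le> norm2_vec v + norm2_vec (u - v)"
    using u v L2_set_triangle_ineq[of "\<lambda>i. v $ i" "\<lambda>i. (u - v) $ i" "{..<k}"]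
    by (simp add: norm2_vec_L2_set)
  also have "norm2_vec (u - v) \<le> real k * e"
    using norm2_vec_le[of "u - v" e] e u v by simp
  finally show ?thesis by simp
qed

lemma frobenius_norm_square:
  "M \<in> carrier_mat a b \<Longrightarrow> (frobenius_norm M)\<^sup>2 = (\<Sum>i<a. \<Sum>j<b. (M $$ (i,j))\<^sup>2)"
  by (simp add: frobenius_norm_def sum_nonneg)

lemma frobenius_norm_nonneg: "0 \<le> frobenius_norm M"
  by (simp add: frobenius_norm_def sum_nonneg)

lemma abs_index_le_frobenius_norm:
  assumes "i < dim_row M" "j < dim_col M"
  shows "\<bar>M $$ (i,j)\<bar> \<le> frobenius_norm M"
proof -
  have "(M $$ (i,j))\<^sup>2 \<le> (\<Sum>j<dim_col M. (M $$ (i,j))\<^sup>2)"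
    using assms by (intro member_le_sum) auto
  also have "\<dots> \<le> (\<Sum>i<dim_row M. \<Sum>j<dim_col M. (M $$ (i,j))\<^sup>2)"
    using assms by (intro member_le_sum) (auto intro!: sum_nonneg)
  finally have "sqrt ((M $$ (i,j))\<^sup>2) \<le> frobenius_norm M"
    unfolding frobenius_norm_def by (rule real_sqrt_le_mono)
  then show ?thesis by simp
qed

lemma norm2_vec_stack_cols: "norm2_vec (stack_cols X) = frobenius_norm X"
proof (rule power2_eq_imp_eq)
  let ?a = "dim_row X" and ?b = "dim_col X"
  have X: "X \<in> carrier_mat ?a ?b" by simp
  have "(norm2_vec (stack_cols X))\<^sup>2 = (\<Sum>k<?b * ?a. (X $$ (k mod ?a, k div ?a))\<^sup>2)"
    by (simp add: norm2_vec_square[OF stack_cols_carrier[OF X]] stack_cols_index[OF X])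
  also have "\<dots> = (\<Sum>q<?b. \<Sum>s<?a. (X $$ (s,q))\<^sup>2)"
    by (rule sum_div_mod[where h = "\<lambda>q s. (X $$ (s,q))\<^sup>2"])
  also have "\<dots> = (\<Sum>s<?a. \<Sum>q<?b. (X $$ (s,q))\<^sup>2)" by (rule sum.swap)
  finally show "(norm2_vec (stack_cols X))\<^sup>2 = (frobenius_norm X)\<^sup>2"
    by (simp add: frobenius_norm_square[OF X])
qed (rule norm2_vec_nonneg frobenius_norm_nonneg)+

lemma stack_cols_surj:
  assumes u: "u \<in> carrier_vec (b * a)"
  obtains X where "X \<in> carrier_mat a b" "stack_cols X = u"
proof
  let ?X = "mat a b (\<lambda>(i,j). u $ (j * a + i))"
  show X: "?X \<in> carrier_mat a b" by simp
  show "stack_cols ?X = u"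
  proof (rule eq_vecI)
    fix k assume "k < dim_vec u"
    then have k: "k < b * a" using u by simp
    then have "k div a < b" "k mod a < a"
      by (rule div_mod_less)+
    then show "stack_cols ?X $ k = u $ k"
      unfolding stack_cols_index[OF X k] by simp
  qed (use u in \<open>simp add: stack_cols_def\<close>)
qed

lemma mat_diag_mult_vec:
  fixes w :: "nat \<Rightarrow> real"
  assumes u: "u \<in> carrier_vec k"
  shows "mat_diag k w *\<^sub>v u = vec k (\<lambda>i. w i * u $ i)"
proof (rule eq_vecI)
  fix i assume "i < dim_vec (vec k (\<lambda>i. w i * u $ i))"
  then have i: "i < k" by simp
  have "(mat_diag k w *\<^sub>v u) $ i = (\<Sum>j<k. if i = j then w j * u $ j else 0)"
    unfolding index_mult_mat_vec_sum[OF mat_diag_dim u i]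
    using i by (intro sum.cong) (auto simp: mat_diag_def)
  then show "(mat_diag k w *\<^sub>v u) $ i = vec k (\<lambda>i. w i * u $ i) $ i"
    using i by simp
qed (simp add: mat_diag_def)

lemma mat_inv_mat_diag:
  fixes w :: "nat \<Rightarrow> real"
  assumes "\<And>i. i < k \<Longrightarrow> w i \<noteq> 0"
  shows "mat_inv (mat_diag k w) \<in> carrier_mat k k"
    "mat_inv (mat_diag k w) * mat_diag k w = 1\<^sub>m k" "mat_diag k w * mat_inv (mat_diag k w) = 1\<^sub>m k"
proof -
  have one: "mat_diag k (\<lambda>i. 1 / w i * w i) = 1\<^sub>m k" "mat_diag k (\<lambda>i. w i * (1 / w i)) = 1\<^sub>m k"
    using assms by (auto simp: mat_diag_def intro!: eq_matI)
  have "mat_inv (mat_diag k w) = mat_diag k (\<lambda>i. 1 / w i)"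
    by (rule mat_inv_left_inverse) (simp_all only: mat_diag_dim mat_diag_diag one)
  then show "mat_inv (mat_diag k w) \<in> carrier_mat k k"
    "mat_inv (mat_diag k w) * mat_diag k w = 1\<^sub>m k" "mat_diag k w * mat_inv (mat_diag k w) = 1\<^sub>m k"
    by (simp_all only: mat_diag_dim mat_diag_diag one)
qed

lemma weight_sym_inverse:
  "mat_inv (weight_sym m) \<in> carrier_mat (length (sym_pairs m)) (length (sym_pairs m))"
  "mat_inv (weight_sym m) * weight_sym m = 1\<^sub>m (length (sym_pairs m))"
  "weight_sym m * mat_inv (weight_sym m) = 1\<^sub>m (length (sym_pairs m))"
  unfolding weight_sym_def by (rule mat_inv_mat_diag; simp split: prod.splits)+

lemma weight_toep_inverse:
  assumes "0 < nr" "0 < nc"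
  shows "mat_inv (weight_toep nr nc) \<in> carrier_mat (nr + nc - 1) (nr + nc - 1)"
    "mat_inv (weight_toep nr nc) * weight_toep nr nc = 1\<^sub>m (nr + nc - 1)"
    "weight_toep nr nc * mat_inv (weight_toep nr nc) = 1\<^sub>m (nr + nc - 1)"
  unfolding weight_toep_def by (rule mat_inv_mat_diag; use assms in auto)+

text \<open>The weight \<open>\<surd>2\<close> accounts for the two occurrences of an off-diagonal entry.\<close>

lemma norm2_vec_weight_sym:
  assumes X: "X \<in> symmetric_mats m"
  shows "norm2_vec (weight_sym m *\<^sub>v vec_sym X) = frobenius_norm X"
proof (rule power2_eq_imp_eq)
  note Xc = symmetric_mats_carrier[OF X]
  let ?w = "\<lambda>(i,j). if i = j then 1 else sqrt 2"
  let ?U = "{(i,j). i \<le> j \<and> j < m}" and ?L = "{(i,j). j < i \<and> i < m}"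
  have fin: "finite ?U" "finite ?L"
    by (rule finite_subset[of _ "{..<m} \<times> {..<m}"]; auto)+
  have "(norm2_vec (weight_sym m *\<^sub>v vec_sym X))\<^sup>2
      = (\<Sum>k<length (sym_pairs m). (?w (sym_pairs m ! k) * X $$ (sym_pairs m ! k))\<^sup>2)"
    unfolding weight_sym_def mat_diag_mult_vec[OF vec_sym_carrier[OF Xc]]
    by (subst norm2_vec_square[OF vec_carrier], rule sum.cong) (simp_all add: vec_sym_index[OF Xc] case_prod_beta)
  also have "\<dots> = (\<Sum>p\<in>?U. (?w p * X $$ p)\<^sup>2)"
    unfolding sum_nth_distinct[OF distinct_sym_pairs, where h = "\<lambda>p. (?w p * X $$ p)\<^sup>2"] set_sym_pairs ..
  also have "\<dots> = (\<Sum>p\<in>?U. (X $$ p)\<^sup>2 + (if fst p < snd p then (X $$ p)\<^sup>2 else 0))"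
    by (rule sum.cong) (auto simp: power_mult_distrib)
  also have "\<dots> = (\<Sum>p\<in>?U. (X $$ p)\<^sup>2) + (\<Sum>p\<in>{p\<in>?U. fst p < snd p}. (X $$ p)\<^sup>2)"
    unfolding sum.distrib by (subst sum.inter_filter[OF fin(1)]) simp
  also have "(\<Sum>p\<in>{p\<in>?U. fst p < snd p}. (X $$ p)\<^sup>2) = (\<Sum>p\<in>?L. (X $$ p)\<^sup>2)"
    by (rule sum.reindex_bij_witness[where i = prod.swap and j = prod.swap])
      (auto simp: symmetric_mats_index[OF X])
  also have "(\<Sum>p\<in>?U. (X $$ p)\<^sup>2) + (\<Sum>p\<in>?L. (X $$ p)\<^sup>2) = (\<Sum>p\<in>?U \<union> ?L. (X $$ p)\<^sup>2)"
    by (rule sum.union_disjoint[symmetric]) (use fin in auto)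
  also have "?U \<union> ?L = {..<m} \<times> {..<m}" by auto
  also have "(\<Sum>p\<in>{..<m} \<times> {..<m}. (X $$ p)\<^sup>2) = (frobenius_norm X)\<^sup>2"
    by (simp add: frobenius_norm_square[OF Xc] sum.cartesian_product)
  finally show "(norm2_vec (weight_sym m *\<^sub>v vec_sym X))\<^sup>2 = (frobenius_norm X)\<^sup>2" .
qed (rule norm2_vec_nonneg frobenius_norm_nonneg)+

lemma append_cols_carrier:
  "P \<in> carrier_mat a b \<Longrightarrow> R \<in> carrier_mat a c \<Longrightarrow> P @\<^sub>c R \<in> carrier_mat a (b + c)"
  by (auto simp: append_cols_def)

lemma append_cols_mult_vec:
  fixes P R :: "real mat"
  assumes P: "P \<in> carrier_mat a b" and R: "R \<in> carrier_mat a c"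
    and u: "u \<in> carrier_vec b" and v: "v \<in> carrier_vec c"
  shows "(P @\<^sub>c R) *\<^sub>v (u @\<^sub>v v) = P *\<^sub>v u + R *\<^sub>v v"
proof (rule eq_vecI)
  fix i assume "i < dim_vec (P *\<^sub>v u + R *\<^sub>v v)"
  then have i: "i < a" using R by simp
  have "row (P @\<^sub>c R) i = row P i @\<^sub>v row R i"
    using P R i by (intro eq_vecI) (auto simp: append_cols_def mat_of_cols_def nth_append)
  then show "((P @\<^sub>c R) *\<^sub>v (u @\<^sub>v v)) $ i = (P *\<^sub>v u + R *\<^sub>v v) $ i"
    using append_cols_carrier[OF P R] P R u v i
    by (simp add: scalar_prod_append[of "row P i" b "row R i" c])
qed (use append_cols_carrier[OF P R] R in auto)

lemma spectral_norm_bdd_above: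
  "bdd_above ((\<lambda>v. norm2_vec (M *\<^sub>v v)) ` {v \<in> carrier_vec (dim_col M). norm2_vec v \<le> 1})"
proof -
  obtain s where s: "\<And>i j. i < dim_row M \<Longrightarrow> j < dim_col M \<Longrightarrow> \<bar>M $$ (i,j)\<bar> \<le> s"
    using mat_entries_bounded[of M] by blast
  have M: "M \<in> carrier_mat (dim_row M) (dim_col M)" by simp
  have "norm2_vec (M *\<^sub>v v) \<le> real (dim_row M) * (real (dim_col M) * s * 1)"
    if v: "v \<in> carrier_vec (dim_col M)" "norm2_vec v \<le> 1" for v
  proof -
    have v1: "\<bar>v $ j\<bar> \<le> 1" if "j < dim_col M" for j
      using abs_index_le_norm2_vec[of j v] that v by simp
    have "norm2_vec (M *\<^sub>v v) \<le> real (dim_vec (M *\<^sub>v v)) * (real (dim_col M) * s * 1)"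
      by (rule norm2_vec_le, rule abs_mult_mat_vec_le[OF M v(1) _ s v1]) auto
    then show ?thesis by simp
  qed
  then show ?thesis by (intro bdd_aboveI2) auto
qed

lemma norm2_vec_mult_le_spectral_norm:
  assumes M: "M \<in> carrier_mat a b" and v: "v \<in> carrier_vec b"
  shows "norm2_vec (M *\<^sub>v v) \<le> spectral_norm M * norm2_vec v"
proof (cases "norm2_vec v = 0")
  case True
  then have "(\<Sum>i<b. (v $ i)\<^sup>2) = 0" using norm2_vec_square[OF v] by simp
  then have "v = 0\<^sub>v b" using v by (intro eq_vecI) (auto simp: sum_nonneg_eq_0_iff)
  then show ?thesis using mult_mat_zero_vec[OF M] by (simp add: norm2_vec_def)
next
  case False
  define c where "c = norm2_vec v"
  have c: "0 < c" using False norm2_vec_nonneg[of v] by (simp add: c_def)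
  let ?u = "(1 / c) \<cdot>\<^sub>v v"
  have "norm2_vec (M *\<^sub>v ?u) \<le> spectral_norm M"
    unfolding spectral_norm_def
    by (rule cSUP_upper[OF _ spectral_norm_bdd_above]) (use M v c in \<open>auto simp: norm2_vec_smult c_def\<close>)
  moreover have "M *\<^sub>v ?u = (1 / c) \<cdot>\<^sub>v (M *\<^sub>v v)" by (rule mult_mat_vec[OF M v])
  ultimately show ?thesis using c by (simp add: norm2_vec_smult field_simps c_def)
qed

lemma less_spectral_normD:
  assumes M: "M \<in> carrier_mat a b" and t: "t < spectral_norm M"
  obtains v where "v \<in> carrier_vec b" "norm2_vec v \<le> 1" "t < norm2_vec (M *\<^sub>v v)"
proof -
  have "0\<^sub>v b \<in> {v \<in> carrier_vec (dim_col M). norm2_vec v \<le> 1}"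
    using M by (simp add: norm2_vec_def)
  then have "\<exists>v\<in>{v \<in> carrier_vec (dim_col M). norm2_vec v \<le> 1}. t < norm2_vec (M *\<^sub>v v)"
    using t unfolding spectral_norm_def by (subst (asm) less_cSUP_iff[OF _ spectral_norm_bdd_above]) auto
  then show thesis using that M by auto
qed

lemma norm_inf_vec_le_iff: "norm_inf_vec v \<le> c \<longleftrightarrow> 0 \<le> c \<and> (\<forall>i<dim_vec v. \<bar>v $ i\<bar> \<le> c)"
proof -
  have fin: "finite {\<bar>v $ i\<bar> | i. i < dim_vec v}" by (rule finite_image_set) simp
  show ?thesis unfolding norm_inf_vec_def using fin by (subst Max_le_iff) auto
qed

lemma norm_inf_vec_nonneg: "0 \<le> norm_inf_vec v"
  using norm_inf_vec_le_iff[of v "norm_inf_vec v"] by simp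

lemma abs_index_le_norm_inf_vec: "i < dim_vec v \<Longrightarrow> \<bar>v $ i\<bar> \<le> norm_inf_vec v"
  using norm_inf_vec_le_iff[of v "norm_inf_vec v"] by simp

section \<open>Structured perturbations\<close>

lemma saddle_data_in_structure_iff:
  assumes dA: "dA \<in> carrier_mat m m" and dB: "dB \<in> carrier_mat n m" and dD: "dD \<in> carrier_mat n n"
  shows "saddle_data dA dB dD \<in> sym_toep_structure m n \<longleftrightarrow> dA \<in> symmetric_mats m \<and> dB \<in> toeplitz_mats n m"
proof
  assume "saddle_data dA dB dD \<in> sym_toep_structure m n"
  then obtain A B D where eq: "saddle_data dA dB dD = saddle_data A B D"
    and s: "A \<in> symmetric_mats m" "B \<in> toeplitz_mats n m" "D \<in> carrier_mat n n"
    unfolding sym_toep_structure_def by blast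
  with saddle_data_eq_iff[OF dA dB dD symmetric_mats_carrier[OF s(1)] toeplitz_mats_carrier[OF s(2)] s(3)]
  show "dA \<in> symmetric_mats m \<and> dB \<in> toeplitz_mats n m" by simp
next
  assume "dA \<in> symmetric_mats m \<and> dB \<in> toeplitz_mats n m"
  with dD show "saddle_data dA dB dD \<in> sym_toep_structure m n"
    unfolding sym_toep_structure_def by blast
qed

lemma perturbation_structured_iff:
  "perturbation m n (sym_toep_structure m n) C dA dB dD df dg \<longleftrightarrow>
     dA \<in> symmetric_mats m \<and> dB \<in> toeplitz_mats n m \<and> dD \<in> carrier_mat n n
     \<and> df \<in> carrier_vec m \<and> dg \<in> carrier_vec n
     \<and> C (append_col (saddle_data dA dB dD) (df @\<^sub>v dg))"
  using saddle_data_in_structure_iff[of dA m dB n dD] symmetric_mats_carrier[of dA m]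
    toeplitz_mats_carrier[of dB n m]
  unfolding perturbation_def by blast

lemma sum_lessThan_add:
  fixes a b :: nat and h :: "nat \<Rightarrow> real"
  shows "(\<Sum>i<a + b. h i) = (\<Sum>i<a. h i) + (\<Sum>i<b. h (a + i))"
  by (induction b) (simp_all add: add.assoc)

lemma frobenius_norm_append_col_saddle_data:
  assumes A: "A \<in> carrier_mat m m" and B: "B \<in> carrier_mat n m" and D: "D \<in> carrier_mat n n"
    and f: "f \<in> carrier_vec m" and g: "g \<in> carrier_vec n"
  shows "(frobenius_norm (append_col (saddle_data A B D) (f @\<^sub>v g)))\<^sup>2
    = (frobenius_norm A)\<^sup>2 + (frobenius_norm B)\<^sup>2 + (frobenius_norm D)\<^sup>2 + (norm2_vec f)\<^sup>2 + (norm2_vec g)\<^sup>2"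
  unfolding append_col_saddle_data[OF assms] frobenius_norm_square[OF A] frobenius_norm_square[OF B]
    frobenius_norm_square[OF D] norm2_vec_square[OF f] norm2_vec_square[OF g]
  by (subst frobenius_norm_square[OF mat_carrier]) (simp add: sum_lessThan_add sum.distrib)

lemma componentwise_small_iff:
  assumes A: "A \<in> carrier_mat m m" and B: "B \<in> carrier_mat n m" and D: "D \<in> carrier_mat n n"
    and f: "f \<in> carrier_vec m" and g: "g \<in> carrier_vec n"
    and dA: "dA \<in> carrier_mat m m" and dB: "dB \<in> carrier_mat n m" and dD: "dD \<in> carrier_mat n n"
    and df: "df \<in> carrier_vec m" and dg: "dg \<in> carrier_vec n"
  shows "componentwise_small A B D f g \<eta> (append_col (saddle_data dA dB dD) (df @\<^sub>v dg)) \<longleftrightarrow>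
     (\<forall>i<m. \<forall>j<m. \<bar>dA $$ (i,j)\<bar> \<le> \<eta> * \<bar>A $$ (i,j)\<bar>) \<and>
     (\<forall>i<n. \<forall>j<m. \<bar>dB $$ (i,j)\<bar> \<le> \<eta> * \<bar>B $$ (i,j)\<bar>) \<and>
     (\<forall>i<n. \<forall>j<n. \<bar>dD $$ (i,j)\<bar> \<le> \<eta> * \<bar>D $$ (i,j)\<bar>) \<and>
     (\<forall>i<m. \<bar>df $ i\<bar> \<le> \<eta> * \<bar>f $ i\<bar>) \<and> (\<forall>i<n. \<bar>dg $ i\<bar> \<le> \<eta> * \<bar>g $ i\<bar>)"
    (is "_ \<longleftrightarrow> ?R")
proof -
  let ?e = "\<lambda>A B D f g i j. if j < m + n
        then if i < m then if j < m then A $$ (i,j) else 0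
             else if j < m then B $$ (i - m, j) else D $$ (i - m, j - m)
        else if i < m then f $ i else g $ (i - m)"
  have "componentwise_small A B D f g \<eta> (append_col (saddle_data dA dB dD) (df @\<^sub>v dg)) \<longleftrightarrow>
    (\<forall>i<m + n. \<forall>j<m + n + 1. \<bar>?e dA dB dD df dg i j\<bar> \<le> \<eta> * \<bar>?e A B D f g i j\<bar>)"
    unfolding componentwise_small_def entrywise_le_def append_col_saddle_data[OF A B D f g]
      append_col_saddle_data[OF dA dB dD df dg] by simp
  also have "\<dots> \<longleftrightarrow> ?R"
  proof
    assume *: "\<forall>i<m + n. \<forall>j<m + n + 1. \<bar>?e dA dB dD df dg i j\<bar> \<le> \<eta> * \<bar>?e A B D f g i j\<bar>"
    then have e: "\<bar>?e dA dB dD df dg i j\<bar> \<le> \<eta> * \<bar>?e A B D f g i j\<bar>" if "i < m + n" "j < m + n + 1" for i j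
      using that by blast
    have "\<bar>dA $$ (i,j)\<bar> \<le> \<eta> * \<bar>A $$ (i,j)\<bar>" if "i < m" "j < m" for i j
      using e[of i j] that by simp
    moreover have "\<bar>dB $$ (i,j)\<bar> \<le> \<eta> * \<bar>B $$ (i,j)\<bar>" if "i < n" "j < m" for i j
      using e[of "m + i" j] that by simp
    moreover have "\<bar>dD $$ (i,j)\<bar> \<le> \<eta> * \<bar>D $$ (i,j)\<bar>" if "i < n" "j < n" for i j
      using e[of "m + i" "m + j"] that by simp
    moreover have "\<bar>df $ i\<bar> \<le> \<eta> * \<bar>f $ i\<bar>" if "i < m" for i
      using e[of i "m + n"] that by simp
    moreover have "\<bar>dg $ i\<bar> \<le> \<eta> * \<bar>g $ i\<bar>" if "i < n" for i
      using e[of "m + i" "m + n"] that by simp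
    ultimately show ?R by blast
  qed auto
  finally show ?thesis .
qed

lemma abs_mult_mat_vec_weighted:
  fixes M :: "real mat"
  assumes M: "M \<in> carrier_mat a b" and u: "u \<in> carrier_vec b" and w: "w \<in> carrier_vec b" and i: "i < a"
    and le: "\<And>j. j < b \<Longrightarrow> \<bar>u $ j\<bar> \<le> \<eta> * w $ j"
  shows "\<bar>(M *\<^sub>v u) $ i\<bar> \<le> \<eta> * (abs_mat M *\<^sub>v w) $ i"
proof -
  have M': "abs_mat M \<in> carrier_mat a b" using M by simp
  have "\<bar>(M *\<^sub>v u) $ i\<bar> \<le> (\<Sum>j<b. \<bar>M $$ (i,j) * u $ j\<bar>)"
    unfolding index_mult_mat_vec_sum[OF M u i] by (rule sum_abs)
  also have "\<dots> \<le> (\<Sum>j<b. \<bar>M $$ (i,j)\<bar> * (\<eta> * w $ j))"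
    using le by (intro sum_mono) (auto simp: abs_mult intro: mult_left_mono)
  also have "\<dots> = \<eta> * (abs_mat M *\<^sub>v w) $ i"
    unfolding index_mult_mat_vec_sum[OF M' w i] sum_distrib_left
    using M i by (intro sum.cong) (auto simp: mult_ac)
  finally show ?thesis .
qed

text \<open>The bound \<open>abs_mult_mat_vec_weighted\<close> is attained in row \<open>i\<close> by a vector with the signs of that
  row.\<close>

lemma mult_mat_vec_signs:
  fixes M :: "real mat"
  assumes M: "M \<in> carrier_mat a b" and w: "w \<in> carrier_vec b" and i: "i < a"
  shows "(M *\<^sub>v vec b (\<lambda>j. \<eta> * sgn (M $$ (i,j)) * w $ j)) $ i = \<eta> * (abs_mat M *\<^sub>v w) $ i"
proof -
  have M': "abs_mat M \<in> carrier_mat a b" using M by simp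
  have "M $$ (i,j) * (\<eta> * sgn (M $$ (i,j)) * w $ j) = \<eta> * (\<bar>M $$ (i,j)\<bar> * w $ j)" for j
    by (simp add: abs_sgn mult_ac)
  then show ?thesis
    unfolding index_mult_mat_vec_sum[OF M vec_carrier i] index_mult_mat_vec_sum[OF M' w i] sum_distrib_left
    using M i by (intro sum.cong) auto
qed

lemma cancel_weight:
  fixes M Z Zi :: "real mat"
  assumes M: "M \<in> carrier_mat a b" and Z: "Z \<in> carrier_mat b b" "Zi \<in> carrier_mat b b" "Zi * Z = 1\<^sub>m b"
    and u: "u \<in> carrier_vec b"
  shows "(M * Zi) *\<^sub>v (Z *\<^sub>v u) = M *\<^sub>v u"
proof -
  have "(M * Zi) *\<^sub>v (Z *\<^sub>v u) = M *\<^sub>v (Zi *\<^sub>v (Z *\<^sub>v u))"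
    using M Z u by (intro assoc_mult_mat_vec) auto
  also have "Zi *\<^sub>v (Z *\<^sub>v u) = u"
    using assoc_mult_mat_vec[OF Z(2,1) u] Z u by simp
  finally show ?thesis .
qed

section \<open>Condition numbers for symmetric and Toeplitz structure\<close>

locale structured_saddle_point = generalized_saddle_point +
  assumes m_pos: "0 < m" and n_pos: "0 < n"
begin

text \<open>The matrices that act on the coordinates of \<open>dA\<close> and \<open>dB\<close> in the first-order change of \<open>y\<close>.\<close>

definition coeff_A :: "real mat" where
  "coeff_A = (row_mat x \<otimes>\<^sub>K K) * Phi_sym m"

definition coeff_B :: "real mat" where
  "coeff_B = (K \<otimes>\<^sub>K row_mat y + row_mat x \<otimes>\<^sub>K Sinv) * Phi_toep n m"

lemma kronecker_carriers:
  "row_mat x \<otimes>\<^sub>K K \<in> carrier_mat n (m * m)"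
  "K \<otimes>\<^sub>K row_mat y \<in> carrier_mat n (m * n)"
  "row_mat x \<otimes>\<^sub>K Sinv \<in> carrier_mat n (m * n)"
  "row_mat y \<otimes>\<^sub>K Sinv \<in> carrier_mat n (n * n)"
  using kronecker_carrier[OF row_mat_carrier[OF x] K_carrier]
    kronecker_carrier[OF K_carrier row_mat_carrier[OF y]]
    kronecker_carrier[OF row_mat_carrier[OF x] Sinv] kronecker_carrier[OF row_mat_carrier[OF y] Sinv]
  by simp_all

lemma Phi_carriers:
  "Phi_sym m \<in> carrier_mat (m * m) (length (sym_pairs m))"
  "Phi_toep n m \<in> carrier_mat (m * n) (length (toep_indices n m))"
  by (rule carrier_matI; simp add: Phi_sym_def Phi_toep_def)+

lemma coeff_carriers:
  "coeff_A \<in> carrier_mat n (length (sym_pairs m))"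
  "coeff_B \<in> carrier_mat n (length (toep_indices n m))"
  unfolding coeff_A_def coeff_B_def
  using kronecker_carriers Phi_carriers by (auto intro!: mult_carrier_mat add_carrier_mat)

lemma coeff_A_vec_sym:
  assumes dA: "dA \<in> symmetric_mats m"
  shows "coeff_A *\<^sub>v vec_sym dA = K *\<^sub>v (dA *\<^sub>v x)"
proof -
  note dAc = symmetric_mats_carrier[OF dA]
  show ?thesis
    unfolding coeff_A_def assoc_mult_mat_vec[OF kronecker_carriers(1) Phi_carriers(1) vec_sym_carrier[OF dAc]]
      Phi_sym_vec_sym[OF dA]
    by (rule kronecker_row_mat_stack_cols[OF K_carrier x dAc])
qed

lemma coeff_B_vec_toep:
  assumes dB: "dB \<in> toeplitz_mats n m"
  shows "coeff_B *\<^sub>v vec_toep dB = K *\<^sub>v (dB\<^sup>T *\<^sub>v y) + Sinv *\<^sub>v (dB *\<^sub>v x)"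
proof -
  note dBc = toeplitz_mats_carrier[OF dB]
  have KS: "K \<otimes>\<^sub>K row_mat y + row_mat x \<otimes>\<^sub>K Sinv \<in> carrier_mat n (m * n)"
    using kronecker_carriers by simp
  show ?thesis
    unfolding coeff_B_def assoc_mult_mat_vec[OF KS Phi_carriers(2) vec_toep_carrier[OF dBc]]
      Phi_toep_vec_toep[OF dB]
      add_mult_distrib_mat_vec[OF kronecker_carriers(2,3) stack_cols_carrier[OF dBc]]
      kronecker_stack_cols_row_mat[OF K_carrier y dBc] kronecker_row_mat_stack_cols[OF Sinv x dBc] ..
qed

lemma first_order_change_coordinates:
  assumes dA: "dA \<in> symmetric_mats m" and dB: "dB \<in> toeplitz_mats n m" and dD: "dD \<in> carrier_mat n n"
    and df: "df \<in> carrier_vec m" and dg: "dg \<in> carrier_vec n"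
  shows "first_order_change K Sinv x y dA dB dD df dg
    = - (coeff_A *\<^sub>v vec_sym dA + (coeff_B *\<^sub>v vec_toep dB
         + (Sinv *\<^sub>v (dD *\<^sub>v y) + (- K *\<^sub>v df + - Sinv *\<^sub>v dg))))"
proof -
  note Kc = K_carrier
  have c: "dA *\<^sub>v x \<in> carrier_vec m" "dB\<^sup>T *\<^sub>v y \<in> carrier_vec m" "dB *\<^sub>v x \<in> carrier_vec n" "dD *\<^sub>v y \<in> carrier_vec n"
    using symmetric_mats_carrier[OF dA] toeplitz_mats_carrier[OF dB] dD x y by auto
  have "first_order_change K Sinv x y dA dB dD df dg
    = (K *\<^sub>v df - (K *\<^sub>v (dA *\<^sub>v x) + K *\<^sub>v (dB\<^sup>T *\<^sub>v y)))
      + (Sinv *\<^sub>v dg - (Sinv *\<^sub>v (dB *\<^sub>v x) + Sinv *\<^sub>v (dD *\<^sub>v y)))"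
    unfolding first_order_change_def
    using mult_minus_distrib_mat_vec[OF Kc df add_carrier_vec[OF c(1,2)]] mult_add_distrib_mat_vec[OF Kc c(1,2)]
      mult_minus_distrib_mat_vec[OF Sinv dg add_carrier_vec[OF c(3,4)]] mult_add_distrib_mat_vec[OF Sinv c(3,4)]
    by simp
  then show ?thesis
    unfolding coeff_A_vec_sym[OF dA] coeff_B_vec_toep[OF dB]
    using Kc Sinv df dg by (intro eq_vecI) auto
qed

text \<open>The first-order change of \<open>y\<close>, up to sign, as one matrix acting on one vector: the weights in
  \<open>weighted_data\<close> turn the Euclidean norm into the Frobenius norm of the perturbation, and
  \<open>weighted_coeff\<close> divides them out again.\<close>

definition weighted_coeff :: "real mat" where
  "weighted_coeff = (coeff_A * mat_inv (weight_sym m)) @\<^sub>c (coeff_B * mat_inv (weight_toep n m))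
     @\<^sub>c (row_mat y \<otimes>\<^sub>K Sinv) @\<^sub>c (- K) @\<^sub>c (- Sinv)"

definition weighted_data ::
  "real mat \<Rightarrow> real mat \<Rightarrow> real mat \<Rightarrow> real vec \<Rightarrow> real vec \<Rightarrow> real vec" where
  "weighted_data dA dB dD df dg = (weight_sym m *\<^sub>v vec_sym dA) @\<^sub>v (weight_toep n m *\<^sub>v vec_toep dB)
     @\<^sub>v stack_cols dD @\<^sub>v df @\<^sub>v dg"

lemma toep_weight_carriers:
  "mat_inv (weight_toep n m) \<in> carrier_mat (length (toep_indices n m)) (length (toep_indices n m))"
  "weight_toep n m \<in> carrier_mat (length (toep_indices n m)) (length (toep_indices n m))"
  "mat_inv (weight_toep n m) * weight_toep n m = 1\<^sub>m (length (toep_indices n m))"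
  "weight_toep n m * mat_inv (weight_toep n m) = 1\<^sub>m (length (toep_indices n m))"
  using weight_toep_inverse[OF n_pos m_pos] length_toep_indices[OF n_pos m_pos]
  by (simp_all add: weight_toep_def)

lemma sym_weight_carrier:
  "weight_sym m \<in> carrier_mat (length (sym_pairs m)) (length (sym_pairs m))"
  by (simp add: weight_sym_def)

lemma weighted_coeff_carrier:
  "weighted_coeff \<in> carrier_mat n (length (sym_pairs m) + (length (toep_indices n m) + (n * n + (m + n))))"
  unfolding weighted_coeff_def
  by (intro append_cols_carrier mult_carrier_mat[OF coeff_carriers(1) weight_sym_inverse(1)]
      mult_carrier_mat[OF coeff_carriers(2) toep_weight_carriers(1)] kronecker_carriers(4)
      uminus_carrier_mat K_carrier Sinv)

lemma weighted_coeff_weighted_data: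
  assumes dA: "dA \<in> symmetric_mats m" and dB: "dB \<in> toeplitz_mats n m" and dD: "dD \<in> carrier_mat n n"
    and df: "df \<in> carrier_vec m" and dg: "dg \<in> carrier_vec n"
  shows "first_order_change K Sinv x y dA dB dD df dg = - (weighted_coeff *\<^sub>v weighted_data dA dB dD df dg)"
proof -
  note vA = vec_sym_carrier[OF symmetric_mats_carrier[OF dA]]
  note vB = vec_toep_carrier[OF toeplitz_mats_carrier[OF dB]]
  have wA: "weight_sym m *\<^sub>v vec_sym dA \<in> carrier_vec (length (sym_pairs m))"
    and wB: "weight_toep n m *\<^sub>v vec_toep dB \<in> carrier_vec (length (toep_indices n m))"
    using vA vB sym_weight_carrier toep_weight_carriers by auto
  have wc: "coeff_A * mat_inv (weight_sym m) \<in> carrier_mat n (length (sym_pairs m))"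
    "coeff_B * mat_inv (weight_toep n m) \<in> carrier_mat n (length (toep_indices n m))"
    "- K \<in> carrier_mat n m" "- Sinv \<in> carrier_mat n n"
    using coeff_carriers weight_sym_inverse(1) toep_weight_carriers(1) K_carrier Sinv
    by (auto intro!: mult_carrier_mat)
  note sD = stack_cols_carrier[OF dD]
  have t4: "(- K) @\<^sub>c (- Sinv) \<in> carrier_mat n (m + n)"
    by (rule append_cols_carrier[OF wc(3,4)])
  note t3 = append_cols_carrier[OF kronecker_carriers(4) t4]
  note t2 = append_cols_carrier[OF wc(2) t3]
  have u4: "df @\<^sub>v dg \<in> carrier_vec (m + n)" using df dg by simp
  have u3: "stack_cols dD @\<^sub>v df @\<^sub>v dg \<in> carrier_vec (n * n + (m + n))" using sD u4 by simp
  have u2: "(weight_toep n m *\<^sub>v vec_toep dB) @\<^sub>v stack_cols dD @\<^sub>v df @\<^sub>v dg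
    \<in> carrier_vec (length (toep_indices n m) + (n * n + (m + n)))" using wB u3 by simp
  show ?thesis
    unfolding weighted_coeff_def weighted_data_def
      append_cols_mult_vec[OF wc(1) t2 wA u2] append_cols_mult_vec[OF wc(2) t3 wB u3]
      append_cols_mult_vec[OF kronecker_carriers(4) t4 sD u4] append_cols_mult_vec[OF wc(3,4) df dg]
      cancel_weight[OF coeff_carriers(1) sym_weight_carrier weight_sym_inverse(1,2) vA]
      cancel_weight[OF coeff_carriers(2) toep_weight_carriers(2,1,3) vB]
      kronecker_row_mat_stack_cols[OF Sinv y dD]
    by (rule first_order_change_coordinates[OF assms])
qed

lemma weighted_data_carrier:
  assumes "dA \<in> symmetric_mats m" "dB \<in> toeplitz_mats n m" "dD \<in> carrier_mat n n"
    "df \<in> carrier_vec m" "dg \<in> carrier_vec n"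
  shows "weighted_data dA dB dD df dg
    \<in> carrier_vec (length (sym_pairs m) + (length (toep_indices n m) + (n * n + (m + n))))"
  unfolding weighted_data_def
  by (intro append_carrier_vec mult_mat_vec_carrier[OF sym_weight_carrier]
      mult_mat_vec_carrier[OF toep_weight_carriers(2)] vec_sym_carrier vec_toep_carrier
      stack_cols_carrier symmetric_mats_carrier toeplitz_mats_carrier assms)

lemma norm2_vec_weighted_data:
  assumes dA: "dA \<in> symmetric_mats m" and dB: "dB \<in> toeplitz_mats n m" and dD: "dD \<in> carrier_mat n n"
    and df: "df \<in> carrier_vec m" and dg: "dg \<in> carrier_vec n"
  shows "norm2_vec (weighted_data dA dB dD df dg)
    = frobenius_norm (append_col (saddle_data dA dB dD) (df @\<^sub>v dg))"
proof (rule power2_eq_imp_eq)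
  have "(norm2_vec (weighted_data dA dB dD df dg))\<^sup>2 = (norm2_vec (weight_sym m *\<^sub>v vec_sym dA))\<^sup>2
    + ((norm2_vec (weight_toep n m *\<^sub>v vec_toep dB))\<^sup>2 + ((norm2_vec (stack_cols dD))\<^sup>2
       + ((norm2_vec df)\<^sup>2 + (norm2_vec dg)\<^sup>2)))"
    unfolding weighted_data_def
    by (simp only: norm2_vec_append[OF carrier_vec_dim_vec carrier_vec_dim_vec])
  then show "(norm2_vec (weighted_data dA dB dD df dg))\<^sup>2
    = (frobenius_norm (append_col (saddle_data dA dB dD) (df @\<^sub>v dg)))\<^sup>2"
    by (simp add: frobenius_norm_append_col_saddle_data[OF symmetric_mats_carrier[OF dA]
          toeplitz_mats_carrier[OF dB] dD df dg] norm2_vec_weight_sym[OF dA]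
          frobenius_norm_toeplitz[OF dB n_pos m_pos, symmetric] norm2_vec_stack_cols)
qed (rule norm2_vec_nonneg frobenius_norm_nonneg)+

text \<open>Every vector consists of the weighted coordinates of an admissible perturbation, so no direction
  is lost when the perturbation problem is replaced by a spectral norm.\<close>

lemma weighted_data_surj:
  assumes u: "u \<in> carrier_vec (length (sym_pairs m) + (length (toep_indices n m) + (n * n + (m + n))))"
  obtains dA dB dD df dg where "dA \<in> symmetric_mats m" "dB \<in> toeplitz_mats n m" "dD \<in> carrier_mat n n"
    "df \<in> carrier_vec m" "dg \<in> carrier_vec n" "weighted_data dA dB dD df dg = u"
proof -
  have split: "\<exists>a b. a \<in> carrier_vec k \<and> b \<in> carrier_vec l \<and> v = a @\<^sub>v b"
    if "v \<in> carrier_vec (k + l)" for k l and v :: "real vec"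
    using vec_first_last_append[OF that] vec_first_carrier vec_last_carrier by metis
  obtain a u2 where a: "a \<in> carrier_vec (length (sym_pairs m))"
    and u2: "u2 \<in> carrier_vec (length (toep_indices n m) + (n * n + (m + n)))" and ua: "u = a @\<^sub>v u2"
    using split[OF u] by blast
  obtain b u3 where b: "b \<in> carrier_vec (length (toep_indices n m))"
    and u3: "u3 \<in> carrier_vec (n * n + (m + n))" and ub: "u2 = b @\<^sub>v u3"
    using split[OF u2] by blast
  obtain c u4 where c: "c \<in> carrier_vec (n * n)" and u4: "u4 \<in> carrier_vec (m + n)" and uc: "u3 = c @\<^sub>v u4"
    using split[OF u3] by blast
  obtain df dg where df: "df \<in> carrier_vec m" and dg: "dg \<in> carrier_vec n" and ud: "u4 = df @\<^sub>v dg"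
    using split[OF u4] by blast
  have "mat_inv (weight_sym m) *\<^sub>v a \<in> carrier_vec (length (sym_pairs m))"
    by (rule mult_mat_vec_carrier[OF weight_sym_inverse(1) a])
  then obtain dA where dA: "dA \<in> symmetric_mats m" "vec_sym dA = mat_inv (weight_sym m) *\<^sub>v a"
    by (rule vec_sym_surj)
  have "mat_inv (weight_toep n m) *\<^sub>v b \<in> carrier_vec (length (toep_indices n m))"
    using toep_weight_carriers(1) b by simp
  then obtain dB where dB: "dB \<in> toeplitz_mats n m" "vec_toep dB = mat_inv (weight_toep n m) *\<^sub>v b"
    by (rule vec_toep_surj[OF n_pos m_pos])
  obtain dD where dD: "dD \<in> carrier_mat n n" "stack_cols dD = c"
    using stack_cols_surj[OF c] .
  have "weight_sym m *\<^sub>v vec_sym dA = a"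
    unfolding dA(2) using assoc_mult_mat_vec[OF sym_weight_carrier weight_sym_inverse(1) a, symmetric]
    weight_sym_inverse(3)[of m] a by simp
  moreover have "weight_toep n m *\<^sub>v vec_toep dB = b"
    unfolding dB(2) using assoc_mult_mat_vec[OF toep_weight_carriers(2,1) b, symmetric]
    toep_weight_carriers(4) b by simp
  ultimately have "weighted_data dA dB dD df dg = u"
    by (simp add: weighted_data_def ua ub uc ud dD)
  with that dA(1) dB(1) dD(1) df dg show thesis by blast
qed

text \<open>The reference size \<open>\<rho>\<close> of the data only rescales the condition number.\<close>

theorem normwise_condition_number:
  assumes y0: "y \<noteq> 0\<^sub>v n" and \<rho>: "0 < \<rho>"
  shows "has_normwise_cond_rel \<rho> (sym_toep_structure m n) A B D f g x y
    (ereal (spectral_norm weighted_coeff / (norm2_vec y / \<rho>)))"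
proof -
  let ?\<sigma> = "spectral_norm weighted_coeff"
  have ny: "0 < norm2_vec y"
  proof (rule ccontr)
    assume "\<not> 0 < norm2_vec y"
    then have "y = 0\<^sub>v n"
      using abs_index_le_norm2_vec[of _ y] y norm2_vec_nonneg[of y] by (intro eq_vecI) fastforce+
    with y0 show False by simp
  qed
  have "((\<lambda>\<eta>. SUP dy\<in>solution_changes (sym_toep_structure m n) A B D f g x y
           (\<lambda>P. frobenius_norm P \<le> \<eta> * \<rho>). ereal (norm2_vec dy / norm2_vec y / \<eta>))
     \<longlongrightarrow> ereal (?\<sigma> / (norm2_vec y / \<rho>))) (at_right 0)"
  proof (rule condition_number_limit[OF \<rho>, where L = "real n / norm2_vec y"])
    show "0 \<le> real n / norm2_vec y" using ny by simp
    show "\<bar>P $$ (i,j)\<bar> \<le> \<rho> * \<eta>"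
      if "frobenius_norm P \<le> \<eta> * \<rho>" "P \<in> carrier_mat (m + n) (m + n + 1)" "i < m + n" "j < m + n + 1"
      for \<eta> P i j
      using abs_index_le_frobenius_norm[of i P j] that by (simp add: mult.commute)
    show "norm2_vec u / norm2_vec y \<le> norm2_vec v / norm2_vec y + real n / norm2_vec y * e"
      if "u \<in> carrier_vec n" "v \<in> carrier_vec n" "\<And>i. i < n \<Longrightarrow> \<bar>u $ i - v $ i\<bar> \<le> e" for u v e
      using norm2_vec_lipschitz[OF that] ny by (simp add: field_simps)
    show "norm2_vec (first_order_change K Sinv x y dA dB dD df dg) / norm2_vec y \<le> \<eta> * (?\<sigma> / (norm2_vec y / \<rho>))"
      if \<eta>: "0 < \<eta>"
        and p: "perturbation m n (sym_toep_structure m n) (\<lambda>P. frobenius_norm P \<le> \<eta> * \<rho>) dA dB dD df dg"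
      for \<eta> dA dB dD df dg
    proof -
      have s: "dA \<in> symmetric_mats m" "dB \<in> toeplitz_mats n m" "dD \<in> carrier_mat n n"
        "df \<in> carrier_vec m" "dg \<in> carrier_vec n"
        and F: "frobenius_norm (append_col (saddle_data dA dB dD) (df @\<^sub>v dg)) \<le> \<eta> * \<rho>"
        using p by (auto simp: perturbation_structured_iff)
      let ?u = "weighted_data dA dB dD df dg"
      have \<sigma>: "0 \<le> ?\<sigma>"
      proof -
        have "norm2_vec (weighted_coeff *\<^sub>v 0\<^sub>v (dim_col weighted_coeff)) \<le> ?\<sigma>"
          unfolding spectral_norm_def by (rule cSUP_upper[OF _ spectral_norm_bdd_above]) (simp add: norm2_vec_def)
        with norm2_vec_nonneg order_trans show ?thesis by blast
      qed
      have "?u \<in> carrier_vec (length (sym_pairs m) + (length (toep_indices n m) + (n * n + (m + n))))"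
        by (rule weighted_data_carrier[OF s])
      then have "norm2_vec (weighted_coeff *\<^sub>v ?u) \<le> ?\<sigma> * norm2_vec ?u"
        by (rule norm2_vec_mult_le_spectral_norm[OF weighted_coeff_carrier])
      also have "\<dots> \<le> ?\<sigma> * (\<eta> * \<rho>)"
        using F \<sigma> unfolding norm2_vec_weighted_data[OF s] by (rule mult_left_mono)
      finally show ?thesis
        using ny unfolding weighted_coeff_weighted_data[OF s] norm2_vec_uminus by (simp add: field_simps)
    qed
    show "\<exists>dA dB dD df dg. perturbation m n (sym_toep_structure m n) (\<lambda>P. frobenius_norm P \<le> \<eta> * \<rho>) dA dB dD df dg
       \<and> \<eta> * t \<le> norm2_vec (first_order_change K Sinv x y dA dB dD df dg) / norm2_vec y"
      if \<eta>: "0 < \<eta>" and t: "t < ?\<sigma> / (norm2_vec y / \<rho>)" for \<eta> t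
    proof -
      have "t * norm2_vec y / \<rho> < ?\<sigma>" using t ny \<rho> by (simp add: field_simps)
      then obtain v where v: "v \<in> carrier_vec (length (sym_pairs m) + (length (toep_indices n m) + (n * n + (m + n))))"
        "norm2_vec v \<le> 1" "t * norm2_vec y / \<rho> < norm2_vec (weighted_coeff *\<^sub>v v)"
        by (rule less_spectral_normD[OF weighted_coeff_carrier])
      let ?u = "(\<eta> * \<rho>) \<cdot>\<^sub>v v"
      have "?u \<in> carrier_vec (length (sym_pairs m) + (length (toep_indices n m) + (n * n + (m + n))))"
        using v by simp
      then obtain dA dB dD df dg where s: "dA \<in> symmetric_mats m" "dB \<in> toeplitz_mats n m" "dD \<in> carrier_mat n n"
        "df \<in> carrier_vec m" "dg \<in> carrier_vec n" and u: "weighted_data dA dB dD df dg = ?u"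
        by (rule weighted_data_surj)
      have "norm2_vec ?u \<le> \<eta> * \<rho>"
        using v(2) \<eta> \<rho> by (simp add: norm2_vec_smult abs_mult mult_left_le)
      then have p: "perturbation m n (sym_toep_structure m n) (\<lambda>P. frobenius_norm P \<le> \<eta> * \<rho>) dA dB dD df dg"
        using s by (simp add: perturbation_structured_iff norm2_vec_weighted_data[OF s, symmetric] u)
      have "norm2_vec (first_order_change K Sinv x y dA dB dD df dg) = \<eta> * \<rho> * norm2_vec (weighted_coeff *\<^sub>v v)"
        unfolding weighted_coeff_weighted_data[OF s] u norm2_vec_uminus mult_mat_vec[OF weighted_coeff_carrier v(1)]
        using \<eta> \<rho> by (simp add: norm2_vec_smult abs_mult)
      moreover have "\<eta> * t \<le> \<eta> * \<rho> * norm2_vec (weighted_coeff *\<^sub>v v) / norm2_vec y"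
        using v(3) \<eta> \<rho> ny by (simp add: field_simps)
      ultimately show ?thesis using p by metis
    qed
  qed
  then show ?thesis
    unfolding has_normwise_cond_rel_def by (simp add: mult.commute)
qed

text \<open>The largest first-order change of each entry of \<open>y\<close> under componentwise perturbations of relative
  size 1. The last summand vanishes for \<open>g = 0\<close>.\<close>

definition componentwise_bound :: "real vec" where
  "componentwise_bound = abs_mat coeff_A *\<^sub>v vec_sym (abs_mat A)
     + abs_mat coeff_B *\<^sub>v vec_toep (abs_mat B)
     + abs_mat Sinv *\<^sub>v (abs_mat D *\<^sub>v abs_vec y)
     + abs_mat K *\<^sub>v abs_vec f + abs_mat Sinv *\<^sub>v abs_vec g"

lemma componentwise_bound_index:
  assumes i: "i < n"
  shows "componentwise_bound $ i = (abs_mat coeff_A *\<^sub>v vec_sym (abs_mat A)) $ i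
     + (abs_mat coeff_B *\<^sub>v vec_toep (abs_mat B)) $ i
     + (abs_mat Sinv *\<^sub>v (abs_mat D *\<^sub>v abs_vec y)) $ i
     + (abs_mat K *\<^sub>v abs_vec f) $ i + (abs_mat Sinv *\<^sub>v abs_vec g) $ i"
  using coeff_carriers K_carrier Sinv i by (simp add: componentwise_bound_def del: index_mult_mat_vec)

lemma first_order_change_index:
  assumes "dA \<in> symmetric_mats m" "dB \<in> toeplitz_mats n m" "dD \<in> carrier_mat n n"
    "df \<in> carrier_vec m" "dg \<in> carrier_vec n" and i: "i < n"
  shows "first_order_change K Sinv x y dA dB dD df dg $ i
    = - ((coeff_A *\<^sub>v vec_sym dA) $ i + (coeff_B *\<^sub>v vec_toep dB) $ i + (Sinv *\<^sub>v (dD *\<^sub>v y)) $ i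
         - (K *\<^sub>v df) $ i - (Sinv *\<^sub>v dg) $ i)"
proof -
  have "- K *\<^sub>v df = - (K *\<^sub>v df)" "- Sinv *\<^sub>v dg = - (Sinv *\<^sub>v dg)"
    using assms K_carrier Sinv by auto
  then show ?thesis
    unfolding first_order_change_coordinates[OF assms(1-5)]
    using coeff_carriers K_carrier Sinv i by (simp del: index_mult_mat_vec uminus_mult_mat_vec)
qed

lemma first_order_change_le:
  assumes As: "A \<in> symmetric_mats m" and Bt: "B \<in> toeplitz_mats n m"
    and p: "perturbation m n (sym_toep_structure m n) (componentwise_small A B D f g \<eta>) dA dB dD df dg"
    and i: "i < n"
  shows "\<bar>first_order_change K Sinv x y dA dB dD df dg $ i\<bar> \<le> \<eta> * componentwise_bound $ i"
proof -
  have s: "dA \<in> symmetric_mats m" "dB \<in> toeplitz_mats n m" "dD \<in> carrier_mat n n"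
    "df \<in> carrier_vec m" "dg \<in> carrier_vec n"
    and cs: "componentwise_small A B D f g \<eta> (append_col (saddle_data dA dB dD) (df @\<^sub>v dg))"
    using p by (auto simp: perturbation_structured_iff)
  note dAc = symmetric_mats_carrier[OF s(1)] and dBc = toeplitz_mats_carrier[OF s(2)]
  note c = componentwise_small_iff[THEN iffD1, OF A B D f g dAc dBc s(3,4,5) cs]
  have Aa: "abs_mat A \<in> carrier_mat m m" and Ba: "abs_mat B \<in> carrier_mat n m" using A B by auto
  have tA: "\<bar>(coeff_A *\<^sub>v vec_sym dA) $ i\<bar> \<le> \<eta> * (abs_mat coeff_A *\<^sub>v vec_sym (abs_mat A)) $ i"
    using vec_sym_bound_iff[OF s(1) As] c
    by (intro abs_mult_mat_vec_weighted[OF coeff_carriers(1) vec_sym_carrier[OF dAc] vec_sym_carrier[OF Aa] i]) blast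
  have tB: "\<bar>(coeff_B *\<^sub>v vec_toep dB) $ i\<bar> \<le> \<eta> * (abs_mat coeff_B *\<^sub>v vec_toep (abs_mat B)) $ i"
    using vec_toep_bound_iff[OF n_pos m_pos s(2) Bt] c
    by (intro abs_mult_mat_vec_weighted[OF coeff_carriers(2) vec_toep_carrier[OF dBc] vec_toep_carrier[OF Ba] i]) blast
  have "\<bar>(dD *\<^sub>v y) $ j\<bar> \<le> \<eta> * (abs_mat D *\<^sub>v abs_vec y) $ j" if j: "j < n" for j
  proof -
    have "\<bar>(dD *\<^sub>v y) $ j\<bar> \<le> (\<Sum>l<n. \<bar>dD $$ (j,l) * y $ l\<bar>)"
      unfolding index_mult_mat_vec_sum[OF s(3) y j] by (rule sum_abs)
    also have "\<dots> \<le> (\<Sum>l<n. (\<eta> * \<bar>D $$ (j,l)\<bar>) * \<bar>y $ l\<bar>)"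
      using c j by (intro sum_mono) (auto simp: abs_mult intro!: mult_right_mono)
    also have "\<dots> = \<eta> * (abs_mat D *\<^sub>v abs_vec y) $ j"
      using D y j by (simp add: index_mult_mat_vec_sum[of _ n n] sum_distrib_left mult.assoc del: index_mult_mat_vec)
    finally show ?thesis .
  qed
  then have tD: "\<bar>(Sinv *\<^sub>v (dD *\<^sub>v y)) $ i\<bar> \<le> \<eta> * (abs_mat Sinv *\<^sub>v (abs_mat D *\<^sub>v abs_vec y)) $ i"
    using s y D by (intro abs_mult_mat_vec_weighted[OF Sinv _ _ i]) auto
  have tf: "\<bar>(K *\<^sub>v df) $ i\<bar> \<le> \<eta> * (abs_mat K *\<^sub>v abs_vec f) $ i"
    using s f c by (intro abs_mult_mat_vec_weighted[OF K_carrier _ _ i]) auto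
  have tg: "\<bar>(Sinv *\<^sub>v dg) $ i\<bar> \<le> \<eta> * (abs_mat Sinv *\<^sub>v abs_vec g) $ i"
    using s g c by (intro abs_mult_mat_vec_weighted[OF Sinv _ _ i]) auto
  show ?thesis
    unfolding first_order_change_index[OF s i] componentwise_bound_index[OF i] distrib_left
    using tA tB tD tf tg by linarith
qed

lemma first_order_change_attained:
  assumes As: "A \<in> symmetric_mats m" and Bt: "B \<in> toeplitz_mats n m" and \<eta>: "0 \<le> \<eta>" and i: "i < n"
  obtains dA dB dD df dg where
    "perturbation m n (sym_toep_structure m n) (componentwise_small A B D f g \<eta>) dA dB dD df dg"
    "first_order_change K Sinv x y dA dB dD df dg $ i = - (\<eta> * componentwise_bound $ i)"
proof -
  have Aa: "abs_mat A \<in> carrier_mat m m" and Ba: "abs_mat B \<in> carrier_mat n m" using A B by auto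
  let ?wA = "vec_sym (abs_mat A)" and ?wB = "vec_toep (abs_mat B)"
  have sgn_le: "\<bar>\<eta> * sgn a * w\<bar> \<le> \<eta> * w" if "0 \<le> w" for a w :: real
    using \<eta> that by (cases a "0::real" rule: linorder_cases) (auto simp: abs_mult)
  have wA0: "0 \<le> ?wA $ k" if "k < length (sym_pairs m)" for k
  proof -
    have "sym_pairs m ! k \<in> set (sym_pairs m)" using that by simp
    then show ?thesis using vec_sym_index[OF Aa that] A by (auto simp: set_sym_pairs)
  qed
  have wB0: "0 \<le> ?wB $ k" if k: "k < length (toep_indices n m)" for k
  proof -
    have "toep_indices n m ! k \<in> set (toep_indices n m)" using k by simp
    from toep_indices_bounds[OF n_pos m_pos this] show ?thesis
      using vec_toep_index[OF Ba k] B by simp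
  qed
  obtain dA where dA: "dA \<in> symmetric_mats m"
    "vec_sym dA = vec (length (sym_pairs m)) (\<lambda>j. \<eta> * sgn (coeff_A $$ (i,j)) * ?wA $ j)"
    by (rule vec_sym_surj[OF vec_carrier])
  obtain dB where dB: "dB \<in> toeplitz_mats n m"
    "vec_toep dB = vec (length (toep_indices n m)) (\<lambda>j. \<eta> * sgn (coeff_B $$ (i,j)) * ?wB $ j)"
    by (rule vec_toep_surj[OF n_pos m_pos vec_carrier])
  \<comment> \<open>The sign of entry \<open>(j,l)\<close> combines those of \<open>Sinv\<close> and \<open>y\<close>, as \<open>dD\<close> acts through \<open>Sinv (dD y)\<close>.\<close>
  define dD where "dD = mat n n (\<lambda>(j,l). \<eta> * sgn (Sinv $$ (i,j)) * (\<bar>D $$ (j,l)\<bar> * sgn (y $ l)))"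
  \<comment> \<open>The vectors \<open>df\<close> and \<open>dg\<close> enter the first-order change with the sign opposite to the matrices.\<close>
  define df where "df = - vec m (\<lambda>j. \<eta> * sgn (K $$ (i,j)) * abs_vec f $ j)"
  define dg where "dg = - vec n (\<lambda>j. \<eta> * sgn (Sinv $$ (i,j)) * abs_vec g $ j)"
  have dD: "dD \<in> carrier_mat n n" and df: "df \<in> carrier_vec m" and dg: "dg \<in> carrier_vec n"
    by (simp_all add: dD_def df_def dg_def)
  note dAc = symmetric_mats_carrier[OF dA(1)] and dBc = toeplitz_mats_carrier[OF dB(1)]
  have "\<forall>i<m. \<forall>j<m. \<bar>dA $$ (i,j)\<bar> \<le> \<eta> * \<bar>A $$ (i,j)\<bar>"
    unfolding vec_sym_bound_iff[OF dA(1) As, symmetric] using sgn_le[OF wA0] by (simp add: dA(2))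
  moreover have "\<forall>i<n. \<forall>j<m. \<bar>dB $$ (i,j)\<bar> \<le> \<eta> * \<bar>B $$ (i,j)\<bar>"
    unfolding vec_toep_bound_iff[OF n_pos m_pos dB(1) Bt, symmetric] using sgn_le[OF wB0] by (simp add: dB(2))
  moreover have "\<forall>i<n. \<forall>j<n. \<bar>dD $$ (i,j)\<bar> \<le> \<eta> * \<bar>D $$ (i,j)\<bar>"
  proof (intro allI impI)
    fix j l assume jl: "j < n" "l < n"
    have "\<bar>dD $$ (j,l)\<bar> = \<eta> * \<bar>D $$ (j,l)\<bar> * (\<bar>sgn (Sinv $$ (i,j))\<bar> * \<bar>sgn (y $ l)\<bar>)"
      using jl \<eta> by (simp add: dD_def abs_mult mult_ac)
    also have "\<dots> \<le> \<eta> * \<bar>D $$ (j,l)\<bar> * 1"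
      using \<eta> by (intro mult_left_mono) (auto simp: sgn_if)
    finally show "\<bar>dD $$ (j,l)\<bar> \<le> \<eta> * \<bar>D $$ (j,l)\<bar>" by simp
  qed
  moreover have "\<forall>i<m. \<bar>df $ i\<bar> \<le> \<eta> * \<bar>f $ i\<bar>"
    using sgn_le f by (simp add: df_def)
  moreover have "\<forall>i<n. \<bar>dg $ i\<bar> \<le> \<eta> * \<bar>g $ i\<bar>"
    using sgn_le g by (simp add: dg_def)
  ultimately have p: "perturbation m n (sym_toep_structure m n) (componentwise_small A B D f g \<eta>) dA dB dD df dg"
    unfolding perturbation_structured_iff componentwise_small_iff[OF A B D f g dAc dBc dD df dg]
    using dA(1) dB(1) dD df dg by blast
  have tA: "(coeff_A *\<^sub>v vec_sym dA) $ i = \<eta> * (abs_mat coeff_A *\<^sub>v ?wA) $ i"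
    unfolding dA(2) by (rule mult_mat_vec_signs[OF coeff_carriers(1) vec_sym_carrier[OF Aa] i])
  have tB: "(coeff_B *\<^sub>v vec_toep dB) $ i = \<eta> * (abs_mat coeff_B *\<^sub>v ?wB) $ i"
    unfolding dB(2) by (rule mult_mat_vec_signs[OF coeff_carriers(2) vec_toep_carrier[OF Ba] i])
  let ?s = "abs_mat D *\<^sub>v abs_vec y"
  have sc: "?s \<in> carrier_vec n" using D y by simp
  have "dD *\<^sub>v y = vec n (\<lambda>j. \<eta> * sgn (Sinv $$ (i,j)) * ?s $ j)"
  proof (rule eq_vecI)
    fix j assume "j < dim_vec (vec n (\<lambda>j. \<eta> * sgn (Sinv $$ (i,j)) * ?s $ j))"
    then have j: "j < n" by simp
    have "(dD *\<^sub>v y) $ j = (\<Sum>l<n. \<eta> * sgn (Sinv $$ (i,j)) * (\<bar>D $$ (j,l)\<bar> * \<bar>y $ l\<bar>))"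
      unfolding index_mult_mat_vec_sum[OF dD y j]
      using j by (intro sum.cong) (auto simp: dD_def abs_sgn mult_ac)
    also have "\<dots> = \<eta> * sgn (Sinv $$ (i,j)) * ?s $ j"
      using D y j by (simp add: index_mult_mat_vec_sum[of _ n n] sum_distrib_left del: index_mult_mat_vec)
    finally show "(dD *\<^sub>v y) $ j = vec n (\<lambda>j. \<eta> * sgn (Sinv $$ (i,j)) * ?s $ j) $ j"
      using j by simp
  qed (use dD in simp)
  then have tD: "(Sinv *\<^sub>v (dD *\<^sub>v y)) $ i = \<eta> * (abs_mat Sinv *\<^sub>v ?s) $ i"
    using mult_mat_vec_signs[OF Sinv sc i] by simp
  have neg: "(M *\<^sub>v (- v)) $ i = - ((M *\<^sub>v v) $ i)"
    if "M \<in> carrier_mat n k" "v \<in> carrier_vec k" for M :: "real mat" and v k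
    using that i by simp
  have tf: "(K *\<^sub>v df) $ i = - (\<eta> * (abs_mat K *\<^sub>v abs_vec f) $ i)"
    unfolding df_def neg[OF K_carrier vec_carrier]
    using mult_mat_vec_signs[OF K_carrier _ i, of "abs_vec f"] f by simp
  have tg: "(Sinv *\<^sub>v dg) $ i = - (\<eta> * (abs_mat Sinv *\<^sub>v abs_vec g) $ i)"
    unfolding dg_def neg[OF Sinv vec_carrier]
    using mult_mat_vec_signs[OF Sinv _ i, of "abs_vec g"] g by simp
  have "first_order_change K Sinv x y dA dB dD df dg $ i = - (\<eta> * componentwise_bound $ i)"
    unfolding first_order_change_index[OF dA(1) dB(1) dD df dg i] componentwise_bound_index[OF i] distrib_left
      tA tB tD tf tg by simp
  with that p show thesis by blast
qed

text \<open>The weights \<open>w\<close> serve both remaining cases: \<open>w i = 1 / \<parallel>y\<parallel>\<close> with the infinity norm gives the mixed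
  condition number and \<open>w i = 1 / y\<^sub>i\<close> the componentwise one.\<close>

theorem componentwise_limit:
  assumes As: "A \<in> symmetric_mats m" and Bt: "B \<in> toeplitz_mats n m"
  shows "((\<lambda>\<eta>. SUP dy\<in>solution_changes (sym_toep_structure m n) A B D f g x y (componentwise_small A B D f g \<eta>).
           ereal (norm_inf_vec (vec n (\<lambda>i. w i * dy $ i)) / \<eta>))
     \<longlongrightarrow> ereal (norm_inf_vec (vec n (\<lambda>i. w i * componentwise_bound $ i)))) (at_right 0)"
proof -
  let ?P = "append_col (saddle_data A B D) (f @\<^sub>v g)"
  have P: "?P \<in> carrier_mat (m + n) (m + n + 1)"
    by (simp add: append_col_saddle_data[OF A B D f g])
  obtain R where R: "0 \<le> R" "\<And>i j. i < m + n \<Longrightarrow> j < m + n + 1 \<Longrightarrow> \<bar>?P $$ (i,j)\<bar> \<le> R"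
    using mat_entries_bounded[of ?P] P by auto
  obtain L where L: "0 \<le> L" "\<And>i. i < n \<Longrightarrow> \<bar>w i\<bar> \<le> L"
    using vec_entries_bounded[of "vec n w"] by auto
  let ?N = "componentwise_bound" and ?\<nu> = "\<lambda>u. norm_inf_vec (vec n (\<lambda>i. w i * u $ i))"
  have index_le: "\<bar>w i * u $ i\<bar> \<le> ?\<nu> u" if "i < n" for i u
    using abs_index_le_norm_inf_vec[of i "vec n (\<lambda>i. w i * u $ i)"] that by simp
  show ?thesis
  proof (rule condition_number_limit[where R = "R + 1" and L = L])
    show "0 < R + 1" using R by simp
    show "0 \<le> L" by (rule L)
    show "\<bar>Q $$ (i,j)\<bar> \<le> (R + 1) * \<eta>"
      if \<eta>: "0 < \<eta>" and Q: "Q \<in> carrier_mat (m + n) (m + n + 1)" "componentwise_small A B D f g \<eta> Q"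
        and ij: "i < m + n" "j < m + n + 1" for \<eta> Q i j
    proof -
      have "\<bar>Q $$ (i,j)\<bar> \<le> \<eta> * \<bar>?P $$ (i,j)\<bar>"
        using Q P ij unfolding componentwise_small_def entrywise_le_def by auto
      also have "\<dots> \<le> \<eta> * (R + 1)"
        using R(2)[OF ij] \<eta> by (intro mult_left_mono) auto
      finally show ?thesis by (simp add: mult.commute)
    qed
    show "?\<nu> u \<le> ?\<nu> v + L * e"
      if "u \<in> carrier_vec n" "v \<in> carrier_vec n" and e: "0 \<le> e" "\<And>i. i < n \<Longrightarrow> \<bar>u $ i - v $ i\<bar> \<le> e" for u v e
    proof -
      have "\<bar>w i * u $ i\<bar> \<le> ?\<nu> v + L * e" if i: "i < n" for i
      proof -
        have "\<bar>w i * u $ i\<bar> \<le> \<bar>w i * v $ i\<bar> + \<bar>w i\<bar> * \<bar>u $ i - v $ i\<bar>"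
          unfolding abs_mult[symmetric] by (simp add: right_diff_distrib)
        moreover have "\<bar>w i\<bar> * \<bar>u $ i - v $ i\<bar> \<le> L * e"
          using L i e by (intro mult_mono) auto
        ultimately show ?thesis using index_le[OF i, of v] by linarith
      qed
      moreover have "0 \<le> ?\<nu> v + L * e" using L e norm_inf_vec_nonneg by simp
      ultimately show ?thesis by (simp add: norm_inf_vec_le_iff)
    qed
    show "?\<nu> (first_order_change K Sinv x y dA dB dD df dg) \<le> \<eta> * ?\<nu> ?N"
      if \<eta>: "0 < \<eta>" and p: "perturbation m n (sym_toep_structure m n) (componentwise_small A B D f g \<eta>) dA dB dD df dg"
      for \<eta> dA dB dD df dg
    proof -
      have "\<bar>w i * first_order_change K Sinv x y dA dB dD df dg $ i\<bar> \<le> \<eta> * ?\<nu> ?N" if i: "i < n" for i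
      proof -
        have "\<bar>w i * first_order_change K Sinv x y dA dB dD df dg $ i\<bar> \<le> \<bar>w i\<bar> * (\<eta> * ?N $ i)"
          using first_order_change_le[OF As Bt p i] by (auto simp: abs_mult intro!: mult_left_mono)
        also have "\<dots> \<le> \<eta> * \<bar>w i * ?N $ i\<bar>"
          using \<eta> by (simp add: abs_mult mult_left_mono mult.left_commute)
        also have "\<dots> \<le> \<eta> * ?\<nu> ?N" using index_le[OF i] \<eta> by (intro mult_left_mono) auto
        finally show ?thesis .
      qed
      moreover have "0 \<le> \<eta> * ?\<nu> ?N" using \<eta> norm_inf_vec_nonneg by simp
      ultimately show ?thesis by (simp add: norm_inf_vec_le_iff)
    qed
    show "\<exists>dA dB dD df dg. perturbation m n (sym_toep_structure m n) (componentwise_small A B D f g \<eta>) dA dB dD df dg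
       \<and> \<eta> * t \<le> ?\<nu> (first_order_change K Sinv x y dA dB dD df dg)"
      if \<eta>: "0 < \<eta>" and t: "t < ?\<nu> ?N" for \<eta> t
    proof -
      \<comment> \<open>\<open>norm_inf_vec\<close> includes 0 in its maximum. For \<open>t < 0\<close> any index works, and \<open>n > 0\<close> provides one.\<close>
      have "\<exists>i<n. t \<le> \<bar>w i * ?N $ i\<bar>"
      proof (cases "t < 0")
        case True then show ?thesis using n_pos by (intro exI[of _ 0]) auto
      next
        case False
        with t norm_inf_vec_le_iff[of "vec n (\<lambda>i. w i * ?N $ i)" t] show ?thesis by auto
      qed
      then obtain i where i: "i < n" "t \<le> \<bar>w i * ?N $ i\<bar>" by blast
      obtain dA dB dD df dg where
        p: "perturbation m n (sym_toep_structure m n) (componentwise_small A B D f g \<eta>) dA dB dD df dg"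
        and eq: "first_order_change K Sinv x y dA dB dD df dg $ i = - (\<eta> * ?N $ i)"
        using first_order_change_attained[OF As Bt less_imp_le[OF \<eta>] i(1)] .
      have "\<eta> * t \<le> \<eta> * \<bar>w i * ?N $ i\<bar>" using i \<eta> by simp
      also have "\<dots> = \<bar>w i * first_order_change K Sinv x y dA dB dD df dg $ i\<bar>"
        using \<eta> by (simp add: eq abs_mult)
      also have "\<dots> \<le> ?\<nu> (first_order_change K Sinv x y dA dB dD df dg)" by (rule index_le[OF i(1)])
      finally show ?thesis using p by metis
    qed
  qed
qed

end

lemma pseudo_inverse_mat_inv:
  fixes A N :: "real mat"
  assumes A: "A \<in> carrier_mat k k" and N: "N \<in> carrier_mat k k" and NA: "N * A = 1\<^sub>m k" and AN: "A * N = 1\<^sub>m k"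
  shows "pseudo_inverse A = N"
  unfolding pseudo_inverse_def
proof (rule the_equality)
  show "N \<in> carrier_mat (dim_col A) (dim_row A) \<and> A * N * A = A \<and> N * A * N = N \<and> (A * N)\<^sup>T = A * N \<and> (N * A)\<^sup>T = N * A"
    using A N NA AN by simp
next
  fix X
  assume "X \<in> carrier_mat (dim_col A) (dim_row A) \<and> A * X * A = A \<and> X * A * X = X \<and> (A * X)\<^sup>T = A * X \<and> (X * A)\<^sup>T = X * A"
  then have X: "X \<in> carrier_mat k k" and AXA: "A * X * A = A" using A by auto
  have XA: "X * A \<in> carrier_mat k k" using X A by simp
  have "X * A = N * A * (X * A)" unfolding NA using left_mult_one_mat[OF XA] by simp
  also have "\<dots> = N * (A * X * A)"
    using assoc_mult_mat[OF N A XA] assoc_mult_mat[OF A X A] by simp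
  also have "\<dots> = 1\<^sub>m k" unfolding AXA by (rule NA)
  finally have "X * A = 1\<^sub>m k" .
  then have "N = X * A * N" using N by simp
  also have "\<dots> = X" using A N X AN by simp
  finally show "X = N" by simp
qed

lemma norm_inf_vec_scale:
  assumes v: "v \<in> carrier_vec k" and c: "0 \<le> c"
  shows "norm_inf_vec (vec k (\<lambda>i. c * v $ i)) = c * norm_inf_vec v"
proof (cases "c = 0")
  case True
  have "norm_inf_vec (vec k (\<lambda>i. c * v $ i)) \<le> 0" unfolding norm_inf_vec_le_iff using True by simp
  then show ?thesis using norm_inf_vec_nonneg[of "vec k (\<lambda>i. c * v $ i)"] True by simp
next
  case False
  with c have c: "0 < c" by simp
  have "norm_inf_vec (vec k (\<lambda>i. c * v $ i)) \<le> c * norm_inf_vec v"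
    unfolding norm_inf_vec_le_iff
    using v c norm_inf_vec_nonneg abs_index_le_norm_inf_vec[of _ v] by (auto simp: abs_mult)
  moreover have "norm_inf_vec v \<le> norm_inf_vec (vec k (\<lambda>i. c * v $ i)) / c"
  proof -
    have "\<bar>v $ i\<bar> \<le> norm_inf_vec (vec k (\<lambda>i. c * v $ i)) / c" if "i < k" for i
      using abs_index_le_norm_inf_vec[of i "vec k (\<lambda>i. c * v $ i)"] that c by (simp add: abs_mult field_simps)
    then show ?thesis unfolding norm_inf_vec_le_iff using v c norm_inf_vec_nonneg by simp
  qed
  ultimately show ?thesis using c by (simp add: field_simps)
qed

lemma quotient_norm_inf_nonzero:
  assumes v: "v \<in> carrier_vec k" and v0: "\<And>i. i < k \<Longrightarrow> v $ i \<noteq> 0"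
  shows "quotient_norm_inf u v = ereal (norm_inf_vec (vec k (\<lambda>i. 1 / v $ i * u $ i)))"
proof -
  let ?S = "insert 0 {\<bar>vec k (\<lambda>i. 1 / v $ i * u $ i) $ i\<bar> | i. i < k}"
  have "\<bar>entry_quotient (u $ i) (v $ i)\<bar> = ereal \<bar>vec k (\<lambda>i. 1 / v $ i * u $ i) $ i\<bar>" if "i < k" for i
    using v0 that by (simp add: entry_quotient_def)
  then have "{\<bar>entry_quotient (u $ i) (v $ i)\<bar> | i. i < k} = ereal ` {\<bar>vec k (\<lambda>i. 1 / v $ i * u $ i) $ i\<bar> | i. i < k}"
    unfolding setcompr_eq_image image_image by (intro image_cong) auto
  then have "insert 0 {\<bar>entry_quotient (u $ i) (v $ i)\<bar> | i. i < dim_vec v} = ereal ` ?S"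
    using v by (simp add: zero_ereal_def)
  moreover have "ereal (Max ?S) = Max (ereal ` ?S)"
    by (rule mono_Max_commute) (auto simp: mono_def)
  ultimately show ?thesis
    by (simp add: quotient_norm_inf_def norm_inf_vec_def)
qed

context structured_saddle_point
begin

lemma solution_changes_carrier: "dy \<in> solution_changes E A B D f g x y C \<Longrightarrow> dy \<in> carrier_vec n"
  using D by (simp add: solution_changes_def Let_def)

theorem mixed_condition_number:
  assumes As: "A \<in> symmetric_mats m" and Bt: "B \<in> toeplitz_mats n m"
  shows "has_mixed_cond (sym_toep_structure m n) A B D f g x y
    (ereal (norm_inf_vec componentwise_bound / norm_inf_vec y))"
proof -
  let ?c = "1 / norm_inf_vec y"
  have c: "0 \<le> ?c" using norm_inf_vec_nonneg by simp
  have N: "componentwise_bound \<in> carrier_vec n"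
    using Sinv by (simp add: componentwise_bound_def carrier_dim_vec)
  have "(SUP dy\<in>solution_changes (sym_toep_structure m n) A B D f g x y (componentwise_small A B D f g \<eta>).
           ereal (norm_inf_vec (vec n (\<lambda>i. ?c * dy $ i)) / \<eta>))
    = (SUP dy\<in>solution_changes (sym_toep_structure m n) A B D f g x y (componentwise_small A B D f g \<eta>).
           ereal (norm_inf_vec dy / (\<eta> * norm_inf_vec y)))" for \<eta>
    by (intro SUP_cong refl) (simp only: norm_inf_vec_scale[OF solution_changes_carrier c], simp add: mult.commute)
  then show ?thesis
    using componentwise_limit[OF As Bt, of "\<lambda>_. ?c"] unfolding has_mixed_cond_def norm_inf_vec_scale[OF N c] by simp
qed

theorem componentwise_condition_number:
  assumes As: "A \<in> symmetric_mats m" and Bt: "B \<in> toeplitz_mats n m" and y0: "\<And>i. i < n \<Longrightarrow> y $ i \<noteq> 0"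
  shows "has_componentwise_cond (sym_toep_structure m n) A B D f g x y
    (ereal (norm_inf_vec (pseudo_inverse (mat_diag n (\<lambda>i. y $ i)) *\<^sub>v componentwise_bound)))"
proof -
  have N: "componentwise_bound \<in> carrier_vec n"
    using Sinv by (simp add: componentwise_bound_def carrier_dim_vec)
  have one: "mat_diag n (\<lambda>i. 1 / y $ i * y $ i) = 1\<^sub>m n" "mat_diag n (\<lambda>i. y $ i * (1 / y $ i)) = 1\<^sub>m n"
    using y0 by (auto simp: mat_diag_def intro!: eq_matI)
  have "pseudo_inverse (mat_diag n (\<lambda>i. y $ i)) = mat_diag n (\<lambda>i. 1 / y $ i)"
    by (rule pseudo_inverse_mat_inv) (simp_all only: mat_diag_dim mat_diag_diag one)
  then have N': "pseudo_inverse (mat_diag n (\<lambda>i. y $ i)) *\<^sub>v componentwise_bound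
      = vec n (\<lambda>i. 1 / y $ i * componentwise_bound $ i)"
    by (simp only: mat_diag_mult_vec[OF N])
  have "(SUP dy\<in>solution_changes (sym_toep_structure m n) A B D f g x y (componentwise_small A B D f g \<eta>).
           ereal (norm_inf_vec (vec n (\<lambda>i. 1 / y $ i * dy $ i)) / \<eta>))
    = (SUP dy\<in>solution_changes (sym_toep_structure m n) A B D f g x y (componentwise_small A B D f g \<eta>).
           ereal (1 / \<eta>) * quotient_norm_inf dy y)" for \<eta>
    by (intro SUP_cong refl) (simp only: quotient_norm_inf_nonzero[OF y y0] times_ereal.simps times_divide_eq_left mult_1)
  then show ?thesis
    using componentwise_limit[OF As Bt, of "\<lambda>i. 1 / y $ i"] unfolding has_componentwise_cond_def N' by simp
qed

end

section \<open>Regularized least squares\<close>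

text \<open>The residual of a least-squares solution is orthogonal to the range: along \<open>y + t z\<close> the
  objective is a quadratic polynomial in \<open>t\<close> with its minimum at 0.\<close>

lemma least_squares_orthogonality:
  fixes M :: "real mat"
  assumes M: "M \<in> carrier_mat a b" and c: "c \<in> carrier_vec a"
    and min: "is_arg_min (\<lambda>z. (norm2_vec (M *\<^sub>v z - c))\<^sup>2) (\<lambda>z. z \<in> carrier_vec b) y"
    and z: "z \<in> carrier_vec b"
  shows "(M *\<^sub>v z) \<bullet> (M *\<^sub>v y - c) = 0"
proof -
  have y: "y \<in> carrier_vec b"
    and le: "(norm2_vec (M *\<^sub>v y - c))\<^sup>2 \<le> (norm2_vec (M *\<^sub>v z' - c))\<^sup>2" if "z' \<in> carrier_vec b" for z'
    using min that by (auto simp: is_arg_min_def not_less)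
  have sq: "(norm2_vec v)\<^sup>2 = v \<bullet> v" for v
  proof -
    have "0 \<le> v \<bullet> v" by (auto simp: scalar_prod_def intro!: sum_nonneg)
    then show ?thesis by (simp add: norm2_vec_def)
  qed
  define e u where "e = M *\<^sub>v y - c" and "u = M *\<^sub>v z"
  have yb: "y \<in> carrier_vec b" by (rule y[OF z])
  have e: "e \<in> carrier_vec a" and u: "u \<in> carrier_vec a" using M c yb z by (auto simp: e_def u_def)
  have quad: "0 \<le> 2 * t * (u \<bullet> e) + t\<^sup>2 * (u \<bullet> u)" for t
  proof -
    have "M *\<^sub>v (y + t \<cdot>\<^sub>v z) - c = e + t \<cdot>\<^sub>v u"
      using M c yb z by (auto simp: e_def u_def mult_add_distrib_mat_vec[OF M] mult_mat_vec[OF M])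
    then have "e \<bullet> e \<le> (e + t \<cdot>\<^sub>v u) \<bullet> (e + t \<cdot>\<^sub>v u)"
      using le[of "y + t \<cdot>\<^sub>v z"] yb z unfolding sq e_def by simp
    also have "\<dots> = e \<bullet> e + 2 * t * (u \<bullet> e) + t\<^sup>2 * (u \<bullet> u)"
      using e u comm_scalar_prod[OF e u]
      by (simp add: add_scalar_prod_distrib[of _ a] scalar_prod_add_distrib[of _ a] power2_eq_square algebra_simps)
    finally show ?thesis by simp
  qed
  have uu: "0 \<le> u \<bullet> u" by (auto simp: scalar_prod_def intro!: sum_nonneg)
  \<comment> \<open>The summand 1 avoids a case distinction on \<open>u = 0\<close>; a step short of the vertex of the parabola suffices.\<close>
  define s where "s = (u \<bullet> e) / (u \<bullet> u + 1)"
  have "u \<bullet> e = s * (u \<bullet> u + 1)" using uu by (simp add: s_def)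
  then have "0 \<le> 2 * (- s) * (s * (u \<bullet> u + 1)) + s\<^sup>2 * (u \<bullet> u)"
    using quad[of "- s"] by simp
  also have "\<dots> = - (s\<^sup>2 * (u \<bullet> u + 2))" by (simp add: power2_eq_square algebra_simps)
  finally have "s\<^sup>2 * (u \<bullet> u + 2) \<le> 0" by simp
  then have "s = 0" using uu by (auto simp: mult_le_0_iff)
  with \<open>u \<bullet> e = s * (u \<bullet> u + 1)\<close> show ?thesis by (simp add: u_def e_def)
qed

lemma scalar_prod_self_eq_0:
  fixes v :: "real vec"
  assumes v: "v \<in> carrier_vec k" and 0: "v \<bullet> v = 0"
  shows "v = 0\<^sub>v k"
proof (rule eq_vecI)
  fix i assume "i < dim_vec (0\<^sub>v k :: real vec)"
  then have "\<bar>v $ i\<bar> \<le> norm2_vec v" "i < k" using v by (auto intro: abs_index_le_norm2_vec)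
  then show "v $ i = 0\<^sub>v k $ i" using 0 by (simp add: norm2_vec_def)
qed (use v in simp)

lemma smult_one_mult_vec:
  fixes v :: "real vec"
  assumes v: "v \<in> carrier_vec k"
  shows "(c \<cdot>\<^sub>m 1\<^sub>m k) *\<^sub>v v = c \<cdot>\<^sub>v v"
proof -
  have "c \<cdot>\<^sub>m 1\<^sub>m k = mat_diag k (\<lambda>_. c)" by (auto simp: mat_diag_def)
  then show ?thesis using v by (auto simp: mat_diag_mult_vec[OF v])
qed

lemma spd_mat_kernel:
  assumes "spd_mat m W" "v \<in> carrier_vec m" "W *\<^sub>v v = 0\<^sub>v m"
  shows "v = 0\<^sub>v m"
  using assms by (force simp: spd_mat_def)

lemma spd_mat_inverse:
  assumes W: "spd_mat m W"
  shows "mat_inv W \<in> symmetric_mats m" "mat_inv W * W = 1\<^sub>m m" "W * mat_inv W = 1\<^sub>m m"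
proof -
  have Wc: "W \<in> carrier_mat m m" and sym: "W\<^sup>T = W" using W by (auto simp: spd_mat_def symmetric_mats_def)
  note I = inverse_mat_exists[OF Wc spd_mat_kernel[OF W]]
  show "mat_inv W * W = 1\<^sub>m m" "W * mat_inv W = 1\<^sub>m m" using I by blast+
  have "(mat_inv W)\<^sup>T * W = 1\<^sub>m m"
    using transpose_mult[OF Wc I(1)] I(3) sym by simp
  then have "mat_inv W = (mat_inv W)\<^sup>T"
    using I(1) by (intro mat_inv_left_inverse[OF Wc]) auto
  then show "mat_inv W \<in> symmetric_mats m" using I(1) by (simp add: symmetric_mats_def)
qed

lemma transpose_toeplitz: "Q \<in> toeplitz_mats m n \<Longrightarrow> Q\<^sup>T \<in> toeplitz_mats n m"
proof -
  assume "Q \<in> toeplitz_mats m n"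
  then obtain t where "Q = toeplitz_of m n t" by (auto simp: toeplitz_mats_def)
  then have "Q\<^sup>T = toeplitz_of n m (\<lambda>k. t (- k))"
    by (intro eq_matI) (auto simp: toeplitz_of_def)
  then show ?thesis by (auto simp: toeplitz_mats_def)
qed

theorem theorem5p1:
  fixes m n :: nat and Q W Wh A D Mh S K G :: "real mat" and lam :: real
    and f y r d Ny :: "real vec"
  assumes "n \<le> m"
    and "Q \<in> toeplitz_mats m n" and "vec_space.rank m Q = n"
    and "spd_mat m W"
    and "spd_mat m Wh" and "Wh * Wh = W"
    and "lam > 0"
    and "f \<in> carrier_vec m"
    and "is_arg_min
           (\<lambda>z. (norm2_vec (((Wh * Q) @\<^sub>r (sqrt lam \<cdot>\<^sub>m 1\<^sub>m n)) *\<^sub>v z - ((Wh *\<^sub>v f) @\<^sub>v 0\<^sub>v n)))\<^sup>2)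
           (\<lambda>z. z \<in> carrier_vec n) y"
    and "y \<noteq> 0\<^sub>v n"
    and "r = W *\<^sub>v (f - Q *\<^sub>v y)"
    and "A = mat_inv W" and "D = - (lam \<cdot>\<^sub>m 1\<^sub>m n)"
    and "S = - (lam \<cdot>\<^sub>m 1\<^sub>m n + Q\<^sup>T * W * Q)"
    and "K = - (mat_inv S * Q\<^sup>T * W)"
    and "Mh = four_block_mat (mat_inv W) Q (Q\<^sup>T) (- (lam \<cdot>\<^sub>m 1\<^sub>m n))"
    and "d = f @\<^sub>v 0\<^sub>v n"
    and "Ny = abs_mat ((row_mat r \<otimes>\<^sub>K K) * Phi_sym m) *\<^sub>v vec_sym (abs_mat A)
            + abs_mat ((K \<otimes>\<^sub>K row_mat y + row_mat r \<otimes>\<^sub>K mat_inv S) * Phi_toep n m)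
                *\<^sub>v vec_toep (abs_mat (Q\<^sup>T))
            + abs_mat (mat_inv S) *\<^sub>v (abs_mat D *\<^sub>v abs_vec y)
            + abs_mat K *\<^sub>v abs_vec f"
    and "G = ((row_mat r \<otimes>\<^sub>K K) * Phi_sym m * mat_inv (weight_sym m))
            @\<^sub>c ((K \<otimes>\<^sub>K row_mat y + row_mat r \<otimes>\<^sub>K mat_inv S) * Phi_toep n m
                  * mat_inv (weight_toep n m))
            @\<^sub>c (row_mat y \<otimes>\<^sub>K mat_inv S) @\<^sub>c (- K) @\<^sub>c (- mat_inv S)"
  shows "has_normwise_cond (sym_toep_structure m n) A (Q\<^sup>T) D f (0\<^sub>v n) r y
           (ereal (spectral_norm G
             / (norm2_vec y / frobenius_norm (append_col (saddle_data A (Q\<^sup>T) D) d))))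
       \<and> has_normwise_cond_rel (frobenius_norm (append_col Mh d))
           (sym_toep_structure m n) A (Q\<^sup>T) D f (0\<^sub>v n) r y
           (ereal (spectral_norm G / (norm2_vec y / frobenius_norm (append_col Mh d))))
       \<and> has_mixed_cond (sym_toep_structure m n) A (Q\<^sup>T) D f (0\<^sub>v n) r y
           (ereal (norm_inf_vec Ny / norm_inf_vec y))
       \<and> ((\<forall>i<m. r $ i \<noteq> 0) \<and> (\<forall>i<n. y $ i \<noteq> 0) \<longrightarrow>
          has_componentwise_cond (sym_toep_structure m n) A (Q\<^sup>T) D f (0\<^sub>v n) r y
            (ereal (norm_inf_vec (pseudo_inverse (mat_diag n (\<lambda>i. y $ i)) *\<^sub>v Ny))))"
proof -
  have Q: "Q \<in> carrier_mat m n" by (rule toeplitz_mats_carrier[OF assms(2)])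
  have Ws: "W \<in> symmetric_mats m" and Whs: "Wh \<in> symmetric_mats m"
    using assms(4,5) by (auto simp: spd_mat_def)
  have W: "W \<in> carrier_mat m m" and Wh: "Wh \<in> carrier_mat m m" and WhT: "Wh\<^sup>T = Wh"
    using Ws Whs by (auto simp: symmetric_mats_def)
  note f = assms(8)
  note Winv = spd_mat_inverse[OF assms(4)]
  have As: "A \<in> symmetric_mats m" and WA: "W * A = 1\<^sub>m m" and AW: "A * W = 1\<^sub>m m"
    using Winv by (simp_all add: assms(12))
  have A: "A \<in> carrier_mat m m" by (rule symmetric_mats_carrier[OF As])
  have y: "y \<in> carrier_vec n" using assms(9) by (simp add: is_arg_min_def)
  have n0: "0 < n" using y assms(10) by (cases n) auto
  have m0: "0 < m" using n0 assms(1) by simp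
  have Qy: "Q *\<^sub>v y \<in> carrier_vec m" and fQy: "f - Q *\<^sub>v y \<in> carrier_vec m" using Q y f by auto
  have r: "r \<in> carrier_vec m" using W fQy by (simp add: assms(11))
  have QT: "Q\<^sup>T \<in> carrier_mat n m" using Q by simp
  have Dc: "D \<in> carrier_mat n n" by (simp add: assms(13))
  have Dv: "D *\<^sub>v v = - (lam \<cdot>\<^sub>v v)" if "v \<in> carrier_vec n" for v
    using that by (simp add: assms(13) smult_one_mult_vec)
  have WQ: "Q\<^sup>T * W * Q \<in> carrier_mat n n" using QT W Q by simp
  have S: "S \<in> carrier_mat n n" using WQ by (simp add: assms(14))
  \<comment> \<open>The form of \<open>- S\<close> at \<open>v\<close> is \<open>lam (v \<bullet> v)\<close> plus the form of \<open>W\<close> at \<open>Q v\<close>.\<close>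
  have S_ker: "v = 0\<^sub>v n" if v: "v \<in> carrier_vec n" and 0: "S *\<^sub>v v = 0\<^sub>v n" for v
  proof -
    have Qv: "Q *\<^sub>v v \<in> carrier_vec m" and WQv: "W *\<^sub>v (Q *\<^sub>v v) \<in> carrier_vec m" using Q W v by auto
    have L: "lam \<cdot>\<^sub>m 1\<^sub>m n \<in> carrier_mat n n" by simp
    let ?u = "lam \<cdot>\<^sub>v v + Q\<^sup>T *\<^sub>v (W *\<^sub>v (Q *\<^sub>v v))"
    have u: "?u \<in> carrier_vec n" using v QT WQv by simp
    have "S *\<^sub>v v = - ((lam \<cdot>\<^sub>m 1\<^sub>m n) *\<^sub>v v + (Q\<^sup>T * W * Q) *\<^sub>v v)"
      using v Q by (simp add: assms(14) add_mult_distrib_mat_vec[OF L WQ v])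
    also have "(Q\<^sup>T * W * Q) *\<^sub>v v = Q\<^sup>T *\<^sub>v (W *\<^sub>v (Q *\<^sub>v v))"
      using assoc_mult_mat_vec[OF mult_carrier_mat[OF QT W] Q v] assoc_mult_mat_vec[OF QT W Qv] by simp
    finally have "- ?u = 0\<^sub>v n" using 0 by (simp add: smult_one_mult_vec[OF v])
    then have "?u = 0\<^sub>v n" using uminus_zero_vec_eq[OF u] by simp
    then have "0 = ?u \<bullet> v" using v by simp
    also have "\<dots> = lam * (v \<bullet> v) + (W *\<^sub>v (Q *\<^sub>v v)) \<bullet> (Q *\<^sub>v v)"
      using v QT WQv transpose_vec_mult_scalar[OF Q v WQv] by (simp add: add_scalar_prod_distrib[of _ n])
    also have "(W *\<^sub>v (Q *\<^sub>v v)) \<bullet> (Q *\<^sub>v v) = (Q *\<^sub>v v) \<bullet> (W *\<^sub>v (Q *\<^sub>v v))"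
      by (rule comm_scalar_prod[OF WQv Qv])
    finally have "lam * (v \<bullet> v) + (Q *\<^sub>v v) \<bullet> (W *\<^sub>v (Q *\<^sub>v v)) = 0" by simp
    moreover have "0 \<le> (Q *\<^sub>v v) \<bullet> (W *\<^sub>v (Q *\<^sub>v v))"
    proof (cases "Q *\<^sub>v v = 0\<^sub>v m")
      case True then show ?thesis using WQv by simp
    next
      case False then show ?thesis using assms(4) Qv by (auto simp: spd_mat_def intro: less_imp_le)
    qed
    moreover have "0 \<le> v \<bullet> v" by (auto simp: scalar_prod_def intro!: sum_nonneg)
    ultimately have "lam * (v \<bullet> v) = 0" using assms(7) by (smt (verit) mult_nonneg_nonneg)
    then show ?thesis using scalar_prod_self_eq_0[OF v] assms(7) by simp
  qed
  note Sinv = inverse_mat_exists[OF S S_ker]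
  have schur: "D - Q\<^sup>T * W * (Q\<^sup>T)\<^sup>T = S"
    using WQ by (intro eq_matI) (auto simp: assms(13,14))
  have lower: "Q\<^sup>T *\<^sub>v r + D *\<^sub>v y = 0\<^sub>v n"
  proof -
    let ?M = "(Wh * Q) @\<^sub>r (sqrt lam \<cdot>\<^sub>m 1\<^sub>m n)" and ?c = "(Wh *\<^sub>v f) @\<^sub>v 0\<^sub>v n"
    have WhQ: "Wh * Q \<in> carrier_mat m n" and L: "sqrt lam \<cdot>\<^sub>m 1\<^sub>m n \<in> carrier_mat n n" using Wh Q by auto
    have M: "?M \<in> carrier_mat (m + n) n" using WhQ L by simp
    have c: "?c \<in> carrier_vec (m + n)" using Wh f by simp
    have Mv: "?M *\<^sub>v v = (Wh *\<^sub>v (Q *\<^sub>v v)) @\<^sub>v (sqrt lam \<cdot>\<^sub>v v)" if "v \<in> carrier_vec n" for v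
      using that assoc_mult_mat_vec[OF Wh Q that] by (simp add: mat_mult_append[OF WhQ L that] smult_one_mult_vec)
    have WhfQy: "Wh *\<^sub>v (f - Q *\<^sub>v y) \<in> carrier_vec m" using Wh fQy by simp
    have res: "?M *\<^sub>v y - ?c = (- (Wh *\<^sub>v (f - Q *\<^sub>v y))) @\<^sub>v (sqrt lam \<cdot>\<^sub>v y)"
      unfolding Mv[OF y] mult_minus_distrib_mat_vec[OF Wh f Qy]
      using Wh f Qy y by (intro eq_vecI) auto
    \<comment> \<open>Orthogonality is tested against the residual \<open>w\<close> of the lower equation itself, which gives
      \<open>w \<bullet> w = 0\<close>.\<close>
    define w where "w = Q\<^sup>T *\<^sub>v r - lam \<cdot>\<^sub>v y"
    have QTr: "Q\<^sup>T *\<^sub>v r \<in> carrier_vec n" using QT r by simp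
    have w: "w \<in> carrier_vec n" using QTr y by (simp add: w_def)
    have Qw: "Q *\<^sub>v w \<in> carrier_vec m" and WhQw: "Wh *\<^sub>v (Q *\<^sub>v w) \<in> carrier_vec m" using Q Wh w by auto
    have "0 = (?M *\<^sub>v w) \<bullet> (?M *\<^sub>v y - ?c)"
      using least_squares_orthogonality[OF M c assms(9) w] by simp
    also have "\<dots> = (Wh *\<^sub>v (Q *\<^sub>v w)) \<bullet> (- (Wh *\<^sub>v (f - Q *\<^sub>v y))) + (sqrt lam \<cdot>\<^sub>v w) \<bullet> (sqrt lam \<cdot>\<^sub>v y)"
      unfolding res Mv[OF w] using WhQw WhfQy w y by (intro scalar_prod_append) auto
    also have "(sqrt lam \<cdot>\<^sub>v w) \<bullet> (sqrt lam \<cdot>\<^sub>v y) = w \<bullet> (lam \<cdot>\<^sub>v y)"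
      using w y assms(7) by simp
    also have "(Wh *\<^sub>v (Q *\<^sub>v w)) \<bullet> (- (Wh *\<^sub>v (f - Q *\<^sub>v y))) = - ((Wh *\<^sub>v (Q *\<^sub>v w)) \<bullet> (Wh *\<^sub>v (f - Q *\<^sub>v y)))"
      using WhQw WhfQy by simp
    also have "(Wh *\<^sub>v (Q *\<^sub>v w)) \<bullet> (Wh *\<^sub>v (f - Q *\<^sub>v y)) = (Q *\<^sub>v w) \<bullet> (Wh *\<^sub>v (Wh *\<^sub>v (f - Q *\<^sub>v y)))"
      using transpose_vec_mult_scalar[OF Wh WhfQy Qw] unfolding WhT .
    also have "Wh *\<^sub>v (Wh *\<^sub>v (f - Q *\<^sub>v y)) = r"
      using assoc_mult_mat_vec[OF Wh Wh fQy] by (simp add: assms(6,11))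
    also have "(Q *\<^sub>v w) \<bullet> r = w \<bullet> (Q\<^sup>T *\<^sub>v r)"
      using transpose_vec_mult_scalar[OF Q w r] comm_scalar_prod[OF w QTr] comm_scalar_prod[OF Qw r] by simp
    finally have "w \<bullet> (Q\<^sup>T *\<^sub>v r) - w \<bullet> (lam \<cdot>\<^sub>v y) = 0" by simp
    then have "w \<bullet> w = 0"
      using scalar_prod_minus_distrib[OF w QTr, of "lam \<cdot>\<^sub>v y"] y by (simp add: w_def[symmetric])
    then have "w = 0\<^sub>v n" by (rule scalar_prod_self_eq_0[OF w])
    then show ?thesis
      using QTr y by (simp add: Dv[OF y] w_def minus_add_uminus_vec[of _ n])
  qed
  have upper: "A *\<^sub>v r + (Q\<^sup>T)\<^sup>T *\<^sub>v y = f"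
  proof -
    have "A *\<^sub>v r = f - Q *\<^sub>v y"
      unfolding assms(11) using assoc_mult_mat_vec[OF A W fQy] AW fQy by simp
    then show ?thesis using f Q y by (intro eq_vecI) auto
  qed
  interpret structured_saddle_point m n A W "Q\<^sup>T" D "mat_inv S" K f "0\<^sub>v n" r y
    by unfold_locales (use A W WA QT Dc Sinv schur assms(15) f r y upper lower m0 n0 in auto)
  have G: "G = weighted_coeff"
    by (simp add: assms(19) weighted_coeff_def coeff_A_def coeff_B_def)
  have Ny: "Ny = componentwise_bound"
  proof -
    have "abs_mat (mat_inv S) *\<^sub>v abs_vec (0\<^sub>v n) = 0\<^sub>v n"
      using Sinv(1) by (intro eq_vecI) (auto simp: scalar_prod_def)
    then show ?thesis
      using K_carrier by (auto simp: assms(18) componentwise_bound_def coeff_A_def coeff_B_def)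
  qed
  \<comment> \<open>The data are nonzero because the block \<open>D\<close> has the entry \<open>- lam\<close> in its first corner.\<close>
  have pos: "0 < frobenius_norm (append_col M d)"
    if M: "M \<in> carrier_mat (m + n) (m + n)" and corner: "M $$ (m,m) = - lam" for M
  proof -
    have "append_col M d $$ (m,m) = - lam" "m < dim_row (append_col M d)" "m < dim_col (append_col M d)"
      using M corner n0 f by (auto simp: append_col_def mat_of_cols_def nth_append assms(17))
    with abs_index_le_frobenius_norm[of m "append_col M d" m] assms(7) show ?thesis by simp
  qed
  have \<rho>1: "0 < frobenius_norm (append_col (saddle_data A (Q\<^sup>T) D) d)"
    using A QT Dc n0 by (intro pos) (auto simp: saddle_data_def assms(13))
  have \<rho>2: "0 < frobenius_norm (append_col Mh d)"
    using A QT Q n0 by (intro pos) (auto simp: assms(12,16))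
  show ?thesis
    using normwise_condition_number[OF assms(10) \<rho>1] normwise_condition_number[OF assms(10) \<rho>2]
      mixed_condition_number[OF As transpose_toeplitz[OF assms(2)]]
      componentwise_condition_number[OF As transpose_toeplitz[OF assms(2)]]
    unfolding has_normwise_cond_def G Ny assms(17)[symmetric] by blast
qed

end
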